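(* Let $n\ge 3$ and let $r\geq 2$ be an integer. Then $$\mathrm{Ind}(M_r(K_n))\simeq\begin{cases}\bigvee_{(n-1)^k}\mathbb{S}^{2k-1} & \text{if } r=3k,\\ \bigvee_{n(n-1)^k}\mathbb{S}^{2k} & \text{if } r=3k+1,\\ \bigvee_{(n-1)^{k+1}}\mathbb{S}^{2k+1} & \text{if } r=3k+2.\end{cases}$$
   Context: $K_n$ is the complete graph on $n$ vertices. For $r\ge 1$, $L_r$ is the graph with vertex set $\{0,\dots,r\}$, edges $\{i,i+1\}$ for $0\le i\le r-1$, and a loop at $0$. The categorical product $G\times H$ has vertex set $V(G)\times V(H)$ with $(g,h)\sim(g',h')$ iff $g\sim g'$ in $G$ and $h\sim h'$ in $H$. The $r$-th generalised Mycielskian $M_r(G)$ is $(G\times L_r)/\sim_r$, obtained by identifying all vertices with second coordinate $r$ into a single vertex (adjacencies inherited). The independence complex $\mathrm{Ind}(G)$ is the simplicial complex of independent vertex sets of $G$. $\simeq$ denotes homotopy equivalence of geometric realizations; $\bigvee_m\mathbb{S}^d$ is a wedge of $m$ copies of $\mathbb{S}^d$. *)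

theory Defs
  imports "HOL-Analysis.Analysis" "Graph_Theory.Graph_Theory"
begin

(* Graphs are symmetric pair_pre_digraphs: an edge {u,v} is the pair of arcs (u,v), (v,u), and a
   loop at u is the arc (u,u). *)

definition looped_path :: "nat \<Rightarrow> nat pair_pre_digraph" where
  "looped_path r = \<lparr> pverts = {0..r},
     parcs = {(0, 0)} \<union> {(i, Suc i) | i. i < r} \<union> {(Suc i, i) | i. i < r} \<rparr>"

definition categorical_product ::
  "'a pair_pre_digraph \<Rightarrow> 'b pair_pre_digraph \<Rightarrow> ('a \<times> 'b) pair_pre_digraph" where
  "categorical_product G H = \<lparr> pverts = pverts G \<times> pverts H,
     parcs = {((g, h), (g', h')) | g h g' h'. (g, g') \<in> parcs G \<and> (h, h') \<in> parcs H} \<rparr>"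

(* Two classes are adjacent iff they have adjacent representatives. *)
definition quotient_graph :: "'a pair_pre_digraph \<Rightarrow> 'a rel \<Rightarrow> 'a set pair_pre_digraph" where
  "quotient_graph G R = \<lparr> pverts = pverts G // R,
     parcs = {(R `` {u}, R `` {v}) | u v. (u, v) \<in> parcs G} \<rparr>"

definition mycielskian :: "nat \<Rightarrow> 'a pair_pre_digraph \<Rightarrow> ('a \<times> nat) set pair_pre_digraph" where
  "mycielskian r G =
     (let P = categorical_product G (looped_path r)
      in quotient_graph P
           {(u, v) \<in> pverts P \<times> pverts P. u = v \<or> snd u = r \<and> snd v = r})"

(* The case u = v is included: a vertex carrying a loop lies in no independent set.
   The empty set is a face. *)
definition independence_complex :: "'a pair_pre_digraph \<Rightarrow> 'a set set" where
  "independence_complex G =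
     {S. finite S \<and> S \<subseteq> pverts G \<and> (\<forall>u\<in>S. \<forall>v\<in>S. (u, v) \<notin> parcs G)}"

(* Barycentric coordinates, extended by 0. For complexes with finitely many vertices (the only ones
   used here) the product topology agrees with the weak topology. *)
definition geometric_realization :: "'a set set \<Rightarrow> ('a \<Rightarrow> real) topology" where
  "geometric_realization K =
     subtopology (powertop_real UNIV)
       {x. (\<forall>v. 0 \<le> x v) \<and> {v. x v \<noteq> 0} \<in> K \<and> (\<Sum>v | x v \<noteq> 0. x v) = 1}"

definition quotient_topology :: "'a topology \<Rightarrow> ('a \<Rightarrow> 'b) \<Rightarrow> 'b topology" where
  "quotient_topology X f =
     topology (\<lambda>U. U \<subseteq> f ` topspace X \<and> openin X {x \<in> topspace X. f x \<in> U})"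

lemma openin_quotient_topology:
  "openin (quotient_topology X f) U \<longleftrightarrow>
     U \<subseteq> f ` topspace X \<and> openin X {x \<in> topspace X. f x \<in> U}"
proof -
  have "istopology (\<lambda>U. U \<subseteq> f ` topspace X \<and> openin X {x \<in> topspace X. f x \<in> U})"
    unfolding istopology_def
  proof (intro conjI allI impI)
    fix S T
    assume S: "S \<subseteq> f ` topspace X \<and> openin X {x \<in> topspace X. f x \<in> S}"
      and T: "T \<subseteq> f ` topspace X \<and> openin X {x \<in> topspace X. f x \<in> T}"
    then show "S \<inter> T \<subseteq> f ` topspace X" by blast
    have "{x \<in> topspace X. f x \<in> S \<inter> T} =
        {x \<in> topspace X. f x \<in> S} \<inter> {x \<in> topspace X. f x \<in> T}" by blast
    with S T show "openin X {x \<in> topspace X. f x \<in> S \<inter> T}" by (simp add: openin_Int)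
  next
    fix \<K>
    assume K: "\<forall>U\<in>\<K>. U \<subseteq> f ` topspace X \<and> openin X {x \<in> topspace X. f x \<in> U}"
    then show "\<Union>\<K> \<subseteq> f ` topspace X" by blast
    have "{x \<in> topspace X. f x \<in> \<Union>\<K>} = (\<Union>U\<in>\<K>. {x \<in> topspace X. f x \<in> U})" by blast
    with K show "openin X {x \<in> topspace X. f x \<in> \<Union>\<K>}" by auto
  qed
  then show ?thesis by (simp add: quotient_topology_def)
qed

lemma topspace_quotient_topology: "topspace (quotient_topology X f) = f ` topspace X"
proof
  show "topspace (quotient_topology X f) \<subseteq> f ` topspace X"
    unfolding topspace_def[of "quotient_topology X f"] by (auto simp: openin_quotient_topology)
  have "{x \<in> topspace X. f x \<in> f ` topspace X} = topspace X" by blast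
  then have "openin (quotient_topology X f) (f ` topspace X)"
    by (simp add: openin_quotient_topology)
  then show "f ` topspace X \<subseteq> topspace (quotient_topology X f)" by (rule openin_subset)
qed

lemma quotient_map_quotient_topology: "quotient_map X (quotient_topology X f) f"
  by (auto simp: quotient_map_def topspace_quotient_topology openin_quotient_topology)

(* The wedge of the pointed spaces (X i, p i), for nonempty I: all points (i, p i) of the disjoint
   union are identified to the single point None, and nothing else is. *)
definition wedge_sum ::
  "('i \<Rightarrow> 'a topology) \<Rightarrow> ('i \<Rightarrow> 'a) \<Rightarrow> 'i set \<Rightarrow> ('i \<times> 'a) option topology" where
  "wedge_sum X p I =
     quotient_topology (sum_topology X I) (\<lambda>(i, x). if x = p i then None else Some (i, x))"

definition wedge_of_spheres :: "nat \<Rightarrow> nat \<Rightarrow> (nat \<times> (nat \<Rightarrow> real)) option topology" where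
  "wedge_of_spheres m d =
     wedge_sum (\<lambda>_. nsphere d) (\<lambda>_ i. if i = 0 then 1 else 0) {..<m}"

end

theory Submission
  imports Defs
begin

text \<open>Write \<open>w\<close> for the contracted top vertex. For \<open>r \<ge> 4\<close>, make \<open>w\<close> adjacent to level \<open>r - 4\<close>
  (a collapse), then nonadjacent to level \<open>r - 1\<close> (the inverse of a collapse), then delete level
  \<open>r - 3\<close> by folding. What remains is the disjoint union of \<open>M\<^bsub>r-3\<^esub>(K\<^sub>n)\<close> and the crown graph
  \<open>K\<^sub>n \<times> K\<^sub>2\<close>, so the independence complex becomes a join. The crown graph and
  \<open>M\<^sub>1\<close>, \<open>M\<^sub>2\<close>, \<open>M\<^sub>3\<close> (the last after collapsing) have perfect matchings whose critical
  faces are facets of one dimension, and this property passes to joins. Finally, a complex that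
  becomes collapsible after removing \<open>m\<close> facets of dimension \<open>d\<close> is a wedge of \<open>m\<close> spheres
  \<open>S\<^sup>d\<close>: crush the contractible rest to a point.\<close>

section \<open>Geometric realizations and elementary collapses\<close>

text \<open>The move that detaches the contracted vertex from level \<open>r - 1\<close> is an
  expansion, so the chain of moves is not a collapse. A perfect matching is therefore asserted only
  for some complex reached by a zigzag of collapses and expansions, each of them a homotopy
  equivalence. Requiring the critical faces to be facets avoids all attaching maps: deleting them
  leaves a subcomplex, and crushing that subcomplex turns each critical facet into a simplex modulo
  its boundary, which is a sphere. Matching the empty face too keeps the bookkeeping multiplicative:
  the critical faces of a join are the unions of critical faces of the factors, so their numbers
  multiply and their cardinalities add, and no topological join of wedges is ever formed. The
  independence complex of the crown graph is two full simplices joined by \<open>n\<close> disjoint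
  edges, up to homotopy a wedge of \<open>n - 1\<close> circles; hence a factor \<open>n - 1\<close>
  and two extra dimensions for every three levels.\<close>

definition fin_complex :: "'a set set \<Rightarrow> bool" where
  "fin_complex K \<longleftrightarrow> finite K \<and> (\<forall>S\<in>K. finite S \<and> Pow S \<subseteq> K)"

abbreviation supp :: "('a \<Rightarrow> real) \<Rightarrow> 'a set" where
  "supp x \<equiv> {v. x v \<noteq> 0}"

definition realization_points :: "'a set set \<Rightarrow> ('a \<Rightarrow> real) set" where
  "realization_points K = {x. (\<forall>v. 0 \<le> x v) \<and> supp x \<in> K \<and> (\<Sum>v\<in>supp x. x v) = 1}"

lemma fin_complexD:
  assumes "fin_complex K"
  shows "finite K" "S \<in> K \<Longrightarrow> finite S" "S \<in> K \<Longrightarrow> T \<subseteq> S \<Longrightarrow> T \<in> K"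
  using assms by (auto simp: fin_complex_def)

lemma geometric_realization_eq:
  "geometric_realization K = subtopology (powertop_real UNIV) (realization_points K)"
  by (simp add: geometric_realization_def realization_points_def)

lemma topspace_geometric_realization [simp]:
  "topspace (geometric_realization K) = realization_points K"
  by (simp add: geometric_realization_eq)

lemma realization_points_mono: "K \<subseteq> L \<Longrightarrow> realization_points K \<subseteq> realization_points L"
  by (auto simp: realization_points_def)

lemma realization_pointsI:
  assumes "fin_complex K" "S \<in> K" "\<And>v. 0 \<le> x v" "\<And>v. v \<notin> S \<Longrightarrow> x v = 0" "sum x S = 1"
  shows "x \<in> realization_points K"
proof -
  have sub: "supp x \<subseteq> S" using assms(4) by auto
  then have "supp x \<in> K" using assms fin_complexD by blast
  moreover have "sum x (supp x) = sum x S"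
    using sub fin_complexD(2)[OF assms(1,2)] by (intro sum.mono_neutral_left) auto
  ultimately show ?thesis using assms by (simp add: realization_points_def)
qed

lemma realization_pointsD:
  assumes "x \<in> realization_points K"
  shows "0 \<le> x v" "supp x \<in> K" "finite A \<Longrightarrow> supp x \<subseteq> A \<Longrightarrow> sum x A = 1"
proof -
  show "0 \<le> x v" "supp x \<in> K" using assms by (auto simp: realization_points_def)
  assume "finite A" "supp x \<subseteq> A"
  then have "sum x (supp x) = sum x A" by (intro sum.mono_neutral_left) auto
  then show "sum x A = 1" using assms by (simp add: realization_points_def)
qed

lemma continuous_map_into_realization:
  "continuous_map X (geometric_realization K) f \<longleftrightarrow>
    (\<forall>v. continuous_map X euclideanreal (\<lambda>x. f x v)) \<and> (\<forall>x\<in>topspace X. f x \<in> realization_points K)"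
  by (auto simp: geometric_realization_eq continuous_map_in_subtopology continuous_map_componentwise_UNIV)

lemma continuous_map_realization_coordinate [continuous_intros]:
  "continuous_map (geometric_realization K) euclideanreal (\<lambda>x. x v)"
  by (auto simp: geometric_realization_eq intro!: continuous_intros)

lemma continuous_map_Min_image:
  fixes f :: "'b \<Rightarrow> 'i \<Rightarrow> real"
  assumes "finite I" "I \<noteq> {}" "\<And>i. i \<in> I \<Longrightarrow> continuous_map X euclideanreal (\<lambda>x. f x i)"
  shows "continuous_map X euclideanreal (\<lambda>x. Min (f x ` I))"
  using assms
proof (induction I rule: finite_ne_induct)
  case (insert i I)
  then show ?case by (simp add: continuous_map_real_min)
qed simp

lemma continuous_map_subset_realization:
  assumes "K \<subseteq> L" shows "continuous_map (geometric_realization K) (geometric_realization L) id"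
  using realization_points_mono[OF assms]
  by (auto simp: continuous_map_into_realization intro!: continuous_intros)

text \<open>Convex combinations of two points stay in the closed face spanned by their supports,
  provided that this is a face. This pointwise form of contiguity yields the homotopies for both
  collapses and cones.\<close>

lemma homotopic_straight_line:
  assumes K: "fin_complex K"
    and f: "continuous_map X (geometric_realization K) f"
    and g: "continuous_map X (geometric_realization K) g"
    and common: "\<And>x. x \<in> topspace X \<Longrightarrow> supp (f x) \<union> supp (g x) \<in> K"
  shows "homotopic_with (\<lambda>_. True) X (geometric_realization K) f g"
proof -
  define h where "h = (\<lambda>(t::real, x). \<lambda>v. (1 - t) * f x v + t * g x v)"
  have "continuous_map (prod_topology (top_of_set {0..1}) X) (geometric_realization K) h"
    unfolding continuous_map_into_realization
  proof (intro conjI allI ballI)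
    have fg: "continuous_map X euclideanreal (\<lambda>x. f x v)" "continuous_map X euclideanreal (\<lambda>x. g x v)" for v
      using f g by (auto simp: continuous_map_into_realization)
    have fst: "continuous_map (prod_topology (top_of_set {0..1}) X) euclideanreal fst"
      using continuous_map_into_fulltopology continuous_map_fst by blast
    show "continuous_map (prod_topology (top_of_set {0..1}) X) euclideanreal (\<lambda>p. h p v)" for v
      unfolding h_def case_prod_unfold
      by (intro continuous_intros fst continuous_map_compose[OF continuous_map_snd fg(1), unfolded o_def]
          continuous_map_compose[OF continuous_map_snd fg(2), unfolded o_def])
    fix p :: "real \<times> 'b" assume "p \<in> topspace (prod_topology (top_of_set {0..1}) X)"
    then obtain t x where p: "p = (t, x)" "0 \<le> t" "t \<le> 1" "x \<in> topspace X" by auto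
    let ?S = "supp (f x) \<union> supp (g x)"
    have fx: "f x \<in> realization_points K" and gx: "g x \<in> realization_points K"
      using f g p by (auto simp: continuous_map_into_realization)
    have S: "?S \<in> K" "finite ?S" using common[OF p(4)] fin_complexD[OF K] by blast+
    show "h p \<in> realization_points K"
    proof (rule realization_pointsI[OF K S(1)])
      show "0 \<le> h p v" for v
        using realization_pointsD(1)[OF fx] realization_pointsD(1)[OF gx] p by (simp add: h_def)
      show "v \<notin> ?S \<Longrightarrow> h p v = 0" for v by (simp add: h_def p)
      have "sum (h p) ?S = (1 - t) * sum (f x) ?S + t * sum (g x) ?S"
        by (simp add: h_def p sum.distrib sum_distrib_left)
      then show "sum (h p) ?S = 1"
        using realization_pointsD(3)[OF fx S(2)] realization_pointsD(3)[OF gx S(2)] by auto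
    qed
  qed
  moreover have "h (0, x) = f x" "h (1, x) = g x" for x by (auto simp: h_def)
  ultimately show ?thesis unfolding homotopic_with_def by blast
qed

text \<open>Each point slides in the direction from the barycentre of \<open>\<tau>\<close> to
  \<open>v\<close> until some coordinate in \<open>\<tau>\<close> vanishes. Freeness of
  \<open>\<tau>\<close> means that only points supported on one of the two removed faces move at
  all, so the segment from a point to its image stays in one face.\<close>

lemma elementary_collapse_homotopy_equivalent:
  assumes K: "fin_complex K" and \<tau>: "\<tau> \<noteq> {}" "v \<notin> \<tau>" "insert v \<tau> \<in> K"
    and free: "\<And>T. T \<in> K \<Longrightarrow> \<tau> \<subseteq> T \<Longrightarrow> T = \<tau> \<or> T = insert v \<tau>"
  shows "geometric_realization K homotopy_equivalent_space
    geometric_realization (K - {\<tau>, insert v \<tau>})"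
proof -
  let ?K = "K - {\<tau>, insert v \<tau>}"
  have fin: "finite \<tau>" using fin_complexD[OF K] \<tau>(3) by (meson finite_insert)
  have K': "fin_complex ?K"
    unfolding fin_complex_def
  proof (intro conjI ballI)
    show "finite ?K" using fin_complexD(1)[OF K] by simp
    fix S assume "S \<in> ?K"
    then have S: "S \<in> K" "\<not> \<tau> \<subseteq> S" using free by auto
    then show "finite S" "Pow S \<subseteq> ?K" using fin_complexD[OF K] by auto
  qed
  \<comment> \<open>The amount \<open>m x\<close> taken from every vertex of \<open>\<tau>\<close>
    is handed to \<open>v\<close>, which preserves the coordinate sum. It is 0 unless the support
    contains \<open>\<tau>\<close>, so a single continuous formula serves on the whole
    complex.\<close>
  define m where "m x = Min (x ` \<tau>)" for x :: "'a \<Rightarrow> real"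
  define r where
    "r x = (\<lambda>u. if u \<in> \<tau> then x u - m x else if u = v then x u + real (card \<tau>) * m x else x u)" for x
  have m_le: "m x \<le> x u" if "u \<in> \<tau>" for x u using that fin by (simp add: m_def)
  have m_in: "\<exists>u\<in>\<tau>. x u = m x" for x
  proof -
    have "m x \<in> x ` \<tau>" using fin \<tau>(1) by (auto simp: m_def intro: Min_in)
    then show ?thesis by (metis imageE)
  qed
  have m_nn: "0 \<le> m x" if "x \<in> realization_points K" for x
    using m_in[of x] realization_pointsD(1)[OF that] by metis
  have m0: "m x = 0" if "x \<in> realization_points K" "\<not> \<tau> \<subseteq> supp x" for x
  proof -
    obtain u where "u \<in> \<tau>" "x u = 0" using \<open>\<not> \<tau> \<subseteq> supp x\<close> by auto
    then show ?thesis using m_le[of u x] m_nn[OF that(1)] by simp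
  qed
  have r_id: "r x = x" if "x \<in> realization_points K" "\<not> \<tau> \<subseteq> supp x" for x
    using m0[OF that] by (auto simp: r_def)
  have supp_K: "supp x = \<tau> \<or> supp x = insert v \<tau>" if "x \<in> realization_points K" "\<tau> \<subseteq> supp x" for x
    using free that realization_pointsD(2) by blast
  have r_in: "r x \<in> realization_points ?K" if x: "x \<in> realization_points K" for x
  proof (cases "\<tau> \<subseteq> supp x")
    case False
    then have "x \<in> realization_points ?K"
      using x \<tau> by (auto simp: realization_points_def)
    then show ?thesis using r_id[OF x False] by simp
  next
    case True
    \<comment> \<open>The vertex \<open>u\<close> attaining the minimum receives coordinate 0, so
      the image lies in \<open>insert v \<tau> - {u}\<close>, which survives because both removed
      faces contain \<open>u\<close>.\<close>
    obtain u where u: "u \<in> \<tau>" "x u = m x" using m_in by blast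
    have sub: "supp x \<subseteq> insert v \<tau>" using supp_K[OF x True] by auto
    show ?thesis
    proof (rule realization_pointsI[OF K'])
      show "insert v \<tau> - {u} \<in> ?K" using fin_complexD(3)[OF K \<tau>(3)] u(1) \<tau> by auto
      show "0 \<le> r x w" for w using m_le[of w x] m_nn[OF x] realization_pointsD(1)[OF x] by (simp add: r_def)
      show "r x w = 0" if "w \<notin> insert v \<tau> - {u}" for w
        using that sub u \<tau>(2) by (auto simp: r_def)
      have "sum (r x) (insert v \<tau> - {u}) = sum (r x) (insert v \<tau>)"
        using fin u \<tau>(2) by (intro sum.mono_neutral_left) (auto simp: r_def)
      also have "\<dots> = (x v + real (card \<tau>) * m x) + (\<Sum>w\<in>\<tau>. x w - m x)"
        using fin \<tau>(2) by (simp add: r_def)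
      also have "\<dots> = sum x (insert v \<tau>)" using fin \<tau>(2) by (simp add: sum_subtractf)
      also have "\<dots> = 1" using realization_pointsD(3)[OF x _ sub] fin by simp
      finally show "sum (r x) (insert v \<tau> - {u}) = 1" .
    qed
  qed
  have m_cont: "continuous_map (geometric_realization K) euclideanreal m"
    unfolding m_def using fin \<tau>(1) by (intro continuous_map_Min_image continuous_intros)
  have r_coord: "continuous_map (geometric_realization K) euclideanreal (\<lambda>x. r x w)" for w
    unfolding r_def by (auto intro!: continuous_intros m_cont)
  have r_cont: "continuous_map (geometric_realization K) (geometric_realization ?K) r"
    unfolding continuous_map_into_realization using r_coord r_in by simp
  have r_cont': "continuous_map (geometric_realization K) (geometric_realization K) r"
    unfolding continuous_map_into_realization
    using r_coord r_in realization_points_mono[of ?K K] by auto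
  have incl: "continuous_map (geometric_realization ?K) (geometric_realization K) id"
    by (rule continuous_map_subset_realization) auto
  have "homotopic_with (\<lambda>_. True) (geometric_realization K) (geometric_realization K) r id"
  proof (rule homotopic_straight_line[OF K r_cont' continuous_map_id])
    fix x assume "x \<in> topspace (geometric_realization K)"
    then have x: "x \<in> realization_points K" by simp
    show "supp (r x) \<union> supp (id x) \<in> K"
    proof (cases "\<tau> \<subseteq> supp x")
      case True
      then have "supp (r x) \<union> supp (id x) \<subseteq> insert v \<tau>"
        using supp_K[OF x True] by (auto simp: r_def)
      then show ?thesis using fin_complexD(3)[OF K \<tau>(3)] by blast
    next
      case False
      then show ?thesis using r_id[OF x False] realization_pointsD(2)[OF x] by simp
    qed
  qed
  moreover have "homotopic_with (\<lambda>_. True) (geometric_realization ?K) (geometric_realization ?K) (r \<circ> id) id"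
  proof (rule homotopic_with_equal)
    show "continuous_map (geometric_realization ?K) (geometric_realization ?K) (r \<circ> id)"
      using continuous_map_compose[OF incl r_cont] .
    fix x assume "x \<in> topspace (geometric_realization ?K)"
    then have x: "x \<in> realization_points ?K" by simp
    have "\<not> \<tau> \<subseteq> supp x" using free realization_pointsD(2)[OF x] by blast
    moreover have "x \<in> realization_points K" using x realization_points_mono[of ?K K] by auto
    ultimately show "(r \<circ> id) x = id x" using r_id by simp
  qed auto
  ultimately show ?thesis
    unfolding homotopy_equivalent_space_def using r_cont incl by (metis id_comp)
qed

section \<open>Matchings and joins\<close>

text \<open>The removed faces are paired by toggling one vertex \<open>v\<close>, so a step bundles
  many elementary collapses with a common apex. The target may be the void complex
  \<open>{}\<close>, where the empty face is matched with \<open>{v}\<close>; that case is not a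
  homotopy equivalence, and \<open>proper_step\<close> excludes it.\<close>

definition collapse_step :: "'a set \<Rightarrow> 'a set set \<Rightarrow> 'a set set \<Rightarrow> bool" where
  "collapse_step V K L \<longleftrightarrow> fin_complex K \<and> fin_complex L \<and> K \<subseteq> Pow V \<and> L \<subseteq> K \<and>
     (\<exists>v. \<forall>S\<in>K - L. insert v S \<in> K - L \<and> S - {v} \<in> K - L)"

definition proper_step :: "'a set \<Rightarrow> 'a set set \<Rightarrow> 'a set set \<Rightarrow> bool" where
  "proper_step V K L \<longleftrightarrow> collapse_step V K L \<and> L \<noteq> {}"

lemma collapse_stepD:
  "collapse_step V K L \<Longrightarrow> \<exists>v. \<forall>S\<in>K - L. insert v S \<in> K - L \<and> S - {v} \<in> K - L"
  unfolding collapse_step_def by (elim conjE)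

lemma fin_complex_remove_free_pair:
  assumes "fin_complex K" "\<And>T. T \<in> K \<Longrightarrow> \<tau> \<subseteq> T \<Longrightarrow> T = \<tau> \<or> T = insert v \<tau>"
  shows "fin_complex (K - {\<tau>, insert v \<tau>})"
  unfolding fin_complex_def
proof (intro conjI ballI)
  show "finite (K - {\<tau>, insert v \<tau>})" using fin_complexD(1)[OF assms(1)] by simp
  fix S assume "S \<in> K - {\<tau>, insert v \<tau>}"
  then have S: "S \<in> K" "\<not> \<tau> \<subseteq> S" using assms(2) by auto
  then show "finite S" "Pow S \<subseteq> K - {\<tau>, insert v \<tau>}" using fin_complexD[OF assms(1)] by auto
qed

lemma fin_complex_empty_mem: "fin_complex K \<Longrightarrow> K \<noteq> {} \<Longrightarrow> {} \<in> K"
  unfolding fin_complex_def by blast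

text \<open>A removed face \<open>S\<close> of largest size contains \<open>v\<close>, since
  otherwise adding \<open>v\<close> would enlarge it. Then \<open>S - {v}\<close> is a free face: a
  face \<open>T\<close> above it is outside \<open>L\<close>, so \<open>insert v T\<close> is
  removed as well, and maximality forces it to be \<open>S\<close>. Thus the pairs come off one at a
  time, largest first.\<close>

lemma proper_step_homotopy_equivalent:
  assumes "proper_step V K L"
  shows "geometric_realization K homotopy_equivalent_space geometric_realization L"
  using assms
proof (induction "card (K - L)" arbitrary: K rule: less_induct)
  case less
  then have K: "fin_complex K" and L: "fin_complex L" "L \<noteq> {}" and sub: "L \<subseteq> K" "K \<subseteq> Pow V"
    by (auto simp: proper_step_def collapse_step_def)
  have "collapse_step V K L" using less.prems by (simp add: proper_step_def)
  then obtain v where "\<forall>S\<in>K - L. insert v S \<in> K - L \<and> S - {v} \<in> K - L"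
    using collapse_stepD by metis
  note v = this[rule_format]
  show ?case
  proof (cases "K = L")
    case True then show ?thesis by (simp add: homotopy_equivalent_space_refl)
  next
    case False
    then have ne: "K - L \<noteq> {}" using sub by auto
    have fin: "finite (K - L)" using fin_complexD(1)[OF K] by simp
    have "Max (card ` (K - L)) \<in> card ` (K - L)" using fin ne by (intro Max_in) auto
    then obtain S where S: "S \<in> K - L" "card S = Max (card ` (K - L))" by auto
    have Smax: "card T \<le> card S" if "T \<in> K - L" for T
      unfolding S(2) using fin that by (intro Max_ge) auto
    note S = S(1)
    have finS: "finite S" using S fin_complexD(2)[OF K] by simp
    have "v \<in> S"
    proof (rule ccontr)
      assume "v \<notin> S"
      then have "card (insert v S) = Suc (card S)" using finS by simp
      then show False using Smax[of "insert v S"] v[OF S] by simp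
    qed
    define \<tau> where "\<tau> = S - {v}"
    have \<tau>: "v \<notin> \<tau>" "insert v \<tau> = S" "\<tau> \<in> K - L"
      using \<open>v \<in> S\<close> v[OF S] by (auto simp: \<tau>_def)
    \<comment> \<open>The target being nonvoid matters here: the empty face stays in
      \<open>L\<close>, so the free face \<open>\<tau>\<close> is nonempty and its minimum
      coordinate makes sense.\<close>
    have "{} \<in> L" using fin_complex_empty_mem L by auto
    then have "\<tau> \<noteq> {}" using \<tau>(3) by auto
    have free: "T = \<tau> \<or> T = insert v \<tau>" if "T \<in> K" "\<tau> \<subseteq> T" for T
    proof -
      have "T \<notin> L" using that(2) \<tau>(3) fin_complexD(3)[OF L(1)] by blast
      then have T: "insert v T \<in> K - L" using that(1) v by blast
      then have "finite (insert v T)" using fin_complexD(2)[OF K, of "insert v T"] by simp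
      moreover have "S \<subseteq> insert v T" using that(2) \<tau>(2) by auto
      ultimately have "S = insert v T" using Smax[OF T] by (simp add: card_seteq)
      then show ?thesis using \<tau>(2) by (cases "v \<in> T") (auto simp: \<tau>_def insert_absorb)
    qed
    let ?K = "K - {\<tau>, insert v \<tau>}"
    have eq: "?K - L = (K - L) - {\<tau>, S}" using \<tau>(2) by auto
    have step: "proper_step V ?K L"
      unfolding proper_step_def collapse_step_def
    proof (intro conjI exI ballI)
      show "fin_complex ?K" using fin_complex_remove_free_pair[OF K] free by blast
      show "L \<subseteq> ?K" using sub \<tau>(3) S \<tau>(2) by auto
      show "fin_complex L" "L \<noteq> {}" "?K \<subseteq> Pow V" using L sub by auto
      fix T assume "T \<in> ?K - L"
      then have T: "T \<in> K - L" "T \<noteq> \<tau>" "T \<noteq> insert v \<tau>" by auto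
      have "insert v T \<noteq> \<tau>" "T - {v} \<noteq> insert v \<tau>" using \<tau>(1) by auto
      moreover have "insert v T \<noteq> insert v \<tau>" "T - {v} \<noteq> \<tau>" using T(2,3) \<tau>(1) by auto
      ultimately show "insert v T \<in> ?K - L" "T - {v} \<in> ?K - L" using v[OF T(1)] by auto
    qed
    have "card (?K - L) < card (K - L)"
      unfolding eq using fin S by (intro psubset_card_mono) auto
    then have "geometric_realization ?K homotopy_equivalent_space geometric_realization L"
      using less.hyps step by blast
    moreover have "geometric_realization K homotopy_equivalent_space geometric_realization ?K"
      using elementary_collapse_homotopy_equivalent[OF K \<open>\<tau> \<noteq> {}\<close> \<tau>(1)] free S \<tau>(2) by auto
    ultimately show ?thesis by (rule homotopy_eqv_trans[rotated])
  qed
qed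

lemma simple_equivalence_homotopy_equivalent:
  assumes "equivclp (proper_step V) K L"
  shows "geometric_realization K homotopy_equivalent_space geometric_realization L"
  using assms
proof (induction rule: equivclp_induct)
  case base
  then show ?case by (rule homotopy_equivalent_space_refl)
next
  case (step y z)
  then have "geometric_realization y homotopy_equivalent_space geometric_realization z"
    using proper_step_homotopy_equivalent homotopy_equivalent_space_sym by blast
  with step.IH show ?case by (rule homotopy_eqv_trans)
qed

lemma contractible_cone:
  assumes K: "fin_complex K" and v: "\<And>S. S \<in> K \<Longrightarrow> insert v S \<in> K" and ne: "K \<noteq> {}"
  shows "contractible_space (geometric_realization K)"
proof -
  define e where "e = (\<lambda>u. if u = v then 1 else 0 :: real)"
  have "{v} \<in> K" using v[OF fin_complex_empty_mem[OF K ne]] .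
  then have e: "e \<in> realization_points K"
    by (intro realization_pointsI[OF K]) (auto simp: e_def)
  have "homotopic_with (\<lambda>_. True) (geometric_realization K) (geometric_realization K) id (\<lambda>_. e)"
  proof (rule homotopic_straight_line[OF K])
    show "continuous_map (geometric_realization K) (geometric_realization K) (\<lambda>_. e)"
      using e by simp
    fix x assume "x \<in> topspace (geometric_realization K)"
    then have "insert v (supp x) \<in> K" using v[OF realization_pointsD(2)] by simp
    moreover have "supp (id x) \<union> supp e = insert v (supp x)" by (auto simp: e_def)
    ultimately show "supp (id x) \<union> supp e \<in> K" by metis
  qed simp
  then show ?thesis unfolding contractible_space_def by blast
qed

text \<open>Every step is a homotopy equivalence except the one that empties a nonvoid complex, and
  in that one the toggled vertex is the apex of a cone.\<close>

lemma contractible_collapsible: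
  assumes "(collapse_step V)\<^sup>*\<^sup>* K {}" "K \<noteq> {}"
  shows "contractible_space (geometric_realization K)"
  using assms
proof (induction rule: converse_rtranclp_induct)
  case (step K L)
  show ?case
  proof (cases "L = {}")
    case True
    then show ?thesis using step contractible_cone[of K] by (auto simp: collapse_step_def)
  next
    case False
    then have "geometric_realization K homotopy_equivalent_space geometric_realization L"
      using step(1) proper_step_homotopy_equivalent by (auto simp: proper_step_def)
    then show ?thesis using step False homotopy_equivalent_space_contractibility by blast
  qed
qed simp

text \<open>A perfect discrete Morse matching, with critical faces the facets in \<open>C\<close>; the empty face is
  matched as well.\<close>

definition spherical :: "'a set \<Rightarrow> 'a set set \<Rightarrow> 'a set set \<Rightarrow> bool" where
  "spherical V K C \<longleftrightarrow> fin_complex K \<and> K \<subseteq> Pow V \<and> C \<subseteq> K \<and>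
     (\<forall>c\<in>C. \<forall>S\<in>K. c \<subseteq> S \<longrightarrow> S = c) \<and> (collapse_step V)\<^sup>*\<^sup>* (K - C) {}"

text \<open>Both factors live on one vertex type and a face is cut at \<open>V\<close>. The
  independence complex of a disjoint union of graphs is then equal to such a join, with no
  relabelling.\<close>

definition simplicial_join :: "'a set \<Rightarrow> 'a set set \<Rightarrow> 'a set set \<Rightarrow> 'a set set" where
  "simplicial_join V K L = {S. S \<inter> V \<in> K \<and> S - V \<in> L}"

lemma simplicial_join_subset_Pow:
  "K \<subseteq> Pow V \<Longrightarrow> L \<subseteq> Pow U \<Longrightarrow> simplicial_join V K L \<subseteq> Pow (V \<union> U)"
  by (fastforce simp: simplicial_join_def)

lemma finite_simplicial_join:
  assumes "finite K" "finite L" shows "finite (simplicial_join V K L)"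
proof (rule finite_subset)
  show "simplicial_join V K L \<subseteq> (\<lambda>(S, T). S \<union> T) ` (K \<times> L)"
  proof
    fix S assume "S \<in> simplicial_join V K L"
    then show "S \<in> (\<lambda>(S, T). S \<union> T) ` (K \<times> L)"
      by (intro image_eqI[of _ _ "(S \<inter> V, S - V)"]) (auto simp: simplicial_join_def)
  qed
qed (use assms in simp)

lemma simplicial_join_finite_mem:
  assumes "fin_complex K" "fin_complex L" "S \<in> simplicial_join V K L"
  shows "finite S"
proof -
  have "finite (S \<inter> V)" "finite (S - V)"
    using assms fin_complexD(2) by (auto simp: simplicial_join_def)
  then have "finite (S \<inter> V \<union> (S - V))" by blast
  then show ?thesis by (simp add: Int_Diff_Un)
qed

lemma fin_complex_simplicial_join:
  assumes "fin_complex K" "fin_complex L"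
  shows "fin_complex (simplicial_join V K L)"
  unfolding fin_complex_def
proof (intro conjI ballI)
  show "finite (simplicial_join V K L)" using assms fin_complexD(1) finite_simplicial_join by blast
  fix S assume S: "S \<in> simplicial_join V K L"
  then show "finite S" using simplicial_join_finite_mem assms by blast
  show "Pow S \<subseteq> simplicial_join V K L"
  proof
    fix T assume "T \<in> Pow S"
    then have "T \<inter> V \<subseteq> S \<inter> V" "T - V \<subseteq> S - V" by auto
    then show "T \<in> simplicial_join V K L"
      using S fin_complexD(3) assms unfolding simplicial_join_def by blast
  qed
qed

text \<open>If any face is removed, then the toggled vertex belongs to \<open>V\<close>, so toggling
  changes only the first part of a face of the join.\<close>

lemma collapse_step_join:
  assumes step: "collapse_step V K K'" and L: "fin_complex L" "L \<subseteq> Pow U" and disj: "V \<inter> U = {}"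
  shows "collapse_step (V \<union> U) (simplicial_join V K L) (simplicial_join V K' L)"
proof -
  have K: "fin_complex K" "fin_complex K'" "K \<subseteq> Pow V" "K' \<subseteq> K" using step by (auto simp: collapse_step_def)
  obtain v where "\<forall>S\<in>K - K'. insert v S \<in> K - K' \<and> S - {v} \<in> K - K'"
    using collapse_stepD[OF step] by metis
  note v = this[rule_format]
  have "insert v S \<in> simplicial_join V K L - simplicial_join V K' L \<and>
        S - {v} \<in> simplicial_join V K L - simplicial_join V K' L"
    if "S \<in> simplicial_join V K L - simplicial_join V K' L" for S
  proof -
    have S: "S \<inter> V \<in> K - K'" "S - V \<in> L" using that by (auto simp: simplicial_join_def)
    then have "v \<in> V" using v K(3) by blast
    then have "insert v S \<inter> V = insert v (S \<inter> V)" "insert v S - V = S - V"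
      "(S - {v}) \<inter> V = S \<inter> V - {v}" "(S - {v}) - V = S - V" by auto
    then show ?thesis using v[OF S(1)] S(2) by (simp add: simplicial_join_def)
  qed
  moreover have "simplicial_join V K' L \<subseteq> simplicial_join V K L"
    using K(4) by (auto simp: simplicial_join_def)
  ultimately show ?thesis
    unfolding collapse_step_def
    using fin_complex_simplicial_join K L simplicial_join_subset_Pow[OF K(3) L(2)] by blast
qed

lemma equivclp_proper_step_join:
  assumes "equivclp (proper_step V) K K'" and L: "fin_complex L" "L \<subseteq> Pow U" "L \<noteq> {}"
    and disj: "V \<inter> U = {}"
  shows "equivclp (proper_step (V \<union> U)) (simplicial_join V K L) (simplicial_join V K' L)"
  using assms(1)
proof (induction rule: equivclp_induct)
  case (step y z)
  have *: "proper_step (V \<union> U) (simplicial_join V y L) (simplicial_join V z L)" if "proper_step V y z" for y z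
  proof -
    have "{} \<in> L" "{} \<in> z"
      using that L fin_complex_empty_mem by (auto simp: proper_step_def collapse_step_def)
    then have "{} \<in> simplicial_join V z L" by (simp add: simplicial_join_def)
    then show ?thesis
      using that collapse_step_join[OF _ L(1,2) disj] by (auto simp: proper_step_def)
  qed
  then show ?case using step by (meson equivclp_into_equivclp)
qed simp

text \<open>Off the critical faces, first match along \<open>L\<close> over the critical faces of \<open>K\<close>, then along \<open>K\<close>.\<close>

lemma spherical_join:
  assumes K: "spherical V K C" and L: "spherical U L D" and disj: "V \<inter> U = {}"
  shows "spherical (V \<union> U) (simplicial_join V K L) (simplicial_join V C D)"
proof -
  have Kc: "fin_complex K" "K \<subseteq> Pow V" "C \<subseteq> K" and Kf: "\<And>c S. c \<in> C \<Longrightarrow> S \<in> K \<Longrightarrow> c \<subseteq> S \<Longrightarrow> S = c"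
    and Kcol: "(collapse_step V)\<^sup>*\<^sup>* (K - C) {}" using K by (auto simp: spherical_def)
  have Lc: "fin_complex L" "L \<subseteq> Pow U" "D \<subseteq> L" and Lf: "\<And>c S. c \<in> D \<Longrightarrow> S \<in> L \<Longrightarrow> c \<subseteq> S \<Longrightarrow> S = c"
    and Lcol: "(collapse_step U)\<^sup>*\<^sup>* (L - D) {}" using L by (auto simp: spherical_def)
  \<comment> \<open>\<open>J M\<close> interpolates between the two stages: over a critical face of
    \<open>K\<close> it allows only parts in \<open>M\<close>, over all other faces every part in
    \<open>L\<close>. \<open>J (L - D)\<close> omits exactly the critical faces of the join, and
    \<open>J {}\<close> is the join of \<open>K - C\<close> with \<open>L\<close>.\<close>
  define J where "J M = simplicial_join V C M \<union> simplicial_join V (K - C) L" for M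
  have J_sub: "J M \<subseteq> Pow (V \<union> U)" if "M \<subseteq> L" for M
    using that simplicial_join_subset_Pow[OF Kc(2) Lc(2)] Kc(3) by (auto simp: J_def simplicial_join_def)
  have J_complex: "fin_complex (J M)" if M: "fin_complex M" "M \<subseteq> L" for M
    unfolding fin_complex_def
  proof (intro conjI ballI)
    have "finite C" "finite (K - C)" using Kc fin_complexD(1) finite_subset by blast+
    then show "finite (J M)"
      using finite_simplicial_join fin_complexD(1) M Lc unfolding J_def by blast
    fix S assume S: "S \<in> J M"
    then have S': "S \<in> simplicial_join V K L"
      using M(2) Kc(3) by (auto simp: J_def simplicial_join_def)
    then show "finite S" using simplicial_join_finite_mem Kc Lc by blast
    show "Pow S \<subseteq> J M"
    proof
      fix T assume "T \<in> Pow S"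
      then have T: "T \<inter> V \<subseteq> S \<inter> V" "T - V \<subseteq> S - V" "T \<in> simplicial_join V K L"
        using fin_complexD(3)[OF fin_complex_simplicial_join[OF Kc(1) Lc(1)] S'] by auto
      show "T \<in> J M"
      proof (cases "T \<inter> V \<in> C")
        case True
        \<comment> \<open>Critical faces of \<open>K\<close> are facets, so passing to a subset
          never turns a noncritical first part into a critical one. This is what makes
          \<open>J M\<close> closed under subsets.\<close>
        then have "S \<inter> V = T \<inter> V" using Kf T S' by (auto simp: simplicial_join_def)
        then have "S - V \<in> M" using S True by (auto simp: J_def simplicial_join_def)
        then show ?thesis using True T(2) fin_complexD(3)[OF M(1)] by (auto simp: J_def simplicial_join_def)
      next
        case False
        then show ?thesis using T(3) by (auto simp: J_def simplicial_join_def)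
      qed
    qed
  qed
  have J_step: "collapse_step (V \<union> U) (J M) (J N)"
    if step: "collapse_step U M N" and sub: "M \<subseteq> L" for M N
  proof -
    have MN: "fin_complex M" "fin_complex N" "N \<subseteq> M" using step by (auto simp: collapse_step_def)
    obtain v where "\<forall>S\<in>M - N. insert v S \<in> M - N \<and> S - {v} \<in> M - N"
      using collapse_stepD[OF step] by metis
    note v = this[rule_format]
    have D: "S \<in> J M - J N \<longleftrightarrow> S \<inter> V \<in> C \<and> S - V \<in> M - N" for S
      by (auto simp: J_def simplicial_join_def)
    have "insert v S \<in> J M - J N \<and> S - {v} \<in> J M - J N" if "S \<in> J M - J N" for S
    proof -
      have S: "S \<inter> V \<in> C" "S - V \<in> M - N" using that D by auto
      then have "v \<in> U" using v sub Lc(2) by blast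
      then have "v \<notin> V" using disj by auto
      then have "insert v S \<inter> V = S \<inter> V" "insert v S - V = insert v (S - V)"
        "(S - {v}) \<inter> V = S \<inter> V" "(S - {v}) - V = S - V - {v}" by auto
      then show ?thesis using v[OF S(2)] S(1) unfolding D by simp
    qed
    then have "\<exists>v. \<forall>S\<in>J M - J N. insert v S \<in> J M - J N \<and> S - {v} \<in> J M - J N" by metis
    moreover have "J N \<subseteq> J M" using MN(3) by (auto simp: J_def simplicial_join_def)
    moreover have "N \<subseteq> L" using MN(3) sub by blast
    ultimately show ?thesis
      using J_complex[OF MN(1) sub] J_complex[OF MN(2)] J_sub[OF sub] unfolding collapse_step_def by simp
  qed
  have "(collapse_step (V \<union> U))\<^sup>*\<^sup>* (J M) (J {})" if "(collapse_step U)\<^sup>*\<^sup>* M {}" "M \<subseteq> L" for M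
    using that
  proof (induction rule: converse_rtranclp_induct)
    case (step M N)
    then have "N \<subseteq> L" by (auto simp: collapse_step_def)
    then show ?case using step J_step by (meson converse_rtranclp_into_rtranclp)
  qed simp
  then have "(collapse_step (V \<union> U))\<^sup>*\<^sup>* (J (L - D)) (J {})" using Lcol by blast
  moreover have "(collapse_step (V \<union> U))\<^sup>*\<^sup>* (simplicial_join V M L) {}"
    if "(collapse_step V)\<^sup>*\<^sup>* M {}" for M
    using that
  proof (induction rule: converse_rtranclp_induct)
    case base
    then show ?case by (simp add: simplicial_join_def)
  next
    case (step M N)
    then show ?case using collapse_step_join[OF _ Lc(1,2) disj]
      by (meson converse_rtranclp_into_rtranclp)
  qed
  moreover have "J {} = simplicial_join V (K - C) L" by (auto simp: J_def simplicial_join_def)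
  moreover have "simplicial_join V K L - simplicial_join V C D = J (L - D)"
    using Kc(3) Lc(3) by (auto simp: J_def simplicial_join_def)
  ultimately have "(collapse_step (V \<union> U))\<^sup>*\<^sup>* (simplicial_join V K L - simplicial_join V C D) {}"
    using Kcol by (metis rtranclp_trans)
  moreover have "S = c" if c: "c \<in> simplicial_join V C D" and S: "S \<in> simplicial_join V K L" "c \<subseteq> S" for c S
  proof -
    have "S \<inter> V = c \<inter> V" "S - V = c - V"
      using Kf[of "c \<inter> V" "S \<inter> V"] Lf[of "c - V" "S - V"] c S by (auto simp: simplicial_join_def)
    then show ?thesis by blast
  qed
  moreover have "simplicial_join V C D \<subseteq> simplicial_join V K L"
    using Kc(3) Lc(3) by (auto simp: simplicial_join_def)
  ultimately show ?thesis
    unfolding spherical_def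
    using fin_complex_simplicial_join[OF Kc(1) Lc(1)] simplicial_join_subset_Pow[OF Kc(2) Lc(2)] by blast
qed

lemma bij_betw_simplicial_join:
  assumes "C \<subseteq> Pow V" "D \<subseteq> Pow U" "V \<inter> U = {}"
  shows "bij_betw (\<lambda>(c, d). c \<union> d) (C \<times> D) (simplicial_join V C D)"
proof (rule bij_betwI[where g = "\<lambda>S. (S \<inter> V, S - V)"])
  have *: "(c \<union> d) \<inter> V = c" "(c \<union> d) - V = d" if "c \<in> C" "d \<in> D" for c d
    using that assms by blast+
  show "(\<lambda>(c, d). c \<union> d) \<in> C \<times> D \<rightarrow> simplicial_join V C D"
    using * by (auto simp: simplicial_join_def)
  show "(\<lambda>S. (S \<inter> V, S - V)) \<in> simplicial_join V C D \<rightarrow> C \<times> D"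
    by (auto simp: simplicial_join_def)
  show "(\<lambda>S. (S \<inter> V, S - V)) ((\<lambda>(c, d). c \<union> d) p) = p" if "p \<in> C \<times> D" for p
    using that *[of "fst p" "snd p"] by (cases p) (simp del: Un_Diff)
qed auto

lemma card_simplicial_join:
  assumes "C \<subseteq> Pow V" "D \<subseteq> Pow U" "V \<inter> U = {}"
  shows "card (simplicial_join V C D) = card C * card D"
  using bij_betw_same_card[OF bij_betw_simplicial_join[OF assms]] by (simp add: card_cartesian_product)

section \<open>Crushing a contractible subcomplex\<close>

text \<open>Crushing \<open>A\<close> is undone up to homotopy by \<open>H\<close> at time 1: it is
  constant on \<open>A\<close>, hence factors through \<open>f\<close> as a map \<open>g\<close>,
  and \<open>H\<close> is a homotopy from the identity to \<open>g\<close> after \<open>f\<close>.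
  Since \<open>H\<close> preserves \<open>A\<close>, its composite with \<open>f\<close> descends to
  a homotopy on \<open>Y\<close> from the identity to \<open>f\<close> after
  \<open>g\<close>.\<close>

lemma homotopy_equivalent_quotient:
  assumes q: "quotient_map X Y f"
    and H: "continuous_map (prod_topology (top_of_set {0..1::real}) X) X H"
    and H0: "\<And>x. x \<in> topspace X \<Longrightarrow> H (0, x) = x"
    and A: "A \<subseteq> topspace X"
    and HA: "\<And>t x. t \<in> {0..1} \<Longrightarrow> x \<in> A \<Longrightarrow> H (t, x) \<in> A"
    and H1: "\<And>x. x \<in> A \<Longrightarrow> H (1, x) = a"
    and fA: "\<And>x y. x \<in> A \<Longrightarrow> y \<in> A \<Longrightarrow> f x = f y"
    and fib: "\<And>x y. x \<in> topspace X \<Longrightarrow> y \<in> topspace X \<Longrightarrow> f x = f y \<Longrightarrow> x = y \<or> x \<in> A \<and> y \<in> A"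
  shows "X homotopy_equivalent_space Y"
proof -
  let ?I = "top_of_set {0..1::real}"
  have f: "continuous_map X Y f" using q by (rule quotient_imp_continuous_map)
  have fX: "f ` topspace X = topspace Y" using q by (simp add: quotient_map_def)
  have "continuous_map X (prod_topology ?I X) (\<lambda>x. (1, x))" by (simp add: continuous_map_paired)
  then have "continuous_map X X (\<lambda>x. H (1, x))" using continuous_map_compose[OF _ H] by (simp add: o_def)
  then obtain g where g: "continuous_map Y X g" and gf: "\<And>x. x \<in> topspace X \<Longrightarrow> g (f x) = H (1, x)"
  proof (rule quotient_map_lift_exists[OF q])
    show "H (1, x) = H (1, y)" if "x \<in> topspace X" "y \<in> topspace X" "f x = f y" for x y
      using fib[OF that] H1 by auto
  qed blast
  \<comment> \<open>Descending a homotopy requires the product of the interval with a quotient map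
    to be a quotient map again; this holds because the interval is locally compact
    Hausdorff.\<close>
  have "locally_compact_space ?I" "Hausdorff_space ?I"
    by (auto intro: compact_imp_locally_compact_space simp: Hausdorff_space_subtopology compact_space_subtopology)
  then have qq: "quotient_map (prod_topology ?I X) (prod_topology ?I Y) (\<lambda>(t, x). (t, f x))"
    using quotient_map_prod_right[OF _ _ q] by blast
  have fH: "continuous_map (prod_topology ?I X) Y (f \<circ> H)" using continuous_map_compose[OF H f] .
  have cong: "(f \<circ> H) p = (f \<circ> H) p'"
    if "p \<in> topspace (prod_topology ?I X)" "p' \<in> topspace (prod_topology ?I X)"
      "(\<lambda>(t, x). (t, f x)) p = (\<lambda>(t, x). (t, f x)) p'" for p p'
  proof -
    obtain t x where p1: "p = (t, x)" by fastforce
    obtain t' x' where p2: "p' = (t', x')" by fastforce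
    have p: "t' = t" "t \<in> {0..1}" "x \<in> topspace X" "x' \<in> topspace X" "f x = f x'"
      using that p1 p2 by auto
    then have "x = x' \<or> x \<in> A \<and> x' \<in> A" using fib by blast
    then show ?thesis using HA[OF p(2)] fA by (auto simp: p(1) p1 p2)
  qed
  obtain k where k: "continuous_map (prod_topology ?I Y) Y k"
    and kf: "\<And>p. p \<in> topspace (prod_topology ?I X) \<Longrightarrow> k ((\<lambda>(t, x). (t, f x)) p) = (f \<circ> H) p"
    by (rule quotient_map_lift_exists[OF qq fH cong]) (assumption+, rule that, assumption+)
  have kf': "k (t, f x) = f (H (t, x))" if "t \<in> {0..1}" "x \<in> topspace X" for t x
    using kf[of "(t, x)"] that by simp
  have hX: "homotopic_with (\<lambda>_. True) X X id (g \<circ> f)"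
    using H H0 gf by (subst homotopic_with) auto
  have hY: "homotopic_with (\<lambda>_. True) Y Y id (f \<circ> g)"
  proof (subst homotopic_with, simp, intro exI conjI ballI)
    fix y assume "y \<in> topspace Y"
    then obtain x where x: "x \<in> topspace X" "y = f x" using fX by blast
    show "k (0, y) = id y" "k (1, y) = (f \<circ> g) y" using kf' x H0 gf by auto
  qed (use k in auto)
  show ?thesis
    unfolding homotopy_equivalent_space_def
    by (intro exI[of _ f] exI[of _ g] conjI f g homotopic_with_symD[OF hX] homotopic_with_symD[OF hY])
qed

text \<open>An explicit form of the homotopy extension property for the subcomplex
  \<open>K - C\<close>. A point of a critical facet is first pushed radially from the barycentre
  towards the boundary, and the time left after arriving there is spent on the contraction of
  \<open>K - C\<close>. Points deep inside do not arrive in time.\<close>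

lemma homotopy_extension_crushing:
  assumes K: "fin_complex K" and C: "C \<subseteq> K"
    and facet: "\<And>c S. c \<in> C \<Longrightarrow> S \<in> K \<Longrightarrow> c \<subseteq> S \<Longrightarrow> S = c"
    and ne: "{} \<notin> C"
    and contr: "contractible_space (geometric_realization (K - C))"
  obtains H a where
    "continuous_map (prod_topology (top_of_set {0..1::real}) (geometric_realization K)) (geometric_realization K) H"
    "\<And>x. x \<in> realization_points K \<Longrightarrow> H (0, x) = x"
    "\<And>t x. t \<in> {0..1} \<Longrightarrow> x \<in> realization_points (K - C) \<Longrightarrow> H (t, x) \<in> realization_points (K - C)"
    "\<And>x. x \<in> realization_points (K - C) \<Longrightarrow> H (1, x) = a"
proof -
  let ?I = "top_of_set {0..1::real}"
  let ?X = "geometric_realization K" and ?A = "geometric_realization (K - C)"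
  have K0: "fin_complex (K - C)"
    unfolding fin_complex_def using fin_complexD[OF K] facet by blast
  obtain h a where h: "continuous_map (prod_topology ?I ?A) ?A h"
    and h0: "\<And>x. h (0, x) = x" and h1: "\<And>x. h (1, x) = a"
    using contr unfolding contractible_space_def homotopic_with_def by auto
  have finC: "finite C" using C fin_complexD(1)[OF K] finite_subset by blast
  have fin\<sigma>: "finite \<sigma>" "\<sigma> \<noteq> {}" "0 < real (card \<sigma>)" if "\<sigma> \<in> C" for \<sigma>
    using that C ne fin_complexD(2)[OF K] by (auto simp: card_gt_0_iff)
  \<comment> \<open>A depth function on the facet \<open>\<sigma>\<close>: 1 at its barycentre, 0 on
    its boundary. Because \<open>\<sigma>\<close> is a facet, it also vanishes at every point whose
    support is not \<open>\<sigma>\<close>. So at most one term of each sum over \<open>C\<close>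
    below is nonzero, and the sums give continuity without any gluing.\<close>
  define \<mu> where "\<mu> \<sigma> x = real (card \<sigma>) * Min (x ` \<sigma>)" for \<sigma> :: "'a set" and x :: "'a \<Rightarrow> real"
  define s where "s x = (\<Sum>\<sigma>\<in>C. \<mu> \<sigma> x)" for x
  define Z where "Z \<tau> x = (\<Sum>\<sigma>\<in>C. min \<tau> (\<mu> \<sigma> x))" for \<tau> x
  \<comment> \<open>Mass \<open>min \<tau> (\<mu> \<sigma> x)\<close> is removed evenly from the
    facet and the rest is rescaled to sum 1: this is motion away from the barycentre. Once
    \<open>\<tau>\<close> reaches the depth, some coordinate is 0.\<close>
  define R where "R \<tau> x = (\<lambda>u. (x u - (\<Sum>\<sigma>\<in>C. if u \<in> \<sigma> then min \<tau> (\<mu> \<sigma> x) / card \<sigma> else 0)) / (1 - Z \<tau> x))"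
    for \<tau> x
  have Min_le: "Min (x ` \<sigma>) \<le> x u" if "\<sigma> \<in> C" "u \<in> \<sigma>" for x :: "'a \<Rightarrow> real" and \<sigma> u
    using that fin\<sigma> by simp
  have Min_in: "\<exists>u\<in>\<sigma>. Min (x ` \<sigma>) = x u" if "\<sigma> \<in> C" for x :: "'a \<Rightarrow> real" and \<sigma>
  proof -
    have "Min (x ` \<sigma>) \<in> x ` \<sigma>" using that fin\<sigma> by (intro Min_in) auto
    then show ?thesis by blast
  qed
  have \<mu>_nn: "0 \<le> \<mu> \<sigma> x" if "\<sigma> \<in> C" "x \<in> realization_points K" for \<sigma> x
    using Min_in[OF that(1), of x] realization_pointsD(1)[OF that(2)] by (auto simp: \<mu>_def)
  have \<mu>_off: "\<mu> \<sigma> x = 0" if "\<sigma> \<in> C" "x \<in> realization_points K" "supp x \<noteq> \<sigma>" for \<sigma> x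
  proof -
    have "\<not> \<sigma> \<subseteq> supp x" using facet[OF that(1) realization_pointsD(2)[OF that(2)]] that(3) by blast
    then obtain u where "u \<in> \<sigma>" "x u = 0" by auto
    then have "\<mu> \<sigma> x \<le> 0"
      using Min_le[OF that(1), of u x] fin\<sigma>(3)[OF that(1)] by (simp add: \<mu>_def mult_le_0_iff)
    then show ?thesis using \<mu>_nn[OF that(1,2)] by simp
  qed
  have sum_single: "(\<Sum>\<sigma>'\<in>C. F \<sigma>') = (F \<sigma> :: real)"
    if "\<sigma> \<in> C" "\<And>\<sigma>'. \<sigma>' \<in> C \<Longrightarrow> \<sigma>' \<noteq> \<sigma> \<Longrightarrow> F \<sigma>' = 0" for F \<sigma>
    using finC that by (subst sum.remove[of C \<sigma>]) auto
  have \<mu>_le: "\<mu> \<sigma> x \<le> 1" if "\<sigma> \<in> C" "x \<in> realization_points K" "supp x = \<sigma>" for \<sigma> x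
  proof -
    have "\<mu> \<sigma> x \<le> sum x \<sigma>"
      unfolding \<mu>_def using sum_bounded_below[of \<sigma> "Min (x ` \<sigma>)" x] Min_le[OF that(1)] by simp
    then show ?thesis using realization_pointsD(3)[OF that(2), of \<sigma>] fin\<sigma>[OF that(1)] that(3) by simp
  qed
  have on_A: "\<mu> \<sigma> x = 0" if "x \<in> realization_points (K - C)" "\<sigma> \<in> C" for \<sigma> x
    using \<mu>_off[OF that(2)] that realization_points_mono[of "K - C" K] realization_pointsD(2)[OF that(1)] by blast
  have A_or: "x \<in> realization_points (K - C) \<or> supp x \<in> C" if "x \<in> realization_points K" for x
    using that by (auto simp: realization_points_def)
  have s_nn: "0 \<le> s x" if "x \<in> realization_points K" for x
    unfolding s_def using \<mu>_nn that by (simp add: sum_nonneg)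
  have s_A: "s x = 0" if "x \<in> realization_points (K - C)" for x
    unfolding s_def using on_A[OF that] by simp
  have Z_A: "Z \<tau> x = 0" "R \<tau> x = x" if "x \<in> realization_points (K - C)" "0 \<le> \<tau>" for x \<tau>
  proof -
    have "min \<tau> (\<mu> \<sigma> x) = 0" if "\<sigma> \<in> C" for \<sigma> using on_A[OF \<open>x \<in> _\<close> that] \<open>0 \<le> \<tau>\<close> by simp
    then show "Z \<tau> x = 0" "R \<tau> x = x" by (auto simp: Z_def R_def cong: if_cong)
  qed
  have Z_C: "s x = \<mu> (supp x) x" "Z \<tau> x = min \<tau> (\<mu> (supp x) x)"
     "R \<tau> x = (\<lambda>u. (x u - (if u \<in> supp x then min \<tau> (\<mu> (supp x) x) / card (supp x) else 0)) / (1 - Z \<tau> x))"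
    if x: "x \<in> realization_points K" "supp x \<in> C" "0 \<le> \<tau>" for x \<tau>
  proof -
    have 0: "\<mu> \<sigma> x = 0" if "\<sigma> \<in> C" "\<sigma> \<noteq> supp x" for \<sigma> using \<mu>_off[OF that(1) x(1)] that(2) by simp
    show "s x = \<mu> (supp x) x" unfolding s_def by (rule sum_single[OF x(2)]) (use 0 in auto)
    show "Z \<tau> x = min \<tau> (\<mu> (supp x) x)" unfolding Z_def by (rule sum_single[OF x(2)]) (use 0 x(3) in auto)
    have "(\<Sum>\<sigma>\<in>C. if u \<in> \<sigma> then min \<tau> (\<mu> \<sigma> x) / card \<sigma> else 0) =
      (if u \<in> supp x then min \<tau> (\<mu> (supp x) x) / card (supp x) else 0)" for u
      by (rule sum_single[OF x(2)]) (use 0 x(3) in auto)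
    then show "R \<tau> x = (\<lambda>u. (x u - (if u \<in> supp x then min \<tau> (\<mu> (supp x) x) / card (supp x) else 0)) / (1 - Z \<tau> x))"
      unfolding R_def by simp
  qed
  \<comment> \<open>The radial parameter is capped at 1/2 to keep the denominator
    \<open>1 - Z \<tau> x\<close> away from 0; a cap of 1 would break down at the barycentre, whose
    depth is 1.\<close>
  have Z_le: "Z \<tau> x \<le> 1/2" if "x \<in> realization_points K" "0 \<le> \<tau>" "\<tau> \<le> 1/2" for x \<tau>
    using A_or[OF that(1)] Z_A(1)[of x \<tau>] Z_C(2)[of x \<tau>] that by auto
  have R_C: "R \<tau> x \<in> realization_points K" "\<mu> (supp x) x \<le> \<tau> \<Longrightarrow> R \<tau> x \<in> realization_points (K - C)"
    if x: "x \<in> realization_points K" "supp x \<in> C" "0 \<le> \<tau>" "\<tau> \<le> 1/2" for x \<tau>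
  proof -
    let ?\<sigma> = "supp x"
    let ?m = "min \<tau> (\<mu> ?\<sigma> x)"
    note fs = fin\<sigma>[OF x(2)]
    have d: "1 - Z \<tau> x > 0" using Z_le[OF x(1,3,4)] by simp
    have R: "R \<tau> x u = (if u \<in> ?\<sigma> then (x u - ?m / card ?\<sigma>) / (1 - ?m) else 0)" for u
      using Z_C(2,3)[OF x(1-3)] by simp
    have "?m / card ?\<sigma> \<le> Min (x ` ?\<sigma>)"
    proof -
      have "?m \<le> \<mu> ?\<sigma> x" by simp
      then show ?thesis using fs(3) by (simp add: \<mu>_def field_simps)
    qed
    then have nn: "0 \<le> R \<tau> x u" for u
      using Min_le[OF x(2), of u x] d Z_C(2)[OF x(1-3)] unfolding R by auto
    have "sum (R \<tau> x) ?\<sigma> = (\<Sum>u\<in>?\<sigma>. (x u - ?m / card ?\<sigma>) / (1 - ?m))"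
      by (rule sum.cong) (auto simp: R)
    also have "\<dots> = (sum x ?\<sigma> - ?m) / (1 - ?m)"
      using fs by (simp add: sum_divide_distrib[symmetric] sum_subtractf)
    also have "\<dots> = 1" using realization_pointsD(3)[OF x(1) fs(1)] d Z_C(2)[OF x(1-3)] by simp
    finally have sum1: "sum (R \<tau> x) ?\<sigma> = 1" .
    show "R \<tau> x \<in> realization_points K"
      by (rule realization_pointsI[OF K realization_pointsD(2)[OF x(1)]]) (use nn sum1 R in auto)
    assume le: "\<mu> ?\<sigma> x \<le> \<tau>"
    obtain u where u: "u \<in> ?\<sigma>" "Min (x ` ?\<sigma>) = x u" using Min_in[OF x(2)] by blast
    have "?m = card ?\<sigma> * x u" using le u by (simp add: \<mu>_def)
    then have 0: "R \<tau> x u = 0" using fs(3) unfolding R by simp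
    have sub: "?\<sigma> - {u} \<in> K" by (rule fin_complexD(3)[OF K realization_pointsD(2)[OF x(1)]]) auto
    have "?\<sigma> - {u} \<notin> C"
    proof
      assume "?\<sigma> - {u} \<in> C"
      then have "?\<sigma> = ?\<sigma> - {u}" using facet[OF _ realization_pointsD(2)[OF x(1)]] by blast
      then show False using u by blast
    qed
    with sub have "?\<sigma> - {u} \<in> K - C" by blast
    then show "R \<tau> x \<in> realization_points (K - C)"
    proof (rule realization_pointsI[OF K0])
      show "R \<tau> x v = 0" if "v \<notin> ?\<sigma> - {u}" for v using that 0 R by auto
      show "sum (R \<tau> x) (?\<sigma> - {u}) = 1" using sum1 0 u(1) fs(1) by (simp add: sum_diff1)
    qed (use nn in auto)
  qed
  have R_K: "R \<tau> x \<in> realization_points K" if "x \<in> realization_points K" "0 \<le> \<tau>" "\<tau> \<le> 1/2" for x \<tau>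
    using A_or[OF that(1)] R_C(1)[of x \<tau>] Z_A(2)[of x \<tau>] that by auto
  have R_half: "R (1/2) x \<in> realization_points (K - C)" if "x \<in> realization_points K" "s x \<le> 1/2" for x
    using A_or[OF that(1)] R_C(2)[of x "1/2"] Z_A(2)[of x "1/2"] Z_C(1)[of x "1/2"] that by auto
  \<comment> \<open>Time \<open>t\<close> gives the radial parameter \<open>t / 2\<close>, so the
    boundary is reached at time \<open>2 * s x\<close>. Afterwards the parameter 1/2 exceeds the
    depth and hence yields that same boundary point. On \<open>K - C\<close> the depth is 0 and
    \<open>H\<close> is \<open>h\<close> from the start.\<close>
  define H where "H = (\<lambda>(t, x). if t / 2 \<le> s x then R (t / 2) x else h (t - 2 * s x, R (1/2) x))"
  have fst_I: "continuous_map (prod_topology ?I ?X) euclideanreal fst"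
    using continuous_map_into_fulltopology continuous_map_fst by blast
  have coord: "continuous_map (prod_topology ?I ?X) euclideanreal (\<lambda>p. snd p u)" for u
    using continuous_map_compose[OF continuous_map_snd continuous_map_realization_coordinate] by (simp add: o_def)
  have \<mu>_cont: "continuous_map (prod_topology ?I ?X) euclideanreal (\<lambda>p. \<mu> \<sigma> (snd p))" if "\<sigma> \<in> C" for \<sigma>
    unfolding \<mu>_def using fin\<sigma>[OF that] by (intro continuous_intros continuous_map_Min_image coord) auto
  have s_cont: "continuous_map (prod_topology ?I ?X) euclideanreal (\<lambda>p. s (snd p))"
    unfolding s_def by (intro continuous_intros \<mu>_cont finC)
  have R_cont: "continuous_map (prod_topology ?I ?X) euclideanreal (\<lambda>p. R (\<tau> p) (snd p) u)"
    if \<tau>: "continuous_map (prod_topology ?I ?X) euclideanreal \<tau>"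
      and le: "\<And>p. p \<in> topspace (prod_topology ?I ?X) \<Longrightarrow> 0 \<le> \<tau> p \<and> \<tau> p \<le> 1/2" for \<tau> u
  proof -
    have "continuous_map (prod_topology ?I ?X) euclideanreal
        (\<lambda>p. if u \<in> \<sigma> then min (\<tau> p) (\<mu> \<sigma> (snd p)) / card \<sigma> else 0)" if "\<sigma> \<in> C" for \<sigma>
      using fin\<sigma>[OF that] by (cases "u \<in> \<sigma>") (auto intro!: continuous_intros \<tau> \<mu>_cont that)
    moreover have "continuous_map (prod_topology ?I ?X) euclideanreal (\<lambda>p. Z (\<tau> p) (snd p))"
      unfolding Z_def by (intro continuous_intros \<mu>_cont \<tau> finC)
    moreover have "1 - Z (\<tau> p) (snd p) \<noteq> 0" if "p \<in> topspace (prod_topology ?I ?X)" for p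
      using Z_le[of "snd p" "\<tau> p"] le[OF that] that by (cases p) auto
    ultimately show ?thesis
      unfolding R_def
      by (intro continuous_map_real_divide continuous_map_diff continuous_map_sum coord finC) auto
  qed
  have c1: "continuous_map (prod_topology ?I ?X) ?X (\<lambda>p. R (fst p / 2) (snd p))"
    unfolding continuous_map_into_realization
    by (intro conjI allI ballI R_cont R_K continuous_intros fst_I) auto
  have c2: "continuous_map (subtopology (prod_topology ?I ?X) {p \<in> topspace (prod_topology ?I ?X). s (snd p) \<le> fst p / 2})
      ?X (\<lambda>p. h (fst p - 2 * s (snd p), R (1/2) (snd p)))" (is "continuous_map ?S _ _")
  proof -
    have 1: "continuous_map ?S euclideanreal (\<lambda>p. fst p - 2 * s (snd p))"
      by (intro continuous_map_from_subtopology continuous_intros fst_I s_cont)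
    have top: "p \<in> topspace ?S \<Longrightarrow> fst p \<in> {0..1} \<and> snd p \<in> realization_points K \<and> s (snd p) \<le> fst p / 2" for p
      by auto
    have 2: "fst p - 2 * s (snd p) \<in> {0..1}" if "p \<in> topspace ?S" for p
      using top[OF that] s_nn[of "snd p"] by auto
    have "continuous_map ?S ?I (\<lambda>p. fst p - 2 * s (snd p))"
      using 1 2 by (auto simp: continuous_map_in_subtopology)
    moreover have "continuous_map ?S ?A (\<lambda>p. R (1/2) (snd p))"
      unfolding continuous_map_into_realization
    proof (intro conjI allI ballI)
      show "continuous_map ?S euclideanreal (\<lambda>x. R (1 / 2) (snd x) v)" for v
        by (intro continuous_map_from_subtopology R_cont) auto
      fix p assume "p \<in> topspace ?S"
      then show "R (1/2) (snd p) \<in> realization_points (K - C)"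
        using top[of p] by (intro R_half) auto
    qed
    ultimately have "continuous_map ?S (prod_topology ?I ?A) (\<lambda>p. (fst p - 2 * s (snd p), R (1/2) (snd p)))"
      by (simp add: continuous_map_paired)
    then have "continuous_map ?S ?A (\<lambda>p. h (fst p - 2 * s (snd p), R (1/2) (snd p)))"
      using continuous_map_compose[OF _ h] by (simp add: o_def)
    then have "continuous_map ?S ?X (id \<circ> (\<lambda>p. h (fst p - 2 * s (snd p), R (1/2) (snd p))))"
      by (rule continuous_map_compose) (rule continuous_map_subset_realization, blast)
    then show ?thesis by simp
  qed
  have "continuous_map (prod_topology ?I ?X) ?X
      (\<lambda>p. if fst p / 2 \<le> s (snd p) then R (fst p / 2) (snd p) else h (fst p - 2 * s (snd p), R (1/2) (snd p)))"
  proof (rule continuous_map_cases_le[OF _ s_cont continuous_map_from_subtopology[OF c1] c2])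
    show "continuous_map (prod_topology ?I ?X) euclideanreal (\<lambda>p. fst p / 2)"
      by (intro continuous_map_real_divide fst_I) auto
    fix p assume p: "p \<in> topspace (prod_topology ?I ?X)" "fst p / 2 = s (snd p)"
    define t x where "t = fst p" and "x = snd p"
    then have tx: "p = (t, x)" "t \<in> {0..1}" "x \<in> realization_points K" "s x = t / 2"
      using p by (auto simp: mem_Times_iff prod_eq_iff)
    have "\<mu> \<sigma> x \<le> t / 2" if "\<sigma> \<in> C" for \<sigma>
      unfolding tx(4)[symmetric] s_def using \<mu>_nn tx(3) that finC by (intro member_le_sum) auto
    \<comment> \<open>At the seam neither cutoff is active, so both radial parameters give the same
      point, and \<open>h\<close> fixes it at time 0.\<close>
    then have eq: "min (t / 2) (\<mu> \<sigma> x) = \<mu> \<sigma> x" "min (1/2) (\<mu> \<sigma> x) = \<mu> \<sigma> x" if "\<sigma> \<in> C" for \<sigma>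
      using that tx(2) by force+
    have "R (t / 2) x = R (1/2) x" 
      unfolding R_def Z_def
      by (intro ext arg_cong2[where f = "(/)"] arg_cong2[where f = "(-)"] refl sum.cong) (auto simp: eq)
    moreover have "t - 2 * s x = 0" using tx(4) by simp
    ultimately show "R (fst p / 2) (snd p) = h (fst p - 2 * s (snd p), R (1 / 2) (snd p))"
      by (simp only: tx(1) fst_conv snd_conv h0)
  qed
  then have Hc: "continuous_map (prod_topology ?I ?X) ?X H" by (simp add: H_def case_prod_unfold)
  have Hzero: "H (0, x) = x" if "x \<in> realization_points K" for x
  proof -
    have "min 0 (\<mu> \<sigma> x) = 0" if "\<sigma> \<in> C" for \<sigma> using \<mu>_nn[OF that \<open>x \<in> _\<close>] by simp
    then have "R 0 x = x" by (auto simp: R_def Z_def cong: if_cong)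
    then show ?thesis using s_nn[OF that] by (simp add: H_def)
  qed
  have H_A: "H (t, x) = h (t, x)" if "t \<in> {0..1}" "x \<in> realization_points (K - C)" for t x
    using that s_A[OF that(2)] Z_A(2)[OF that(2)] h0 by (auto simp: H_def)
  have h_A: "h (t, x) \<in> realization_points (K - C)" if "t \<in> {0..1}" "x \<in> realization_points (K - C)" for t x
    using h that by (auto simp: continuous_map_def Pi_iff)
  show thesis
  proof (rule that[OF Hc Hzero])
    show "H (t, x) \<in> realization_points (K - C)"
      if "t \<in> {0..1}" "x \<in> realization_points (K - C)" for t x
      using h_A[OF that] H_A[OF that] by simp
    show "H (1, x) = a" if "x \<in> realization_points (K - C)" for x
      using H_A[OF _ that, of 1] h1 by simp
  qed
qed

section \<open>Spheres as quotients of simplices\<close>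

text \<open>With \<open>m\<close> the least barycentric coordinate and \<open>y\<^sub>i = x\<^sub>i - x\<^sub>0\<close>, the vector \<open>y / m\<close> identifies
  the interior of the simplex with Euclidean space and escapes to infinity at the boundary; this is
  its image under inverse stereographic projection.\<close>

definition simplex_to_sphere :: "nat \<Rightarrow> (nat \<Rightarrow> real) \<Rightarrow> nat \<Rightarrow> real" where
  "simplex_to_sphere d x =
     (let m = Min (x ` {..d}); Y = (\<Sum>i\<le>d. (x i - x 0)\<^sup>2)
      in (\<lambda>i. if i = 0 then (Y - m\<^sup>2) / (Y + m\<^sup>2)
              else if i \<le> d then 2 * m * (x i - x 0) / (Y + m\<^sup>2) else 0))"

abbreviation sphere_base :: "nat \<Rightarrow> real" where
  "sphere_base \<equiv> (\<lambda>i. if i = 0 then 1 else 0)"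

context
  fixes d :: nat and x :: "nat \<Rightarrow> real"
  assumes nn: "\<And>i. i \<le> d \<Longrightarrow> 0 \<le> x i" and sum1: "(\<Sum>i\<le>d. x i) = 1"
begin

text \<open>The sum of squares vanishes only when all coordinates agree; a minimum of 0 would then
  make them all 0, against the coordinate sum 1.\<close>

lemma simplex_denominator_pos: "0 < (\<Sum>i\<le>d. (x i - x 0)\<^sup>2) + (Min (x ` {..d}))\<^sup>2"
proof -
  define m where "m = Min (x ` {..d})"
  define Y where "Y = (\<Sum>i\<le>d. (x i - x 0)\<^sup>2)"
  have nonneg: "0 \<le> Y" "0 \<le> m\<^sup>2" by (simp_all add: Y_def sum_nonneg)
  have "\<not> (Y = 0 \<and> m\<^sup>2 = 0)"
  proof
    assume "Y = 0 \<and> m\<^sup>2 = 0"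
    then have Y: "Y = 0" and m: "m = 0" by auto
    have eq: "x i = x 0" if "i \<le> d" for i
    proof -
      have "(x i - x 0)\<^sup>2 \<le> Y" unfolding Y_def using that by (intro member_le_sum) auto
      then have "(x i - x 0)\<^sup>2 = 0" using Y by simp
      then show ?thesis by simp
    qed
    have "m \<in> x ` {..d}" unfolding m_def by (intro Min_in) auto
    then obtain i where "i \<le> d" "x i = m" by auto
    then have "x 0 = 0" using m eq[of i] by simp
    then have "x i = 0" if "i \<le> d" for i using eq[OF that] by simp
    then have "(\<Sum>i\<le>d. x i) = 0" by simp
    then show False using sum1 by simp
  qed
  then have "0 < Y + m\<^sup>2" using nonneg by linarith
  then show ?thesis by (simp only: m_def Y_def)
qed

lemma simplex_to_sphere_in_sphere:
  "(\<Sum>i\<le>d. (simplex_to_sphere d x i)\<^sup>2) = 1" "i > d \<Longrightarrow> simplex_to_sphere d x i = 0"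
proof -
  define m where "m = Min (x ` {..d})"
  define Y where "Y = (\<Sum>i\<le>d. (x i - x 0)\<^sup>2)"
  have pos: "0 < Y + m\<^sup>2" using simplex_denominator_pos by (simp add: m_def Y_def)
  have \<Phi>: "simplex_to_sphere d x i = (if i = 0 then (Y - m\<^sup>2) / (Y + m\<^sup>2)
      else if i \<le> d then 2 * m * (x i - x 0) / (Y + m\<^sup>2) else 0)" for i
    by (simp add: simplex_to_sphere_def Let_def m_def Y_def)
  show "i > d \<Longrightarrow> simplex_to_sphere d x i = 0" by (simp add: \<Phi>)
  have Y1: "Y = (\<Sum>i=1..d. (x i - x 0)\<^sup>2)"
    unfolding Y_def by (rule sum.mono_neutral_right) (auto simp: not_less_eq_eq)
  have "{..d} = insert 0 {1..d}" by auto
  then have "(\<Sum>i\<le>d. (simplex_to_sphere d x i)\<^sup>2) =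
      ((Y - m\<^sup>2) / (Y + m\<^sup>2))\<^sup>2 + (\<Sum>i=1..d. (simplex_to_sphere d x i)\<^sup>2)"
    by (simp add: \<Phi>)
  also have "(\<Sum>i=1..d. (simplex_to_sphere d x i)\<^sup>2) = (\<Sum>i=1..d. (2 * m / (Y + m\<^sup>2))\<^sup>2 * (x i - x 0)\<^sup>2)"
    by (rule sum.cong) (auto simp: \<Phi> power_mult_distrib power_divide)
  also have "\<dots> = (2 * m / (Y + m\<^sup>2))\<^sup>2 * Y" unfolding Y1 sum_distrib_left ..
  also have "((Y - m\<^sup>2) / (Y + m\<^sup>2))\<^sup>2 + (2 * m / (Y + m\<^sup>2))\<^sup>2 * Y = ((Y - m\<^sup>2)\<^sup>2 + 4 * m\<^sup>2 * Y) / (Y + m\<^sup>2)\<^sup>2"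
    by (simp add: power_divide power_mult_distrib add_divide_distrib)
  also have "(Y - m\<^sup>2)\<^sup>2 + 4 * m\<^sup>2 * Y = (Y + m\<^sup>2)\<^sup>2" by (simp add: power2_eq_square algebra_simps)
  also have "(Y + m\<^sup>2)\<^sup>2 / (Y + m\<^sup>2)\<^sup>2 = 1" using pos by simp
  finally show "(\<Sum>i\<le>d. (simplex_to_sphere d x i)\<^sup>2) = 1" .
qed

text \<open>The coordinate at index 0 equals 1 exactly when the least barycentric coordinate is 0.
  So the whole boundary, and nothing else, goes to the pole of the stereographic projection.\<close>

lemma simplex_to_sphere_eq_base_iff:
  "simplex_to_sphere d x = sphere_base \<longleftrightarrow> (\<exists>i\<le>d. x i = 0)"
proof -
  define m where "m = Min (x ` {..d})"
  define Y where "Y = (\<Sum>i\<le>d. (x i - x 0)\<^sup>2)"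
  have pos: "0 < Y + m\<^sup>2" using simplex_denominator_pos by (simp add: m_def Y_def)
  have \<Phi>: "simplex_to_sphere d x i = (if i = 0 then (Y - m\<^sup>2) / (Y + m\<^sup>2)
      else if i \<le> d then 2 * m * (x i - x 0) / (Y + m\<^sup>2) else 0)" for i
    by (simp add: simplex_to_sphere_def Let_def m_def Y_def)
  have min: "m \<in> x ` {..d}" unfolding m_def by (intro Min_in) auto
  have "(\<exists>i\<le>d. x i = 0) \<longleftrightarrow> m = 0"
  proof
    assume "\<exists>i\<le>d. x i = 0"
    then obtain i where "i \<le> d" "x i = 0" by blast
    then have "m \<le> 0" unfolding m_def by (metis Min_le atMost_iff finite_atMost finite_imageI imageI)
    then show "m = 0" using min nn by fastforce
  qed (use min in force)
  moreover have "simplex_to_sphere d x = sphere_base \<longleftrightarrow> m = 0"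
  proof
    assume "simplex_to_sphere d x = sphere_base"
    then have "simplex_to_sphere d x 0 = 1" by simp
    then have "(Y - m\<^sup>2) / (Y + m\<^sup>2) = 1" unfolding \<Phi> by (simp only: simp_thms if_True)
    then have "Y - m\<^sup>2 = Y + m\<^sup>2" using pos by (simp add: divide_eq_eq split: if_splits)
    then show "m = 0" by simp
  next
    assume "m = 0"
    moreover have "Y \<noteq> 0" using pos \<open>m = 0\<close> by auto
    ultimately show "simplex_to_sphere d x = sphere_base" by (intro ext) (simp add: \<Phi>)
  qed
  ultimately show ?thesis by simp
qed

end

text \<open>The coordinate at index 0 determines \<open>(m x)\<^sup>2 / D x\<close>; dividing the
  others by it recovers all \<open>(x i - x 0) / m x\<close>. The normalised vector
  \<open>x / m\<close> is thus known up to an additive constant.\<close>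

lemma simplex_to_sphere_inj:
  assumes x: "\<And>i. i \<le> d \<Longrightarrow> 0 < x i" "(\<Sum>i\<le>d. x i) = 1"
    and x': "\<And>i. i \<le> d \<Longrightarrow> 0 < x' i" "(\<Sum>i\<le>d. x' i) = 1"
    and eq: "simplex_to_sphere d x = simplex_to_sphere d x'" and i: "i \<le> d"
  shows "x i = x' i"
proof -
  define m where "m x = Min (x ` {..d})" for x :: "nat \<Rightarrow> real"
  define Y where "Y x = (\<Sum>i\<le>d. (x i - x 0)\<^sup>2)" for x :: "nat \<Rightarrow> real"
  have m_le: "m z \<le> z i" if "i \<le> d" for z i unfolding m_def using that by (intro Min_le) auto
  have m_in: "\<exists>i\<le>d. m z = z i" for z
  proof -
    have "m z \<in> z ` {..d}" unfolding m_def by (intro Min_in) auto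
    then show ?thesis by auto
  qed
  have m_pos: "0 < m x" "0 < m x'" using m_in[of x] m_in[of x'] x(1) x'(1) by auto
  have pos: "0 < Y x + (m x)\<^sup>2" "0 < Y x' + (m x')\<^sup>2"
    using simplex_denominator_pos[of d x] simplex_denominator_pos[of d x'] x x'
    by (auto simp: m_def Y_def less_imp_le)
  have \<Phi>: "simplex_to_sphere d z i = (if i = 0 then (Y z - (m z)\<^sup>2) / (Y z + (m z)\<^sup>2)
      else if i \<le> d then 2 * m z * (z i - z 0) / (Y z + (m z)\<^sup>2) else 0)" for z i
    by (simp add: simplex_to_sphere_def Let_def m_def Y_def)
  define D where "D z = Y z + (m z)\<^sup>2" for z
  have D: "0 < D x" "0 < D x'" using pos by (auto simp: D_def)
  have "(Y x - (m x)\<^sup>2) / D x = (Y x' - (m x')\<^sup>2) / D x'"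
    using eq \<Phi>[of x 0] \<Phi>[of x' 0] by (simp add: D_def)
  moreover have "(Y z - (m z)\<^sup>2) / D z = 1 - 2 * ((m z)\<^sup>2 / D z)" if "0 < D z" for z
    using that by (simp add: D_def field_simps)
  ultimately have mD: "(m x)\<^sup>2 / D x = (m x')\<^sup>2 / D x'" using D by simp
  have quot: "(x i - x 0) / m x = (x' i - x' 0) / m x'" if "i \<le> d" for i
  proof (cases "i = 0")
    case False
    have e: "m x * (x i - x 0) / D x = m x' * (x' i - x' 0) / D x'"
      using fun_cong[OF eq, of i] False that by (simp add: \<Phi> D_def)
    have r: "(z i - z 0) / m z = (m z * (z i - z 0) / D z) / ((m z)\<^sup>2 / D z)" if "0 < m z" "0 < D z" for z
      using that by (simp add: field_simps power2_eq_square)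
    show ?thesis using r[OF m_pos(1) D(1)] r[OF m_pos(2) D(2)] e mD by simp
  qed simp
  define t where "t z i = z i / m z" for z :: "nat \<Rightarrow> real" and i
  have t_ge: "1 \<le> t z i" if "0 < m z" "i \<le> d" for z i using that m_le[of i z] by (simp add: t_def)
  have t_one: "\<exists>i\<le>d. t z i = 1" if "0 < m z" for z using m_in[of z] that by (auto simp: t_def)
  have tt: "t x i - t x 0 = t x' i - t x' 0" if "i \<le> d" for i
    using quot[OF that] by (simp add: t_def diff_divide_distrib)
  obtain a b where a: "a \<le> d" "t x a = 1" and b: "b \<le> d" "t x' b = 1"
    using t_one m_pos by meson
  \<comment> \<open>Both normalised vectors have minimum 1, so the constant by which they differ is
    0. Their common coordinate sum is then \<open>1 / m\<close>, which recovers \<open>m\<close>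
    itself.\<close>
  have "t x 0 = t x' 0"
    using tt[OF a(1)] tt[OF b(1)] t_ge[OF m_pos(1) b(1)] t_ge[OF m_pos(2) a(1)] a b by linarith
  then have t_eq: "t x i = t x' i" if "i \<le> d" for i using tt[OF that] by simp
  have t_sum: "(\<Sum>i\<le>d. t z i) = (\<Sum>i\<le>d. z i) / m z" for z by (simp add: t_def sum_divide_distrib)
  have "1 / m x = 1 / m x'" using t_sum[of x] t_sum[of x'] t_eq x(2) x'(2) by simp
  then have "m x = m x'" by simp
  then show ?thesis using t_eq[OF i] m_pos by (simp add: t_def)
qed

text \<open>Away from the pole, stereographic projection gives prescribed values \<open>z i\<close>
  for \<open>(x i - x 0) / m\<close>, and a shift followed by a scaling turns \<open>z\<close> into
  barycentric coordinates.\<close>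

lemma simplex_to_sphere_surj:
  assumes d: "1 \<le> d" and s: "(\<Sum>i\<le>d. (s i)\<^sup>2) = 1" "\<And>i. i > d \<Longrightarrow> s i = 0"
  obtains x where "\<And>i. 0 \<le> x i" "\<And>i. i > d \<Longrightarrow> x i = 0" "(\<Sum>i\<le>d. x i) = 1" "simplex_to_sphere d x = s"
proof (cases "s = sphere_base")
  case True
  show thesis
  \<comment> \<open>As barycentric coordinates, \<open>sphere_base\<close> is the vertex with index
    0. It lies on the boundary because \<open>d \<ge> 1\<close> provides a vanishing coordinate; for
    \<open>d = 0\<close> the one-point simplex could not cover two points.\<close>
  proof (rule that[of sphere_base])
    show "(\<Sum>i\<le>d. sphere_base i) = 1" by simp
    then show "simplex_to_sphere d sphere_base = s"
      using simplex_to_sphere_eq_base_iff[of d sphere_base] d True by fastforce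
  qed auto
next
  case False
  have split: "{..d} = insert 0 {1..d}" by auto
  have sum_s: "(s 0)\<^sup>2 + (\<Sum>i=1..d. (s i)\<^sup>2) = 1" using s(1) unfolding split by simp
  have "s 0 \<noteq> 1"
  proof
    assume "s 0 = 1"
    then have "(\<Sum>i=1..d. (s i)\<^sup>2) = 0" using sum_s by simp
    then have "\<forall>i\<in>{1..d}. s i = 0" by (subst (asm) sum_nonneg_eq_0_iff) auto
    then have "s = sphere_base"
      using \<open>s 0 = 1\<close> s(2) by (intro ext) (metis One_nat_def atLeastAtMost_iff not_gr_zero not_le Suc_leI)
    then show False using False by simp
  qed
  moreover have "(s 0)\<^sup>2 \<le> 1" using sum_s by (smt (verit) sum_nonneg zero_le_power2)
  then have "s 0 \<le> 1" by (simp add: abs_square_le_1)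
  ultimately have s0: "0 < 1 - s 0" by simp
  define z where "z i = (if i = 0 \<or> i > d then 0 else s i / (1 - s 0))" for i
  define \<nu> where "\<nu> = Min (z ` {..d})"
  have \<nu>_le: "\<nu> \<le> z i" if "i \<le> d" for i unfolding \<nu>_def using that by (intro Min_le) auto
  have "\<nu> \<in> z ` {..d}" unfolding \<nu>_def by (intro Min_in) auto
  then obtain a where a: "a \<le> d" "\<nu> = z a" by auto
  \<comment> \<open>Adding \<open>1 - \<nu>\<close> makes the least entry 1, and dividing by the
    total \<open>T\<close> makes the sum 1. The least barycentric coordinate is then
    \<open>1 / T\<close>, so the ratios \<open>(x i - x 0) / m\<close> are the prescribed
    \<open>z i\<close>.\<close>
  define w where "w i = (if i \<le> d then 1 - \<nu> + z i else 0)" for i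
  define T where "T = (\<Sum>i\<le>d. w i)"
  have w_ge: "1 \<le> w i" if "i \<le> d" for i using \<nu>_le[OF that] that by (simp add: w_def)
  have "1 \<le> w 0" using w_ge by simp
  also have "w 0 \<le> T" unfolding T_def using w_ge by (intro member_le_sum) (auto intro: order_trans[OF zero_le_one])
  finally have T: "0 < T" by simp
  define x where "x i = w i / T" for i
  have x_nn: "0 \<le> x i" for i
    using w_ge[of i] T by (cases "i \<le> d") (auto simp: x_def w_def)
  have x_sum: "(\<Sum>i\<le>d. x i) = 1" using T by (simp add: x_def sum_divide_distrib[symmetric] T_def)
  have m: "Min (x ` {..d}) = 1 / T"
  proof (rule Min_eqI)
    show "1 / T \<in> x ` {..d}" using a by (auto simp: x_def w_def intro!: image_eqI[of _ _ a])
    show "\<And>y. y \<in> x ` {..d} \<Longrightarrow> 1 / T \<le> y" using w_ge T by (auto simp: x_def divide_right_mono)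
  qed simp
  have y: "x i - x 0 = z i / T" if "i \<le> d" for i
    using that by (simp add: x_def w_def z_def diff_divide_distrib[symmetric])
  define Z where "Z = (\<Sum>i\<le>d. (z i)\<^sup>2)"
  have Y: "(\<Sum>i\<le>d. (x i - x 0)\<^sup>2) = Z / T\<^sup>2"
    unfolding Z_def sum_divide_distrib by (rule sum.cong) (auto simp: y power_divide)
  have "Z = (\<Sum>i=1..d. (s i)\<^sup>2) / (1 - s 0)\<^sup>2"
  proof -
    have "Z = (\<Sum>i=1..d. (z i)\<^sup>2)" unfolding Z_def split by (simp add: z_def)
    also have "\<dots> = (\<Sum>i=1..d. (s i)\<^sup>2 / (1 - s 0)\<^sup>2)"
      by (rule sum.cong) (auto simp: z_def power_divide)
    finally show ?thesis by (simp add: sum_divide_distrib)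
  qed
  also have "(\<Sum>i=1..d. (s i)\<^sup>2) = (1 - s 0) * (1 + s 0)" using sum_s by (simp add: power2_eq_square algebra_simps)
  finally have Z: "Z = (1 + s 0) / (1 - s 0)" using s0 by (simp add: power2_eq_square)
  have Z1: "Z + 1 = 2 / (1 - s 0)" "Z - 1 = 2 * s 0 / (1 - s 0)" using s0 by (simp_all add: Z field_simps)
  have den: "Z / T\<^sup>2 + (1 / T)\<^sup>2 = (Z + 1) / T\<^sup>2" "Z / T\<^sup>2 - (1 / T)\<^sup>2 = (Z - 1) / T\<^sup>2"
    by (simp_all add: power_divide add_divide_distrib diff_divide_distrib)
  have "simplex_to_sphere d x i = s i" for i
  proof -
    consider "i = 0" | "0 < i" "i \<le> d" | "i > d" by linarith
    then show ?thesis
    proof cases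
      case 1
      then have "simplex_to_sphere d x i = ((Z - 1) / T\<^sup>2) / ((Z + 1) / T\<^sup>2)"
        by (simp add: simplex_to_sphere_def Let_def m Y den)
      also have "\<dots> = s 0" using T s0 by (simp add: Z1)
      finally show ?thesis using 1 by simp
    next
      case 2
      then have "simplex_to_sphere d x i = 2 * (1 / T) * (z i / T) / ((Z + 1) / T\<^sup>2)"
        by (simp add: simplex_to_sphere_def Let_def m Y den y[OF 2(2)])
      also have "\<dots> = s i" using T s0 2 by (simp add: Z1 z_def power2_eq_square)
      finally show ?thesis .
    next
      case 3
      then show ?thesis using s(2) by (simp add: simplex_to_sphere_def Let_def)
    qed
  qed
  then have "simplex_to_sphere d x = s" by blast
  then show thesis using that[of x] x_nn x_sum by (simp add: x_def w_def)
qed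

section \<open>Realizations as compact spaces, closed subcomplexes\<close>

lemma closedin_realization_points:
  assumes L: "fin_complex L"
  shows "closedin (powertop_real UNIV) (realization_points L)"
proof -
  let ?P = "powertop_real (UNIV :: 'a set)"
  define F where "F S = (\<Inter>v. {x \<in> topspace ?P. x v \<in> {0..}}) \<inter>
      (\<Inter>v. {x \<in> topspace ?P. (if v \<in> S then 0 else x v) \<in> {0}}) \<inter>
      {x \<in> topspace ?P. sum x S \<in> {1}}" for S
  have "closedin ?P (F S)" if "S \<in> L" for S
  proof -
    have 1: "closedin ?P {x \<in> topspace ?P. x v \<in> {0..}}" for v
      by (rule closedin_continuous_map_preimage[where Y = euclideanreal]) (auto intro: continuous_intros)
    have 2: "closedin ?P {x \<in> topspace ?P. (if v \<in> S then 0 else x v) \<in> {0}}" for v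
      by (rule closedin_continuous_map_preimage[where Y = euclideanreal], cases "v \<in> S")
        (auto intro: continuous_intros)
    have 3: "closedin ?P {x \<in> topspace ?P. sum x S \<in> {1}}"
      using fin_complexD(2)[OF L that]
      by (intro closedin_continuous_map_preimage[where Y = euclideanreal] continuous_intros) auto
    show ?thesis
      unfolding F_def by (intro closedin_Int 3 closedin_Inter) (use 1 2 in blast)+
  qed
  moreover have "realization_points L = \<Union> (F ` L)"
  proof (intro subset_antisym subsetI)
    fix x assume x: "x \<in> realization_points L"
    have "x \<in> F (supp x)"
      using realization_pointsD(1)[OF x] realization_pointsD(3)[OF x, of "supp x"]
        fin_complexD(2)[OF L realization_pointsD(2)[OF x]] by (simp add: F_def)
    then show "x \<in> \<Union> (F ` L)" using realization_pointsD(2)[OF x] by blast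
  next
    fix x assume "x \<in> \<Union> (F ` L)"
    then obtain S where S: "S \<in> L" "x \<in> F S" by blast
    show "x \<in> realization_points L"
    proof (rule realization_pointsI[OF L S(1)])
      show "x v = 0" if "v \<notin> S" for v
      proof -
        have "(if v \<in> S then 0 else x v) \<in> {0}" using S(2) by (simp add: F_def)
        then show ?thesis using that by simp
      qed
    qed (use S(2) in \<open>auto simp: F_def\<close>)
  qed
  ultimately show ?thesis
    using fin_complexD(1)[OF L] by (auto intro!: closedin_Union)
qed

text \<open>Barycentric coordinates lie in \<open>{0..1}\<close>, so the realization is a closed
  subset of a cube, which is compact by Tychonoff even when the vertex type is infinite.\<close>

lemma compact_space_realization:
  assumes L: "fin_complex L"
  shows "compact_space (geometric_realization L)"
proof -
  have "realization_points L \<subseteq> Pi\<^sub>E UNIV (\<lambda>_. {0..1})"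
  proof
    fix x :: "'a \<Rightarrow> real" assume x: "x \<in> realization_points L"
    have "x v \<le> 1" for v
    proof (cases "x v = 0")
      case False
      have "finite (supp x)" using fin_complexD(2)[OF L realization_pointsD(2)[OF x]] .
      then have "x v \<le> sum x (supp x)"
        using False realization_pointsD(1)[OF x] by (intro member_le_sum) auto
      then show ?thesis using realization_pointsD(3)[OF x \<open>finite (supp x)\<close>] by simp
    qed simp
    then show "x \<in> Pi\<^sub>E UNIV (\<lambda>_. {0..1})" using realization_pointsD(1)[OF x] by auto
  qed
  moreover have "compactin (powertop_real UNIV) (Pi\<^sub>E UNIV (\<lambda>_::'a. {0..1}))"
    by (simp add: compactin_PiE)
  ultimately have "compactin (powertop_real UNIV) (realization_points L)"
    using closedin_realization_points[OF L] by (meson closed_compactin)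
  then show ?thesis by (simp add: geometric_realization_eq compact_space_subtopology)
qed

lemma subtopology_realization:
  assumes "L \<subseteq> K"
  shows "subtopology (geometric_realization K) (realization_points L) = geometric_realization L"
  using realization_points_mono[OF assms]
  by (simp add: geometric_realization_eq subtopology_subtopology Int_absorb1)

lemma closedin_subcomplex:
  assumes "fin_complex L" "L \<subseteq> K"
  shows "closedin (geometric_realization K) (realization_points L)"
  unfolding geometric_realization_eq
  using closedin_realization_points[OF assms(1)] realization_points_mono[OF assms(2)]
  by (simp add: closedin_closed_subtopology closedin_subset_topspace)

lemma fin_complex_Pow: "finite S \<Longrightarrow> fin_complex (Pow S)"
  by (auto simp: fin_complex_def intro: finite_subset)

lemma topspace_nsphere: "topspace (nsphere d) = {x. (\<Sum>i\<le>d. (x i)\<^sup>2) = 1 \<and> (\<forall>i>d. x i = 0)}"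
  by (simp add: nsphere)

text \<open>A continuous surjection from a compact space onto a Hausdorff space is a quotient map;
  \<open>b\<close> merely numbers the vertices of the simplex.\<close>

lemma quotient_map_simplex_to_sphere:
  assumes b: "bij_betw b {..d} \<sigma>" and d: "1 \<le> d"
  shows "quotient_map (geometric_realization (Pow \<sigma>)) (nsphere d) (\<lambda>x. simplex_to_sphere d (x \<circ> b))"
proof -
  have fin: "finite \<sigma>" using b bij_betw_finite by blast
  have K: "fin_complex (Pow \<sigma>)" by (rule fin_complex_Pow[OF fin])
  have nn: "0 \<le> (x \<circ> b) i" and sum1: "(\<Sum>i\<le>d. (x \<circ> b) i) = 1"
    if x: "x \<in> realization_points (Pow \<sigma>)" for x i
  proof -
    show "0 \<le> (x \<circ> b) i" using realization_pointsD(1)[OF x] by simp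
    have "(\<Sum>i\<le>d. (x \<circ> b) i) = sum x \<sigma>"
      using sum.reindex_bij_betw[OF b, of x] by simp
    also have "\<dots> = 1" using realization_pointsD(2,3)[OF x] fin by auto
    finally show "(\<Sum>i\<le>d. (x \<circ> b) i) = 1" .
  qed
  have coord: "continuous_map (geometric_realization (Pow \<sigma>)) euclideanreal (\<lambda>x. (x \<circ> b) i)" for i
    unfolding o_def by (rule continuous_map_realization_coordinate)
  have Min_cont: "continuous_map (geometric_realization (Pow \<sigma>)) euclideanreal (\<lambda>x. Min ((x \<circ> b) ` {..d}))"
    by (intro continuous_map_Min_image coord) auto
  have cont_i: "continuous_map (geometric_realization (Pow \<sigma>)) euclideanreal (\<lambda>x. simplex_to_sphere d (x \<circ> b) i)" for i
  proof -
    have den: "(\<Sum>i\<le>d. ((x \<circ> b) i - (x \<circ> b) 0)\<^sup>2) + (Min ((x \<circ> b) ` {..d}))\<^sup>2 \<noteq> 0"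
      if "x \<in> topspace (geometric_realization (Pow \<sigma>))" for x
      using simplex_denominator_pos[of d "x \<circ> b"] nn sum1 that by fastforce
    have num: "continuous_map (geometric_realization (Pow \<sigma>)) euclideanreal (\<lambda>x. \<Sum>i\<le>d. ((x \<circ> b) i - (x \<circ> b) 0)\<^sup>2)"
      by (intro continuous_map_sum continuous_map_real_pow continuous_map_diff coord) auto
    let ?m = "\<lambda>x. Min ((x \<circ> b) ` {..d})" and ?Y = "\<lambda>x. \<Sum>i\<le>d. ((x \<circ> b) i - (x \<circ> b) 0)\<^sup>2"
    have "continuous_map (geometric_realization (Pow \<sigma>)) euclideanreal (\<lambda>x. (?Y x - (?m x)\<^sup>2) / (?Y x + (?m x)\<^sup>2))"
      by (intro continuous_map_real_divide continuous_map_add continuous_map_diff continuous_map_real_pow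
          num Min_cont den)
    moreover have "continuous_map (geometric_realization (Pow \<sigma>)) euclideanreal
        (\<lambda>x. 2 * ?m x * ((x \<circ> b) i - (x \<circ> b) 0) / (?Y x + (?m x)\<^sup>2))"
      by (intro continuous_map_real_divide continuous_map_real_mult continuous_map_real_mult_left
          continuous_map_add continuous_map_diff continuous_map_real_pow num Min_cont coord den)
    ultimately show ?thesis
      unfolding simplex_to_sphere_def Let_def by (cases "i = 0"; cases "i \<le> d"; simp only: if_True if_False simp_thms; simp)
  qed
  have sphere: "simplex_to_sphere d (x \<circ> b) \<in> topspace (nsphere d)" if "x \<in> realization_points (Pow \<sigma>)" for x
    using simplex_to_sphere_in_sphere[of d "x \<circ> b", OF nn[OF that] sum1[OF that]]
    unfolding topspace_nsphere by blast
  show ?thesis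
  proof (rule continuous_imp_quotient_map)
    show "continuous_map (geometric_realization (Pow \<sigma>)) (nsphere d) (\<lambda>x. simplex_to_sphere d (x \<circ> b))"
      using cont_i sphere
      by (simp add: nsphere continuous_map_in_subtopology continuous_map_componentwise_UNIV image_subset_iff Pi_iff)
    show "compact_space (geometric_realization (Pow \<sigma>))" by (rule compact_space_realization[OF K])
    show "Hausdorff_space (nsphere d)"
      unfolding nsphere by (intro Hausdorff_space_subtopology) (simp add: Hausdorff_space_product_topology)
    show "(\<lambda>x. simplex_to_sphere d (x \<circ> b)) ` topspace (geometric_realization (Pow \<sigma>)) = topspace (nsphere d)"
    proof (intro subset_antisym subsetI)
      fix s assume "s \<in> topspace (nsphere d)"
      then obtain y where y: "\<And>i. 0 \<le> y i" "\<And>i. i > d \<Longrightarrow> y i = 0" "(\<Sum>i\<le>d. y i) = 1" "simplex_to_sphere d y = s"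
        using simplex_to_sphere_surj[OF d, of s] by (auto simp: topspace_nsphere)
      define x where "x v = (if v \<in> \<sigma> then y (the_inv_into {..d} b v) else 0)" for v
      have inv: "(x \<circ> b) i = y i" if "i \<le> d" for i
        using that b by (auto simp: x_def bij_betw_def the_inv_into_f_f)
      have "x \<in> realization_points (Pow \<sigma>)"
      proof (rule realization_pointsI[OF K, of \<sigma>])
        have "sum x \<sigma> = (\<Sum>i\<le>d. (x \<circ> b) i)" using sum.reindex_bij_betw[OF b, of x] by simp
        then show "sum x \<sigma> = 1" using inv y(3) by simp
      qed (use y(1) in \<open>auto simp: x_def\<close>)
      moreover have "simplex_to_sphere d (x \<circ> b) = simplex_to_sphere d y"
      proof -
        have "(x \<circ> b) ` {..d} = y ` {..d}" using inv by (intro image_cong) auto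
        then show ?thesis unfolding simplex_to_sphere_def Let_def using inv by (auto simp: fun_eq_iff)
      qed
      ultimately show "s \<in> (\<lambda>x. simplex_to_sphere d (x \<circ> b)) ` topspace (geometric_realization (Pow \<sigma>))"
        using y(4) by force
    qed (use sphere in auto)
  qed
qed

text \<open>The wedge is shown to be the quotient of the realization by \<open>K - C\<close>: the
  map \<open>f\<close> sends \<open>K - C\<close> to the wedge point, wraps each critical facet
  around its own sphere, and is injective on the interiors of the critical facets. As
  \<open>K - C\<close> is contractible, the quotient map is a homotopy equivalence.\<close>

theorem homotopy_equivalent_wedge_of_spheres:
  fixes K :: "'a set set"
  assumes K: "fin_complex K" and C: "C \<subseteq> K" "C \<noteq> {}"
    and facet: "\<And>c S. c \<in> C \<Longrightarrow> S \<in> K \<Longrightarrow> c \<subseteq> S \<Longrightarrow> S = c"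
    and dim: "\<And>c. c \<in> C \<Longrightarrow> card c = Suc d" and d: "1 \<le> d"
    and contr: "contractible_space (geometric_realization (K - C))"
  shows "geometric_realization K homotopy_equivalent_space wedge_of_spheres (card C) d"
proof -
  let ?X = "geometric_realization K"
  define m where "m = card C"
  have finC: "finite C" using C(1) fin_complexD(1)[OF K] finite_subset by blast
  have K0: "fin_complex (K - C)"
    unfolding fin_complex_def using fin_complexD[OF K] facet by blast
  have m: "0 < m" using finC C(2) by (simp add: m_def card_gt_0_iff)
  obtain e where e: "bij_betw e {..<m} C"
    using ex_bij_betw_nat_finite[OF finC] by (auto simp: m_def atLeast0LessThan)
  have eC: "e j \<in> C" if "j < m" for j using e that by (auto simp: bij_betw_def)
  have e_inj: "i = j" if "e i = e j" "i < m" "j < m" for i j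
    using e that by (auto simp: bij_betw_def inj_on_def)
  have fin_e: "finite (e j)" if "j < m" for j using eC[OF that] C(1) fin_complexD(2)[OF K] by blast
  have "\<exists>b. bij_betw b {..d} (e j)" if "j < m" for j
  proof -
    have "card {..d} = card (e j)" using dim[OF eC[OF that]] by simp
    then show ?thesis using fin_e[OF that] by (intro finite_same_card_bij) auto
  qed
  then obtain b where b: "\<And>j. j < m \<Longrightarrow> bij_betw (b j) {..d} (e j)" by metis
  define q where "q j x = simplex_to_sphere d (x \<circ> b j)" for j and x :: "'a \<Rightarrow> real"
  define \<omega> where "\<omega> = (\<lambda>(i::nat, x). if x = sphere_base then None else Some (i, x))"
  let ?W = "wedge_of_spheres m d"
  let ?\<Sigma> = "sum_topology (\<lambda>_. nsphere d) {..<m}"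
  have W: "?W = quotient_topology ?\<Sigma> \<omega>" by (simp add: wedge_of_spheres_def wedge_sum_def \<omega>_def)
  have \<omega>q: "quotient_map ?\<Sigma> ?W \<omega>" unfolding W by (rule quotient_map_quotient_topology)
  have q_quot: "quotient_map (geometric_realization (Pow (e j))) (nsphere d) (q j)" if "j < m" for j
    unfolding q_def by (rule quotient_map_simplex_to_sphere[OF b[OF that] d])
  have Pow_sub: "Pow (e j) \<subseteq> K" if "j < m" for j
    using eC[OF that] C(1) fin_complexD(3)[OF K] by blast
  have q_base: "q j x = sphere_base \<longleftrightarrow> supp x \<noteq> e j" if "j < m" "x \<in> realization_points (Pow (e j))" for j x
  proof -
    have "(\<Sum>i\<le>d. (x \<circ> b j) i) = sum x (e j)" using sum.reindex_bij_betw[OF b[OF that(1)], of x] by simp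
    then have "(\<Sum>i\<le>d. (x \<circ> b j) i) = 1"
      using realization_pointsD(2,3)[OF that(2)] fin_e[OF that(1)] by auto
    then have "q j x = sphere_base \<longleftrightarrow> (\<exists>i\<le>d. (x \<circ> b j) i = 0)"
      unfolding q_def using realization_pointsD(1)[OF that(2)]
      by (intro simplex_to_sphere_eq_base_iff) auto
    also have "\<dots> \<longleftrightarrow> (\<exists>v\<in>e j. x v = 0)"
      using bij_betw_imp_surj_on[OF b[OF that(1)], symmetric] by auto
    also have "\<dots> \<longleftrightarrow> supp x \<noteq> e j" using realization_pointsD(2)[OF that(2)] by blast
    finally show ?thesis .
  qed
  define f where "f x = (if supp x \<in> C then let j = the_inv_into {..<m} e (supp x) in Some (j, q j x) else None)" for x
  have f_e: "f x = Some (j, q j x)" if "j < m" "supp x = e j" for j x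
  proof -
    have "the_inv_into {..<m} e (e j) = j" using e that(1) by (simp add: bij_betw_def the_inv_into_f_f)
    then show ?thesis using eC[OF that(1)] that(2) by (simp add: f_def)
  qed
  \<comment> \<open>The description of \<open>f\<close> on open facets persists on closed ones: a
    proper face of a critical facet is not critical, so \<open>f\<close> takes it to
    \<open>None\<close>, and \<open>q j\<close> takes it to the base point.\<close>
  have f_\<omega>: "f x = \<omega> (j, q j x)" if j: "j < m" and x: "x \<in> realization_points (Pow (e j))" for j x
  proof (cases "supp x = e j")
    case True
    then show ?thesis using f_e[OF j True] q_base[OF j x] by (simp add: \<omega>_def)
  next
    case False
    have sub: "supp x \<subseteq> e j" using realization_pointsD(2)[OF x] by blast
    have "supp x \<notin> C" using facet[of "supp x" "e j"] eC[OF j] C(1) sub False by blast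
    then show ?thesis using False q_base[OF j x] by (simp add: \<omega>_def f_def)
  qed
  have f_K0: "f x = None" if "x \<in> realization_points (K - C)" for x
    using realization_pointsD(2)[OF that] by (simp add: f_def)
  have split: "x \<in> realization_points (K - C) \<or> (\<exists>j<m. supp x = e j)" if "x \<in> realization_points K" for x
  proof (cases "supp x \<in> C")
    case True
    then show ?thesis using e by (force simp: bij_betw_def)
  next
    case False
    then show ?thesis using that by (simp add: realization_points_def)
  qed
  have in_Pow: "x \<in> realization_points (Pow (e j))" if "x \<in> realization_points K" "supp x = e j" for x j
    using that by (auto simp: realization_points_def)
  have None_W: "None \<in> topspace ?W"
  proof -
    have "(\<Sum>i\<le>d. (sphere_base i)\<^sup>2) = (\<Sum>i\<le>d. if i = 0 then 1 else 0)" by (rule sum.cong) auto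
    then have "sphere_base \<in> topspace (nsphere d)" by (simp add: topspace_nsphere)
    then have "(0, sphere_base) \<in> topspace ?\<Sigma>" using m by simp
    moreover have "\<omega> (0, sphere_base) = None" by (simp add: \<omega>_def)
    ultimately show ?thesis unfolding W topspace_quotient_topology by force
  qed
  have f_cont: "continuous_map ?X ?W f"
  \<comment> \<open>Finitely many closed pieces cover the realization: one for each critical facet
    at the indices below \<open>m\<close>, and the subcomplex \<open>K - C\<close> at the extra
    index \<open>m\<close>.\<close>
  proof (rule pasting_lemma_closed[where I = "{..m}" and f = "\<lambda>_. f" and
        T = "\<lambda>j. realization_points (if j < m then Pow (e j) else K - C)"])
    fix j assume "j \<in> {..m}"
    show "closedin ?X (realization_points (if j < m then Pow (e j) else K - C))"
      using Pow_sub[of j] fin_complex_Pow[OF fin_e] K0 by (auto intro!: closedin_subcomplex)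
    show "continuous_map (subtopology ?X (realization_points (if j < m then Pow (e j) else K - C))) ?W f"
    proof (cases "j < m")
      case True
      have "continuous_map (geometric_realization (Pow (e j))) ?\<Sigma> (Pair j \<circ> q j)"
        using continuous_map_compose[OF quotient_imp_continuous_map[OF q_quot[OF True]]
            continuous_map_component_injection[of j "{..<m}" "\<lambda>_. nsphere d"]] True by simp
      from continuous_map_compose[OF this quotient_imp_continuous_map[OF \<omega>q]]
      have "continuous_map (geometric_realization (Pow (e j))) ?W (\<omega> \<circ> (Pair j \<circ> q j))" .
      then have "continuous_map (geometric_realization (Pow (e j))) ?W f"
        by (rule continuous_map_eq) (use f_\<omega>[OF True] in auto)
      then show ?thesis using True subtopology_realization[OF Pow_sub[OF True]] by simp
    next
      case False
      have "continuous_map (geometric_realization (K - C)) ?W (\<lambda>_. None)" using None_W by simp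
      then have "continuous_map (geometric_realization (K - C)) ?W f"
        by (rule continuous_map_eq) (use f_K0 in auto)
      then show ?thesis using False subtopology_realization[of "K - C" K] by simp
    qed
  next
    fix x assume "x \<in> topspace ?X"
    then show "\<exists>j. j \<in> {..m} \<and> x \<in> realization_points (if j < m then Pow (e j) else K - C) \<and> f x = f x"
      using split[of x] in_Pow[of x]
      by (metis atMost_iff less_imp_le less_irrefl order_refl topspace_geometric_realization)
  qed auto
  have f_quot: "quotient_map ?X ?W f"
    unfolding quotient_map_def
  proof (intro conjI allI impI)
    show "f ` topspace ?X = topspace ?W"
    proof (intro subset_antisym subsetI)
      fix w assume "w \<in> topspace ?W"
      then obtain j s where js: "j < m" "s \<in> topspace (nsphere d)" "w = \<omega> (j, s)"
        unfolding W topspace_quotient_topology by auto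
      then obtain x where x: "x \<in> realization_points (Pow (e j))" "s = q j x"
        using q_quot[OF js(1)] unfolding quotient_map_def by auto
      then have "x \<in> topspace ?X" using realization_points_mono[OF Pow_sub[OF js(1)]] by auto
      moreover have "w = f x" using f_\<omega>[OF js(1) x(1)] x js by simp
      ultimately show "w \<in> f ` topspace ?X" by blast
    qed (use continuous_map_image_subset_topspace[OF f_cont] in blast)
    fix U assume U: "U \<subseteq> topspace ?W"
    show "openin ?X {x \<in> topspace ?X. f x \<in> U} = openin ?W U"
    proof
      assume "openin ?W U"
      then show "openin ?X {x \<in> topspace ?X. f x \<in> U}" by (rule openin_continuous_map_preimage[OF f_cont])
    next
      assume op: "openin ?X {x \<in> topspace ?X. f x \<in> U}"
      \<comment> \<open>Openness in the wedge is tested on each sphere separately, and there through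
        the quotient map \<open>q j\<close> from the corresponding closed facet.\<close>
      have "openin (nsphere d) {s. (j, s) \<in> {z \<in> topspace ?\<Sigma>. \<omega> z \<in> U}}" if j: "j < m" for j
      proof -
        let ?V = "{s \<in> topspace (nsphere d). \<omega> (j, s) \<in> U}"
        let ?P = "geometric_realization (Pow (e j))"
        have "openin (subtopology ?X (realization_points (Pow (e j))))
            ({x \<in> topspace ?X. f x \<in> U} \<inter> realization_points (Pow (e j)))"
          using op by (rule openin_subtopology_Int)
        then have "openin ?P ({x \<in> topspace ?X. f x \<in> U} \<inter> realization_points (Pow (e j)))"
          using subtopology_realization[OF Pow_sub[OF j]] by simp
        moreover have "{x \<in> topspace ?X. f x \<in> U} \<inter> realization_points (Pow (e j)) = {x \<in> topspace ?P. q j x \<in> ?V}"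
          using realization_points_mono[OF Pow_sub[OF j]] f_\<omega>[OF j]
            continuous_map_image_subset_topspace[OF quotient_imp_continuous_map[OF q_quot[OF j]]] by auto
        ultimately have "openin ?P {x \<in> topspace ?P. q j x \<in> ?V}" by simp
        moreover have quot: "openin ?P {x \<in> topspace ?P. q j x \<in> V} = openin (nsphere d) V"
          if "V \<subseteq> topspace (nsphere d)" for V
          using q_quot[OF j] that by (simp add: quotient_map_def)
        ultimately have "openin (nsphere d) ?V" by (subst (asm) quot) auto
        moreover have "{s. (j, s) \<in> {z \<in> topspace ?\<Sigma>. \<omega> z \<in> U}} = ?V" using j by auto
        ultimately show ?thesis by simp
      qed
      then have "openin ?\<Sigma> {z \<in> topspace ?\<Sigma>. \<omega> z \<in> U}"
        unfolding openin_sum_topology by auto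
      then show "openin ?W U"
        using U unfolding W openin_quotient_topology topspace_quotient_topology by blast
    qed
  qed
  have ne: "{} \<notin> C" using dim by force
  obtain H a where
    H: "continuous_map (prod_topology (top_of_set {0..1::real}) ?X) ?X H"
      "\<And>x. x \<in> realization_points K \<Longrightarrow> H (0, x) = x"
      "\<And>t x. t \<in> {0..1} \<Longrightarrow> x \<in> realization_points (K - C) \<Longrightarrow> H (t, x) \<in> realization_points (K - C)"
      "\<And>x. x \<in> realization_points (K - C) \<Longrightarrow> H (1, x) = a"
    by (rule homotopy_extension_crushing[OF K C(1) facet ne contr]) (assumption+, rule that, assumption+)
  have "?X homotopy_equivalent_space ?W"
  proof (rule homotopy_equivalent_quotient[OF f_quot H(1) _ _ H(3) H(4)])
    show "x \<in> topspace ?X \<Longrightarrow> H (0, x) = x" for x using H(2) by simp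
    show "realization_points (K - C) \<subseteq> topspace ?X" using realization_points_mono[of "K - C" K] by auto
    show "f x = f y" if "x \<in> realization_points (K - C)" "y \<in> realization_points (K - C)" for x y
      using that f_K0 by simp
    fix x y assume xy: "x \<in> topspace ?X" "y \<in> topspace ?X" "f x = f y"
    then have x: "x \<in> realization_points K" and y: "y \<in> realization_points K" by auto
    show "x = y \<or> x \<in> realization_points (K - C) \<and> y \<in> realization_points (K - C)"
    proof (cases "\<exists>j<m. supp x = e j")
      case True
      then obtain j where j: "j < m" "supp x = e j" by blast
      have "y \<notin> realization_points (K - C)" using f_K0[of y] f_e[OF j] xy(3) by auto
      then obtain j' where j': "j' < m" "supp y = e j'" using split[OF y] by blast
      have jj: "j' = j" "q j x = q j y" using f_e[OF j] f_e[OF j'] xy(3) by auto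
      have pos: "0 < (z \<circ> b j) i" if "z \<in> realization_points K" "supp z = e j" "i \<le> d" for z i
      proof -
        have "b j i \<in> supp z" using b[OF j(1)] that by (auto simp: bij_betw_def)
        then show ?thesis using realization_pointsD(1)[OF that(1), of "b j i"] by simp
      qed
      have sum1: "(\<Sum>i\<le>d. (z \<circ> b j) i) = 1" if "z \<in> realization_points K" "supp z = e j" for z
        using sum.reindex_bij_betw[OF b[OF j(1)], of z] realization_pointsD(3)[OF that(1) fin_e[OF j(1)]] that(2)
        by simp
      have eq: "(x \<circ> b j) i = (y \<circ> b j) i" if "i \<le> d" for i
      proof (rule simplex_to_sphere_inj[OF _ _ _ _ _ that])
        have sy: "supp y = e j" using j'(2) jj(1) by simp
        show "0 < (x \<circ> b j) i" "0 < (y \<circ> b j) i" if "i \<le> d" for i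
          using pos[OF x j(2) that] pos[OF y sy that] by auto
        show "(\<Sum>i\<le>d. (x \<circ> b j) i) = 1" "(\<Sum>i\<le>d. (y \<circ> b j) i) = 1"
          using sum1[OF x j(2)] sum1[OF y sy] by auto
        show "simplex_to_sphere d (x \<circ> b j) = simplex_to_sphere d (y \<circ> b j)"
          using jj(2) by (simp add: q_def)
      qed
      have "x v = y v" for v
      proof (cases "v \<in> e j")
        case True
        then obtain i where "i \<le> d" "v = b j i" using b[OF j(1)] by (auto simp: bij_betw_def)
        then show ?thesis using eq[of i] by simp
      next
        case False
        then have "v \<notin> supp x" "v \<notin> supp y" using j(2) j'(2) jj(1) by auto
        then show ?thesis by simp
      qed
      then show ?thesis by blast
    next
      case False
      then have xA: "x \<in> realization_points (K - C)" using split[OF x] by blast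
      have "\<nexists>j. j < m \<and> supp y = e j" using f_K0[OF xA] f_e[of _ y] xy(3) by auto
      then show ?thesis using split[OF y] xA by blast
    qed
  qed
  then show ?thesis by (simp add: m_def)
qed

section \<open>Independence complexes of layered graphs\<close>

lemma proper_steps_imp_collapse_steps: "(proper_step V)\<^sup>*\<^sup>* K L \<Longrightarrow> (collapse_step V)\<^sup>*\<^sup>* K L"
  by (rule rtranclp_mono[THEN predicate2D]) (auto simp: proper_step_def)

lemma proper_steps_imp_equivclp: "(proper_step V)\<^sup>*\<^sup>* K L \<Longrightarrow> equivclp (proper_step V) K L"
  by (rule predicate2D[OF rtranlcp_le_equivclp])

text \<open>If every face with \<open>a\<close> and \<open>b\<close> can also take the witness
  \<open>t (a, b)\<close>, toggling that witness pairs off the faces containing both. For an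
  independence complex this adds the edge from \<open>a\<close> to \<open>b\<close> to the graph.
  The pairs are treated successively; since no witness belongs to a listed pair, toggling neither
  creates nor destroys such a pair, and earlier deletions do no harm.\<close>

lemma delete_pairs:
  assumes K: "fin_complex K" "K \<subseteq> Pow V" "K \<noteq> {}" and F: "finite F"
    and ins: "\<And>a b S. (a, b) \<in> F \<Longrightarrow> S \<in> K \<Longrightarrow> a \<in> S \<Longrightarrow> b \<in> S \<Longrightarrow> insert (t (a, b)) S \<in> K"
    and indep: "\<And>p a b. p \<in> F \<Longrightarrow> (a, b) \<in> F \<Longrightarrow> t p \<noteq> a \<and> t p \<noteq> b"
  shows "(proper_step V)\<^sup>*\<^sup>* K {S \<in> K. \<forall>(a, b)\<in>F. \<not> (a \<in> S \<and> b \<in> S)}"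
  using F ins indep
proof (induction F rule: finite_induct)
  case empty
  then show ?case by simp
next
  case (insert p F)
  obtain a b where p: "p = (a, b)" by fastforce
  define L where "L F = {S \<in> K. \<forall>(a, b)\<in>F. \<not> (a \<in> S \<and> b \<in> S)}" for F
  have IH: "(proper_step V)\<^sup>*\<^sup>* K (L F)" unfolding L_def
    by (rule insert.IH) (rule insert.prems, rule insertI2, assumption+, rule insert.prems, (rule insertI2, assumption)+)
  have L_complex: "fin_complex (L F)" for F
    unfolding fin_complex_def
  proof (intro conjI ballI)
    show "finite (L F)" using fin_complexD(1)[OF K(1)] by (simp add: L_def)
    fix S assume S: "S \<in> L F"
    then show "finite S" using fin_complexD(2)[OF K(1)] by (auto simp: L_def)
    show "Pow S \<subseteq> L F" using S fin_complexD(3)[OF K(1)] by (fastforce simp: L_def)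
  qed
  have "proper_step V (L F) (L (insert p F))"
    unfolding proper_step_def collapse_step_def
  proof (intro conjI L_complex exI[of _ "t p"] ballI)
    show "L F \<subseteq> Pow V" "L (insert p F) \<subseteq> L F" using K(2) by (auto simp: L_def)
    have "{} \<in> L (insert p F)" using fin_complex_empty_mem[OF K(1,3)] by (auto simp: L_def)
    then show "L (insert p F) \<noteq> {}" by blast
    fix S assume "S \<in> L F - L (insert p F)"
    then have S: "S \<in> K" "\<And>c e. (c, e) \<in> F \<Longrightarrow> \<not> (c \<in> S \<and> e \<in> S)" "a \<in> S" "b \<in> S"
      by (auto simp: L_def p)
    have t: "t p \<noteq> c \<and> t p \<noteq> e" if "(c, e) \<in> insert p F" for c e using insert.prems(2) that by blast
    have "insert (t p) S \<in> K" using insert.prems(1)[of a b S] S p by simp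
    then have "insert (t p) S \<in> L F" using S t by (auto simp: L_def)
    then show "insert (t p) S \<in> L F - L (insert p F)" using S by (auto simp: L_def p)
    have "S - {t p} \<in> K" using fin_complexD(3)[OF K(1) S(1)] by blast
    then have "S - {t p} \<in> L F" using S by (auto simp: L_def)
    then show "S - {t p} \<in> L F - L (insert p F)" using S t[of a b] p by (auto simp: L_def)
  qed
  with IH show ?case unfolding L_def by (rule rtranclp.rtrancl_into_rtrancl)
qed

text \<open>The diagonal pairs \<open>(a, a)\<close> turn edge addition into vertex removal. In
  graph terms this is folding: whatever is compatible with \<open>a\<close> is compatible with
  \<open>t a\<close>.\<close>

lemma delete_vertices:
  assumes K: "fin_complex K" "K \<subseteq> Pow V" "K \<noteq> {}" and Z: "finite Z"
    and ins: "\<And>a S. a \<in> Z \<Longrightarrow> S \<in> K \<Longrightarrow> a \<in> S \<Longrightarrow> insert (t a) S \<in> K"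
    and indep: "\<And>a. a \<in> Z \<Longrightarrow> t a \<notin> Z"
  shows "(proper_step V)\<^sup>*\<^sup>* K {S \<in> K. S \<inter> Z = {}}"
proof -
  have "(proper_step V)\<^sup>*\<^sup>* K {S \<in> K. \<forall>(a, b)\<in>(\<lambda>a. (a, a)) ` Z. \<not> (a \<in> S \<and> b \<in> S)}"
    by (rule delete_pairs[where t = "t \<circ> fst"]) (use K Z ins indep in auto)
  moreover have "{S \<in> K. \<forall>(a, b)\<in>(\<lambda>a. (a, a)) ` Z. \<not> (a \<in> S \<and> b \<in> S)} = {S \<in> K. S \<inter> Z = {}}" by auto
  ultimately show ?thesis by simp
qed

text \<open>The pairs \<open>(w, a)\<close> with \<open>a\<close> in \<open>Z\<close>: the vertex
  \<open>w\<close> becomes adjacent to all of \<open>Z\<close>.\<close>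

lemma delete_edges_at:
  assumes K: "fin_complex K" "K \<subseteq> Pow V" "K \<noteq> {}" and Z: "finite Z"
    and ins: "\<And>a S. a \<in> Z \<Longrightarrow> S \<in> K \<Longrightarrow> w \<in> S \<Longrightarrow> a \<in> S \<Longrightarrow> insert (t a) S \<in> K"
    and indep: "\<And>a. a \<in> Z \<Longrightarrow> t a \<notin> Z \<and> t a \<noteq> w"
  shows "(proper_step V)\<^sup>*\<^sup>* K {S \<in> K. w \<in> S \<longrightarrow> S \<inter> Z = {}}"
proof -
  have "(proper_step V)\<^sup>*\<^sup>* K {S \<in> K. \<forall>(a, b)\<in>Pair w ` Z. \<not> (a \<in> S \<and> b \<in> S)}"
    by (rule delete_pairs[where t = "t \<circ> snd"]) (use K Z ins indep in auto)
  moreover have "{S \<in> K. \<forall>(a, b)\<in>Pair w ` Z. \<not> (a \<in> S \<and> b \<in> S)} = {S \<in> K. w \<in> S \<longrightarrow> S \<inter> Z = {}}" by auto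
  ultimately show ?thesis by simp
qed

lemma collapse_step_cone:
  assumes "fin_complex K" "K \<subseteq> Pow V" "\<And>S. S \<in> K \<Longrightarrow> insert v S \<in> K"
  shows "collapse_step V K {}"
  unfolding collapse_step_def
proof (intro conjI exI[of _ v] ballI)
  fix S assume "S \<in> K - {}"
  then show "insert v S \<in> K - {}" "S - {v} \<in> K - {}" using assms fin_complexD(3)[OF assms(1)] by auto
qed (use assms in \<open>auto simp: fin_complex_def\<close>)

text \<open>\<open>None\<close> is the vertex to which the top level of the Mycielskian is contracted, and \<open>Some (i, g)\<close>
  is the vertex over \<open>g\<close> in level \<open>i\<close>. In \<open>layered V X\<close> the vertex \<open>None\<close> is adjacent to the levels
  in \<open>X\<close>.\<close>

definition conflict :: "nat \<Rightarrow> 'a \<Rightarrow> nat \<Rightarrow> 'a \<Rightarrow> bool" where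
  "conflict i g j h \<longleftrightarrow> g \<noteq> h \<and> (i = 0 \<and> j = 0 \<or> i = Suc j \<or> j = Suc i)"

definition layered :: "(nat \<times> 'a) option set \<Rightarrow> nat set \<Rightarrow> (nat \<times> 'a) option set set" where
  "layered V X = {S. S \<subseteq> V \<and>
     (\<forall>i g j h. Some (i, g) \<in> S \<longrightarrow> Some (j, h) \<in> S \<longrightarrow> \<not> conflict i g j h) \<and>
     (None \<in> S \<longrightarrow> (\<forall>i\<in>X. \<forall>g. Some (i, g) \<notin> S))}"

lemma conflict_sym: "conflict i g j h \<longleftrightarrow> conflict j h i g"
  by (auto simp: conflict_def)

lemma conflict_irrefl [simp]: "\<not> conflict i g i g"
  by (simp add: conflict_def)

lemma layered_subset_Pow: "layered V X \<subseteq> Pow V"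
  by (auto simp: layered_def)

lemma layered_nonempty: "{} \<in> layered V X"
  by (simp add: layered_def)

lemma fin_complex_layered:
  assumes "finite V" shows "fin_complex (layered V X)"
  unfolding fin_complex_def
proof (intro conjI ballI)
  show "finite (layered V X)" by (rule finite_subset[OF layered_subset_Pow]) (simp add: assms)
  fix S assume S: "S \<in> layered V X"
  then show "finite S" using assms finite_subset by (auto simp: layered_def)
  show "Pow S \<subseteq> layered V X" using S unfolding layered_def by fast
qed

lemma layeredD:
  assumes "S \<in> layered V X"
  shows "S \<subseteq> V" "Some (i, g) \<in> S \<Longrightarrow> Some (j, h) \<in> S \<Longrightarrow> \<not> conflict i g j h"
    "None \<in> S \<Longrightarrow> i \<in> X \<Longrightarrow> Some (i, g) \<notin> S"
  using assms by (auto simp: layered_def)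

lemma layered_insert_Some:
  assumes "S \<in> layered V X" "Some (i, g) \<in> V"
    and "\<And>j h. Some (j, h) \<in> S \<Longrightarrow> \<not> conflict i g j h" "None \<in> S \<Longrightarrow> i \<notin> X"
  shows "insert (Some (i, g)) S \<in> layered V X"
proof -
  have "\<not> conflict j h k g'" if "Some (j, h) \<in> insert (Some (i, g)) S" "Some (k, g') \<in> insert (Some (i, g)) S"
    for j h k g'
    using that assms(3) conflict_sym[of j h i g] layeredD(2)[OF assms(1), of j h k g'] by auto
  then show ?thesis using layeredD[OF assms(1)] assms(2,4) unfolding layered_def by auto
qed

abbreviation level :: "nat \<Rightarrow> 'a set \<Rightarrow> (nat \<times> 'a) option set" where
  "level i A \<equiv> Some ` ({i} \<times> A)"

abbreviation myc_vertices :: "'a set \<Rightarrow> nat \<Rightarrow> (nat \<times> 'a) option set" where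
  "myc_vertices A r \<equiv> insert None (Some ` ({..<r} \<times> A))"

text \<open>Recasts the outcome of an edge addition at \<open>None\<close> as a layered complex with
  one more level in \<open>X\<close>.\<close>

lemma layered_insert_level:
  assumes "\<And>g. Some (i, g) \<in> V \<Longrightarrow> g \<in> A"
  shows "{S \<in> layered V X. None \<in> S \<longrightarrow> S \<inter> level i A = {}} = layered V (insert i X)"
proof (intro subset_antisym subsetI)
  fix S assume S: "S \<in> {S \<in> layered V X. None \<in> S \<longrightarrow> S \<inter> level i A = {}}"
  have "Some (i, g) \<notin> S" if "None \<in> S" for g
  proof
    assume "Some (i, g) \<in> S"
    then have "Some (i, g) \<in> S \<inter> level i A" using S assms layeredD(1)[of S V X] by auto
    then show False using S that by blast
  qed
  then show "S \<in> layered V (insert i X)" using S by (simp add: layered_def)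
qed (auto simp: layered_def)

text \<open>The independence complex of the crown graph, \<open>K\<^sub>n \<times> K\<^sub>2\<close>, placed on the levels \<open>l\<close> and \<open>l + 1\<close>.\<close>

abbreviation crown :: "'a set \<Rightarrow> nat \<Rightarrow> (nat \<times> 'a) option set set" where
  "crown A l \<equiv> layered (level l A \<union> level (Suc l) A) {}"

lemma mycielskian_split:
  assumes A: "finite A"
  shows "equivclp (proper_step (myc_vertices A (p + 4)))
    (layered (myc_vertices A (p + 4)) {p + 3})
    (simplicial_join (myc_vertices A (p + 1)) (layered (myc_vertices A (p + 1)) {p}) (crown A (p + 2)))"
proof -
  let ?V = "myc_vertices A (p + 4)"
  have fin: "fin_complex (layered ?V X)" for X by (rule fin_complex_layered) (use A in simp)
  have ne: "layered ?V X \<noteq> {}" for X using layered_nonempty by blast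
  note L = fin layered_subset_Pow ne
  \<comment> \<open>With \<open>r = p + 4\<close>. The witness for \<open>None\<close> and
    \<open>(p, g)\<close> is \<open>(p + 2, g)\<close>: its neighbours in level \<open>p + 3\<close>
    are excluded by \<open>None\<close>, those in level \<open>p + 1\<close> by
    \<open>(p, g)\<close>.\<close>
  have "(proper_step ?V)\<^sup>*\<^sup>* (layered ?V {p + 3}) {S \<in> layered ?V {p + 3}. None \<in> S \<longrightarrow> S \<inter> level p A = {}}"
  proof (rule delete_edges_at[OF L, where t = "\<lambda>a. Some (p + 2, snd (the a))"])
    fix a S assume a: "a \<in> level p A" "S \<in> layered ?V {p + 3}" "None \<in> S" "a \<in> S"
    then obtain g where g: "a = Some (p, g)" "g \<in> A" by auto
    show "insert (Some (p + 2, snd (the a))) S \<in> layered ?V {p + 3}"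
    proof (rule layered_insert_Some[OF a(2)])
      fix j h assume h: "Some (j, h) \<in> S"
      have "\<not> conflict p g j h" "j \<noteq> p + 3" using layeredD(2,3)[OF a(2)] a(3,4) g h by auto
      then show "\<not> conflict (p + 2) (snd (the a)) j h" using g by (auto simp: conflict_def)
    qed (use g in auto)
  qed (use A in auto)
  moreover have "{S \<in> layered ?V {p + 3}. None \<in> S \<longrightarrow> S \<inter> level p A = {}} = layered ?V {p, p + 3}"
    by (rule layered_insert_level) auto
  ultimately have 1: "(proper_step ?V)\<^sup>*\<^sup>* (layered ?V {p + 3}) (layered ?V {p, p + 3})" by simp
  \<comment> \<open>The edges from \<open>None\<close> to level \<open>p + 3\<close> are removed by
    collapsing onto the same complex from the other side. The witness is now
    \<open>(p + 1, g)\<close>: its neighbours in level \<open>p\<close> are excluded by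
    \<open>None\<close>, those in level \<open>p + 2\<close> by \<open>(p + 3, g)\<close>.\<close>
  have "(proper_step ?V)\<^sup>*\<^sup>* (layered ?V {p}) {S \<in> layered ?V {p}. None \<in> S \<longrightarrow> S \<inter> level (p + 3) A = {}}"
  proof (rule delete_edges_at[OF L, where t = "\<lambda>a. Some (p + 1, snd (the a))"])
    fix a S assume a: "a \<in> level (p + 3) A" "S \<in> layered ?V {p}" "None \<in> S" "a \<in> S"
    then obtain g where g: "a = Some (p + 3, g)" "g \<in> A" by auto
    show "insert (Some (p + 1, snd (the a))) S \<in> layered ?V {p}"
    proof (rule layered_insert_Some[OF a(2)])
      fix j h assume h: "Some (j, h) \<in> S"
      have "\<not> conflict (p + 3) g j h" "j \<noteq> p" using layeredD(2,3)[OF a(2)] a(3,4) g h by auto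
      then show "\<not> conflict (p + 1) (snd (the a)) j h" using g by (auto simp: conflict_def)
    qed (use g in auto)
  qed (use A in auto)
  moreover have "{S \<in> layered ?V {p}. None \<in> S \<longrightarrow> S \<inter> level (p + 3) A = {}} = layered ?V {p, p + 3}"
    unfolding insert_commute[of p] by (rule layered_insert_level) auto
  ultimately have 2: "(proper_step ?V)\<^sup>*\<^sup>* (layered ?V {p}) (layered ?V {p, p + 3})" by simp
  \<comment> \<open>Once \<open>None\<close> is detached from the top level, the neighbours of
    \<open>(p + 3, g)\<close> all lie in level \<open>p + 2\<close> and are also neighbours of
    \<open>(p + 1, g)\<close>, so level \<open>p + 1\<close> folds onto level
    \<open>p + 3\<close>.\<close>
  have 3: "(proper_step ?V)\<^sup>*\<^sup>* (layered ?V {p}) {S \<in> layered ?V {p}. S \<inter> level (p + 1) A = {}}"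
  proof (rule delete_vertices[OF L, where t = "\<lambda>a. Some (p + 3, snd (the a))"])
    fix a S assume a: "a \<in> level (p + 1) A" "S \<in> layered ?V {p}" "a \<in> S"
    then obtain g where g: "a = Some (p + 1, g)" "g \<in> A" by auto
    show "insert (Some (p + 3, snd (the a))) S \<in> layered ?V {p}"
    proof (rule layered_insert_Some[OF a(2)])
      fix j h assume h: "Some (j, h) \<in> S"
      have "\<not> conflict (p + 1) g j h" using layeredD(2)[OF a(2)] a(3) g h by auto
      moreover have "j < p + 4" using layeredD(1)[OF a(2)] h by auto
      ultimately show "\<not> conflict (p + 3) (snd (the a)) j h" using g by (auto simp: conflict_def)
    qed (use g in auto)
  qed (use A in auto)
  let ?V' = "myc_vertices A (p + 1)"
  \<comment> \<open>Level \<open>p + 1\<close> was the only link: \<open>None\<close> and the levels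
    up to \<open>p\<close> form the shorter Mycielskian, while levels \<open>p + 2\<close> and
    \<open>p + 3\<close> carry the crown graph.\<close>
  have "{S \<in> layered ?V {p}. S \<inter> level (p + 1) A = {}} = simplicial_join ?V' (layered ?V' {p}) (crown A (p + 2))"
  proof (intro subset_antisym subsetI)
    fix S assume S: "S \<in> {S \<in> layered ?V {p}. S \<inter> level (p + 1) A = {}}"
    have "j = p + 2 \<or> j = Suc (p + 2)" "g \<in> A" if "Some (j, g) \<in> S - ?V'" for j g
    proof -
      have "Some (j, g) \<in> ?V" using S that layeredD(1)[of S ?V "{p}"] by blast
      then have j: "j < p + 4" and g: "g \<in> A" by auto
      show "g \<in> A" by (rule g)
      have "\<not> j < p + 1" using that g by auto
      moreover have "j \<noteq> p + 1"
      proof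
        assume "j = p + 1"
        then have "Some (j, g) \<in> S \<inter> level (p + 1) A" using that g by simp
        then show False using S by blast
      qed
      ultimately show "j = p + 2 \<or> j = Suc (p + 2)" using j by linarith
    qed
    note jg = this
    have "x \<in> level (p + 2) A \<union> level (Suc (p + 2)) A" if x: "x \<in> S - ?V'" for x
    proof -
      obtain j g where "x = Some (j, g)" using x by (metis DiffE insertI1 option.exhaust surj_pair)
      then show ?thesis using jg[of j g] x by blast
    qed
    then have "S - ?V' \<subseteq> level (p + 2) A \<union> level (Suc (p + 2)) A" by (rule subsetI)
    then show "S \<in> simplicial_join ?V' (layered ?V' {p}) (crown A (p + 2))"
      using S unfolding simplicial_join_def layered_def by auto
  next
    fix S assume "S \<in> simplicial_join ?V' (layered ?V' {p}) (crown A (p + 2))"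
    then have S1: "S \<inter> ?V' \<in> layered ?V' {p}" and S2: "S - ?V' \<in> crown A (p + 2)"
      by (auto simp: simplicial_join_def)
    have cases: "j \<le> p \<and> Some (j, g) \<in> S \<inter> ?V' \<or> (j = p + 2 \<or> j = p + 3) \<and> Some (j, g) \<in> S - ?V'"
      if "Some (j, g) \<in> S" for j g
      using that layeredD(1)[OF S1] layeredD(1)[OF S2] by (cases "Some (j, g) \<in> ?V'") fastforce+
    have sub: "S \<subseteq> ?V"
    proof
      fix x assume "x \<in> S"
      then have "x \<in> ?V' \<or> x \<in> level (p + 2) A \<union> level (Suc (p + 2)) A"
        using layeredD(1)[OF S1] layeredD(1)[OF S2] by blast
      then show "x \<in> ?V" by auto
    qed
    have "\<not> conflict i g j h" if "Some (i, g) \<in> S" "Some (j, h) \<in> S" for i g j h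
      using cases[OF that(1)] cases[OF that(2)] layeredD(2)[OF S1, of i g j h] layeredD(2)[OF S2, of i g j h]
      by (auto simp: conflict_def)
    moreover have "Some (p, g) \<notin> S" if "None \<in> S" for g
      using cases[of p g] layeredD(3)[OF S1, of p g] that by auto
    moreover have "S \<inter> level (p + 1) A = {}" using cases by fastforce
    ultimately show "S \<in> {S \<in> layered ?V {p}. S \<inter> level (p + 1) A = {}}"
      using sub by (auto simp: layered_def)
  qed
  with 3 have 4: "(proper_step ?V)\<^sup>*\<^sup>* (layered ?V {p})
    (simplicial_join ?V' (layered ?V' {p}) (crown A (p + 2)))" by simp
  show ?thesis
    by (rule equivclp_trans[OF proper_steps_imp_equivclp[OF 1]])
      (rule equivclp_trans[OF equivclp_sym[OF proper_steps_imp_equivclp[OF 2]] proper_steps_imp_equivclp[OF 4]])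
qed

lemma subset_Un_disjoint: "L \<inter> M = {} \<Longrightarrow> S \<subseteq> L \<union> M \<and> S \<inter> L = {} \<longleftrightarrow> S \<subseteq> M"
  by blast

text \<open>For \<open>r = 3\<close> there is no shorter Mycielskian to split off.
  \<open>None\<close> is made adjacent to level 0 with witness \<open>(1, g)\<close>, whose other
  neighbours in level 0 are excluded by \<open>(0, g)\<close>, level 0 being a clique. Next
  \<open>None\<close> is removed, and finally level 0 folds onto level 2.\<close>

lemma mycielskian_three:
  assumes A: "finite A" "x0 \<in> A"
  shows "equivclp (proper_step (myc_vertices A 3)) (layered (myc_vertices A 3) {2}) (crown A 1)"
proof -
  let ?V = "myc_vertices A 3"
  have fin: "fin_complex (layered V X)" if "V \<subseteq> ?V" for V X
    by (rule fin_complex_layered) (use A that finite_subset in blast)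
  have sub: "layered V X \<subseteq> Pow ?V" if "V \<subseteq> ?V" for V X using that layered_subset_Pow by blast
  have ne: "layered V X \<noteq> {}" for V :: "(nat \<times> 'a) option set" and X using layered_nonempty by blast
  note L = fin sub ne
  have "(proper_step ?V)\<^sup>*\<^sup>* (layered ?V {2}) {S \<in> layered ?V {2}. None \<in> S \<longrightarrow> S \<inter> level 0 A = {}}"
  proof (rule delete_edges_at[OF L, where t = "\<lambda>a. Some (1, snd (the a))"])
    fix a S assume a: "a \<in> level 0 A" "S \<in> layered ?V {2}" "None \<in> S" "a \<in> S"
    then obtain g where g: "a = Some (0, g)" "g \<in> A" by auto
    show "insert (Some (1, snd (the a))) S \<in> layered ?V {2}"
    proof (rule layered_insert_Some[OF a(2)])
      fix j h assume h: "Some (j, h) \<in> S"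
      have "\<not> conflict 0 g j h" "j \<noteq> 2" using layeredD(2,3)[OF a(2)] a(3,4) g h by auto
      then show "\<not> conflict 1 (snd (the a)) j h" using g by (auto simp: conflict_def)
    qed (use g in auto)
  qed (use A in auto)
  moreover have "{S \<in> layered ?V {2}. None \<in> S \<longrightarrow> S \<inter> level 0 A = {}} = layered ?V {0, 2}"
    by (rule layered_insert_level) auto
  ultimately have 1: "(proper_step ?V)\<^sup>*\<^sup>* (layered ?V {2}) (layered ?V {0, 2})" by simp
  \<comment> \<open>\<open>None\<close> is now adjacent to all of levels 0 and 2, which contain
    every neighbour of any vertex of level 1; hence one fixed vertex \<open>(1, x0)\<close> suffices
    as witness.\<close>
  have "(proper_step ?V)\<^sup>*\<^sup>* (layered ?V {0, 2}) {S \<in> layered ?V {0, 2}. S \<inter> {None} = {}}"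
  proof (rule delete_vertices[OF L, where t = "\<lambda>_. Some (1, x0)"])
    fix a S assume a: "a \<in> {None :: (nat \<times> 'a) option}" "S \<in> layered ?V {0, 2}" "a \<in> S"
    show "insert (Some (1, x0)) S \<in> layered ?V {0, 2}"
    proof (rule layered_insert_Some[OF a(2)])
      fix j h assume h: "Some (j, h) \<in> S"
      have "j \<noteq> 0" "j \<noteq> 2"
        using layeredD(3)[OF a(2), of 0 h] layeredD(3)[OF a(2), of 2 h] a(1,3) h by (metis insertI1 insertI2 singletonD)+
      then show "\<not> conflict 1 x0 j h" by (auto simp: conflict_def)
    qed (use A in auto)
  qed (use A in auto)
  moreover have "{S \<in> layered ?V {0, 2}. S \<inter> {None} = {}} = layered (?V - {None}) {}"
    by (auto simp: layered_def)
  ultimately have 2: "(proper_step ?V)\<^sup>*\<^sup>* (layered ?V {0, 2}) (layered (?V - {None}) {})" by simp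
  have "(proper_step ?V)\<^sup>*\<^sup>* (layered (?V - {None}) {}) {S \<in> layered (?V - {None}) {}. S \<inter> level 0 A = {}}"
  proof (rule delete_vertices[OF L, where t = "\<lambda>a. Some (2, snd (the a))"])
    fix a S assume a: "a \<in> level 0 A" "S \<in> layered (?V - {None}) {}" "a \<in> S"
    then obtain g where g: "a = Some (0, g)" "g \<in> A" by auto
    show "insert (Some (2, snd (the a))) S \<in> layered (?V - {None}) {}"
    proof (rule layered_insert_Some[OF a(2)])
      fix j h assume h: "Some (j, h) \<in> S"
      have "\<not> conflict 0 g j h" using layeredD(2)[OF a(2)] a(3) g h by auto
      moreover have "j < 3" using layeredD(1)[OF a(2)] h by auto
      ultimately show "\<not> conflict 2 (snd (the a)) j h" using g by (auto simp: conflict_def)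
    qed (use g in auto)
  qed (use A in auto)
  moreover have "{S \<in> layered (?V - {None}) {}. S \<inter> level 0 A = {}} = crown A 1"
  proof -
    have "S \<subseteq> ?V - {None} \<and> S \<inter> level 0 A = {} \<longleftrightarrow> S \<subseteq> level 1 A \<union> level (Suc 1) A" for S
    proof -
      have "{..<3} = {0, 1, Suc 1}" by auto
      then have "{..<3} \<times> A = {0} \<times> A \<union> ({1} \<times> A \<union> {Suc 1} \<times> A)" by auto
      then have "Some ` ({..<3} \<times> A) = level 0 A \<union> (level 1 A \<union> level (Suc 1) A)"
        by (simp only: image_Un)
      moreover have "?V - {None} = Some ` ({..<3} \<times> A)" by auto
      ultimately have "?V - {None} = level 0 A \<union> (level 1 A \<union> level (Suc 1) A)" by simp
      moreover have "level 0 A \<inter> (level 1 A \<union> level (Suc 1) A) = {}" by auto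
      ultimately show ?thesis by (simp only: subset_Un_disjoint)
    qed
    note F = this
    show ?thesis
      unfolding layered_def mem_Collect_eq F[symmetric] by (rule Collect_cong) (simp only: conj_ac)
  qed
  ultimately have 3: "(proper_step ?V)\<^sup>*\<^sup>* (layered (?V - {None}) {}) (crown A 1)" by simp
  show ?thesis by (rule proper_steps_imp_equivclp[OF rtranclp_trans[OF rtranclp_trans[OF 1 2] 3]])
qed

section \<open>Perfect matchings for the crown graph and the first two Mycielskians\<close>

lemma fin_complex_Diff_facets:
  assumes K: "fin_complex K" and facet: "\<And>c S. c \<in> C \<Longrightarrow> S \<in> K \<Longrightarrow> c \<subseteq> S \<Longrightarrow> S = c"
  shows "fin_complex (K - C)"
  unfolding fin_complex_def
proof (intro conjI ballI)
  show "finite (K - C)" using fin_complexD(1)[OF K] by simp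
  fix S assume S: "S \<in> K - C"
  then show "finite S" using fin_complexD(2)[OF K] by simp
  show "Pow S \<subseteq> K - C"
  proof
    fix T assume T: "T \<in> Pow S"
    then have "T \<in> K" using S fin_complexD(3)[OF K, of S T] by simp
    moreover have "T \<notin> C" using facet[of T S] S T by auto
    ultimately show "T \<in> K - C" by simp
  qed
qed

lemma fin_complex_restrict:
  assumes "fin_complex K" shows "fin_complex {S \<in> K. S \<inter> Z = {}}"
  using assms unfolding fin_complex_def by fastforce

text \<open>The complex consists of two full simplices, one per level, joined by the edges between
  equal elements. Cutting all these edges except the one over \<open>x0\<close> leaves a collapsible
  complex. The condition \<open>0 < l\<close> ensures that each level is independent, since level 0
  would be a clique.\<close>

lemma spherical_crown:
  assumes A: "finite A" "x0 \<in> A" and l: "0 < l"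
  shows "spherical (level l A \<union> level (Suc l) A) (crown A l)
    ((\<lambda>g. {Some (l, g), Some (Suc l, g)}) ` (A - {x0}))"
proof -
  let ?V = "level l A \<union> level (Suc l) A" and ?K = "crown A l"
  let ?C = "(\<lambda>g. {Some (l, g), Some (Suc l, g)}) ` (A - {x0})"
  have fin: "fin_complex ?K" by (rule fin_complex_layered) (use A in simp)
  have vert: "\<exists>j h. x = Some (j, h) \<and> (j = l \<or> j = Suc l) \<and> h \<in> A" if "S \<in> ?K" "x \<in> S" for S x
    using layeredD(1)[OF that(1)] that(2) by auto
  \<comment> \<open>A face meeting both levels is one connecting edge: two different elements on
    opposite levels conflict, so every vertex of the face lies over the same element.\<close>
  have pair: "S = {Some (l, g), Some (Suc l, g)}" if "S \<in> ?K" "Some (l, h) \<in> S" "Some (Suc l, g) \<in> S" for S g h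
  proof -
    have g: "j = l \<or> j = Suc l" "k = g" if "Some (j, k) \<in> S" for j k
      using vert[OF \<open>S \<in> ?K\<close> that] layeredD(2)[OF \<open>S \<in> ?K\<close> that \<open>Some (l, h) \<in> S\<close>]
        layeredD(2)[OF \<open>S \<in> ?K\<close> that \<open>Some (Suc l, g) \<in> S\<close>]
        layeredD(2)[OF \<open>S \<in> ?K\<close> \<open>Some (l, h) \<in> S\<close> \<open>Some (Suc l, g) \<in> S\<close>] by (auto simp: conflict_def)
    have "h = g" using g(2)[OF that(2)] .
    moreover have "S \<subseteq> {Some (l, g), Some (Suc l, g)}"
      using vert[OF that(1)] g by fastforce
    ultimately show ?thesis using that by blast
  qed
  have CK: "?C \<subseteq> ?K"
    by (auto simp: layered_def conflict_def)
  have facet: "S = c" if "c \<in> ?C" "S \<in> ?K" "c \<subseteq> S" for c S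
    using that pair[OF that(2)] by auto
  have "Some (Suc l, x0) \<notin> c \<and> Some (l, x0) \<notin> c" if "c \<in> ?C" for c using that by auto
  then have notC: "insert (Some (Suc l, x0)) S \<notin> ?C" "insert (Some (l, x0)) S \<notin> ?C" for S by blast+
  define K1 where "K1 = ?K - ?C"
  have K1: "fin_complex K1" unfolding K1_def using fin facet by (rule fin_complex_Diff_facets)
  let ?Z = "level (Suc l) (A - {x0})"
  define K2 where "K2 = {S \<in> K1. S \<inter> ?Z = {}}"
  define K3 where "K3 = {S \<in> K2. S \<inter> {Some (Suc l, x0)} = {}}"
  have fins: "fin_complex K2" "fin_complex K3"
    using K1 fin_complex_restrict unfolding K2_def K3_def by blast+
  have subs: "K1 \<subseteq> Pow ?V" "K2 \<subseteq> Pow ?V" "K3 \<subseteq> Pow ?V"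
    by (rule subset_trans[OF _ layered_subset_Pow[of ?V "{}"]]; simp add: K1_def K2_def K3_def subset_iff)+
  have ne: "K1 \<noteq> {}" "K2 \<noteq> {}"
    using layered_nonempty[of ?V "{}"] unfolding K1_def K2_def by blast+
  \<comment> \<open>With the critical edges gone, the upper simplex shrinks to
    \<open>(l + 1, x0)\<close>, then the edge over \<open>x0\<close> is retracted to the lower
    simplex, and that is a cone over \<open>(l, x0)\<close>.\<close>
  have s1: "(proper_step ?V)\<^sup>*\<^sup>* K1 K2"
    unfolding K2_def
  proof (rule delete_vertices[OF K1 subs(1) ne(1), where t = "\<lambda>_. Some (Suc l, x0)"])
    fix a S assume a: "a \<in> ?Z" "S \<in> K1" "a \<in> S"
    then obtain g where g: "a = Some (Suc l, g)" "g \<in> A" "g \<noteq> x0" by auto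
    have S: "S \<in> ?K" "S \<notin> ?C" using a(2) by (auto simp: K1_def)
    have no: "Some (l, h) \<notin> S" for h using pair[OF S(1), of h g] S(2) a(3) g by auto
    have "insert (Some (Suc l, x0)) S \<in> ?K"
    proof (rule layered_insert_Some[OF S(1)])
      fix j h assume "Some (j, h) \<in> S"
      then have "j = Suc l" using vert[OF S(1)] no by fastforce
      then show "\<not> conflict (Suc l) x0 j h" by (simp add: conflict_def)
    qed (use A in auto)
    then show "insert (Some (Suc l, x0)) S \<in> K1" using notC(1) by (simp add: K1_def)
  qed (use A in auto)
  have s2: "(proper_step ?V)\<^sup>*\<^sup>* K2 K3"
    unfolding K3_def
  proof (rule delete_vertices[OF fins(1) subs(2) ne(2), where t = "\<lambda>_. Some (l, x0)"])
    fix a S assume a: "a \<in> {Some (Suc l, x0)}" "S \<in> K2" "a \<in> S"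
    have S: "S \<in> ?K" "S \<notin> ?C" "\<And>g. g \<in> A \<Longrightarrow> g \<noteq> x0 \<Longrightarrow> Some (Suc l, g) \<notin> S"
      using a(2) by (auto simp: K1_def K2_def)
    have "insert (Some (l, x0)) S \<in> ?K"
    proof (rule layered_insert_Some[OF S(1)])
      fix j h assume "Some (j, h) \<in> S"
      then show "\<not> conflict l x0 j h" using vert[OF S(1)] S(3) l by (fastforce simp: conflict_def)
    qed (use A in auto)
    then have "insert (Some (l, x0)) S \<in> K1" using notC(2) by (simp add: K1_def)
    then show "insert (Some (l, x0)) S \<in> K2" using S(3) by (auto simp: K2_def)
  qed auto
  have last: "collapse_step ?V K3 {}"
  proof (rule collapse_step_cone[OF fins(2) subs(3), where v = "Some (l, x0)"])
    fix S assume "S \<in> K3"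
    then have S: "S \<in> ?K" "\<And>g. g \<in> A \<Longrightarrow> Some (Suc l, g) \<notin> S" by (auto simp: K1_def K2_def K3_def)
    have "insert (Some (l, x0)) S \<in> ?K"
    proof (rule layered_insert_Some[OF S(1)])
      fix j h assume "Some (j, h) \<in> S"
      then show "\<not> conflict l x0 j h" using vert[OF S(1)] S(2) l by (fastforce simp: conflict_def)
    qed (use A in auto)
    then have "insert (Some (l, x0)) S \<in> K1" using notC(2) by (simp add: K1_def)
    then show "insert (Some (l, x0)) S \<in> K3" using S(2) A by (auto simp: K2_def K3_def)
  qed
  have "(proper_step ?V)\<^sup>*\<^sup>* K1 K3" by (rule rtranclp_trans[OF s1 s2])
  then have "(collapse_step ?V)\<^sup>*\<^sup>* K1 {}"
    by (rule rtranclp.rtrancl_into_rtrancl[OF proper_steps_imp_collapse_steps last])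
  then show ?thesis
    unfolding spherical_def K1_def
    by (intro conjI ballI impI) (rule fin layered_subset_Pow CK facet | assumption)+
qed

text \<open>\<open>None\<close> is adjacent to the clique at level 0, so the graph is complete and
  its complex is a set of isolated points. The point \<open>None\<close> is matched with the empty
  face, and the others are critical.\<close>

lemma spherical_mycielskian_one:
  assumes A: "finite A"
  shows "spherical (myc_vertices A 1) (layered (myc_vertices A 1) {0}) ((\<lambda>g. {Some (0, g)}) ` A)"
proof -
  let ?V = "myc_vertices A 1" and ?C = "(\<lambda>g. {Some (0, g)}) ` A"
  let ?K = "layered ?V {0}"
  have fin: "fin_complex ?K" by (rule fin_complex_layered) (use A in simp)
  have CK: "?C \<subseteq> ?K" by (auto simp: layered_def)
  have single: "S = {Some (0, g)}" if "S \<in> ?K" "Some (0, g) \<in> S" for S g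
  proof -
    have "x = Some (0, g)" if "x \<in> S" for x
      using layeredD(1)[OF \<open>S \<in> ?K\<close>] layeredD(2)[OF \<open>S \<in> ?K\<close> \<open>Some (0, g) \<in> S\<close>]
        layeredD(3)[OF \<open>S \<in> ?K\<close>, of 0 g] that \<open>Some (0, g) \<in> S\<close> by (cases x) (auto simp: conflict_def)
    then show ?thesis using that by blast
  qed
  then have facet: "S = c" if "c \<in> ?C" "S \<in> ?K" "c \<subseteq> S" for c S using that by auto
  have "collapse_step ?V (?K - ?C) {}"
  proof (rule collapse_step_cone[where v = None])
    show "fin_complex (?K - ?C)" using fin facet by (rule fin_complex_Diff_facets)
    show "?K - ?C \<subseteq> Pow ?V" using layered_subset_Pow by blast
    fix S assume S: "S \<in> ?K - ?C"
    have "Some (0, g) \<notin> S" for g using single[of S g] S layeredD(1)[of S] by auto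
    then have "S \<subseteq> {None}" using layeredD(1)[of S ?V "{0}"] S by auto
    then show "insert None S \<in> ?K - ?C" by (auto simp: layered_def)
  qed
  then show ?thesis
    unfolding spherical_def using fin layered_subset_Pow CK facet by blast
qed

text \<open>Level 1 spans a full simplex, and each \<open>(0, g)\<close> is the middle of a path of
  two edges from \<open>(1, g)\<close> to \<open>None\<close>. Cutting the edge at
  \<open>None\<close> in all of these paths but the one over \<open>x0\<close> leaves a collapsible
  complex.\<close>

lemma spherical_mycielskian_two:
  assumes A: "finite A" "x0 \<in> A"
  shows "spherical (myc_vertices A 2) (layered (myc_vertices A 2) {1})
    ((\<lambda>g. {None, Some (0, g)}) ` (A - {x0}))"
proof -
  let ?V = "myc_vertices A 2" and ?C = "(\<lambda>g. {None, Some (0, g)}) ` (A - {x0})"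
  let ?K = "layered ?V {1}"
  have fin: "fin_complex ?K" by (rule fin_complex_layered) (use A in simp)
  have CK: "?C \<subseteq> ?K" by (auto simp: layered_def conflict_def)
  have vert: "(j = 0 \<or> j = 1) \<and> h \<in> A" if "S \<in> ?K" "Some (j, h) \<in> S" for S j h
    using layeredD(1)[OF that(1)] that(2) by (auto simp: less_2_cases_iff)
  have pair: "S = {None, Some (0, g)}" if "S \<in> ?K" "None \<in> S" "Some (0, g) \<in> S" for S g
  proof -
    have "x = None \<or> x = Some (0, g)" if "x \<in> S" for x
    proof (cases x)
      case (Some p)
      obtain j h where p: "p = (j, h)" by fastforce
      have "j = 0" using vert[OF \<open>S \<in> ?K\<close>, of j h] layeredD(3)[OF \<open>S \<in> ?K\<close> \<open>None \<in> S\<close>, of 1 h] that Some p by auto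
      then show ?thesis using layeredD(2)[OF \<open>S \<in> ?K\<close> \<open>Some (0, g) \<in> S\<close>, of j h] that Some p
        by (auto simp: conflict_def)
    qed simp
    then show ?thesis using that by blast
  qed
  have facet: "S = c" if "c \<in> ?C" "S \<in> ?K" "c \<subseteq> S" for c S
    using that pair[OF that(2)] by auto
  have C: "Some (0, x0) \<notin> c \<and> Some (1 :: nat, g) \<notin> c" if "c \<in> ?C" for c g using that by auto
  have notC: "insert (Some (0, x0)) S \<notin> ?C" "insert (Some (1, g)) S \<notin> ?C"
    for S :: "(nat \<times> 'a) option set" and g
  proof -
    show "insert (Some (0, x0)) S \<notin> ?C"
    proof
      assume "insert (Some (0, x0)) S \<in> ?C"
      from C[OF this] show False by simp
    qed
    show "insert (Some (1, g)) S \<notin> ?C"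
    proof
      assume "insert (Some (1, g)) S \<in> ?C"
      from C[OF this, of g] show False by simp
    qed
  qed
  define K1 where "K1 = ?K - ?C"
  have K1: "fin_complex K1" unfolding K1_def using fin facet by (rule fin_complex_Diff_facets)
  let ?Z = "level 0 (A - {x0})"
  define K2 where "K2 = {S \<in> K1. S \<inter> ?Z = {}}"
  define K3 where "K3 = {S \<in> K2. S \<inter> {None} = {}}"
  define K4 where "K4 = {S \<in> K3. S \<inter> {Some (0, x0)} = {}}"
  have fins: "fin_complex K2" "fin_complex K3" "fin_complex K4"
    using K1 fin_complex_restrict unfolding K2_def K3_def K4_def by blast+
  have subs: "K1 \<subseteq> Pow ?V" "K2 \<subseteq> Pow ?V" "K3 \<subseteq> Pow ?V" "K4 \<subseteq> Pow ?V"
    by (rule subset_trans[OF _ layered_subset_Pow[of ?V "{1}"]]; simp add: K1_def K2_def K3_def K4_def subset_iff)+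
  have ne: "K1 \<noteq> {}" "K2 \<noteq> {}" "K3 \<noteq> {}"
    using layered_nonempty[of ?V "{1}"] unfolding K1_def K2_def K3_def by blast+
  \<comment> \<open>The paths that were cut are now loose ends and retract to level 1,
    \<open>(0, g)\<close> being toggled against \<open>(1, g)\<close>. The remaining path then
    retracts from its end \<open>None\<close>, and finally the simplex on level 1 is a cone over
    \<open>(1, x0)\<close>.\<close>
  have s1: "(proper_step ?V)\<^sup>*\<^sup>* K1 K2"
    unfolding K2_def
  proof (rule delete_vertices[OF K1 subs(1) ne(1), where t = "\<lambda>a. Some (1, snd (the a))"])
    fix a S assume a: "a \<in> ?Z" "S \<in> K1" "a \<in> S"
    then obtain g where g: "a = Some (0, g)" "g \<in> A" "g \<noteq> x0" by auto
    have S: "S \<in> ?K" "S \<notin> ?C" using a(2) by (auto simp: K1_def)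
    have no: "None \<notin> S" using pair[OF S(1), of g] S(2) a(3) g by auto
    have "insert (Some (1, g)) S \<in> ?K"
    proof (rule layered_insert_Some[OF S(1)])
      fix j h assume h: "Some (j, h) \<in> S"
      then show "\<not> conflict 1 g j h"
        using layeredD(2)[OF S(1) a(3)[unfolded g(1)] h] vert[OF S(1) h] by (auto simp: conflict_def)
    qed (use g no in auto)
    then show "insert (Some (1, snd (the a))) S \<in> K1" using g notC(2) by (simp add: K1_def)
  qed (use A in auto)
  have s2: "(proper_step ?V)\<^sup>*\<^sup>* K2 K3"
    unfolding K3_def
  proof (rule delete_vertices[OF fins(1) subs(2) ne(2), where t = "\<lambda>_. Some (0, x0)"])
    fix a S assume a: "a \<in> {None :: (nat \<times> 'a) option}" "S \<in> K2" "a \<in> S"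
    have S: "S \<in> ?K" "S \<notin> ?C" "\<And>g. g \<in> A \<Longrightarrow> g \<noteq> x0 \<Longrightarrow> Some (0, g) \<notin> S"
      using a(2) by (auto simp: K1_def K2_def)
    have no: "Some (1, g) \<notin> S" for g using layeredD(3)[OF S(1), of 1 g] a by auto
    have "insert (Some (0, x0)) S \<in> ?K"
    proof (rule layered_insert_Some[OF S(1)])
      fix j h assume h: "Some (j, h) \<in> S"
      then show "\<not> conflict 0 x0 j h" using vert[OF S(1) h] S(3)[of h] no by (auto simp: conflict_def)
    qed (use A in auto)
    then have "insert (Some (0, x0)) S \<in> K1" using notC(1) by (simp add: K1_def)
    then show "insert (Some (0, x0)) S \<in> K2" using S(3) by (auto simp: K2_def)
  qed auto
  have s3: "(proper_step ?V)\<^sup>*\<^sup>* K3 K4"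
    unfolding K4_def
  proof (rule delete_vertices[OF fins(2) subs(3) ne(3), where t = "\<lambda>_. Some (1, x0)"])
    fix a S assume a: "a \<in> {Some (0 :: nat, x0)}" "S \<in> K3" "a \<in> S"
    have S: "S \<in> ?K" "None \<notin> S" "\<And>g. g \<in> A \<Longrightarrow> g \<noteq> x0 \<Longrightarrow> Some (0, g) \<notin> S"
      using a(2) by (auto simp: K1_def K2_def K3_def)
    have "insert (Some (1, x0)) S \<in> ?K"
    proof (rule layered_insert_Some[OF S(1)])
      fix j h assume h: "Some (j, h) \<in> S"
      then show "\<not> conflict 1 x0 j h" using vert[OF S(1) h] S(3)[of h] by (auto simp: conflict_def)
    qed (use A S in auto)
    then have "insert (Some (1, x0)) S \<in> K1" using notC(2) by (simp add: K1_def)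
    then show "insert (Some (1, x0)) S \<in> K3" using S by (auto simp: K2_def K3_def)
  qed auto
  have last: "collapse_step ?V K4 {}"
  proof (rule collapse_step_cone[OF fins(3) subs(4), where v = "Some (1, x0)"])
    fix S assume "S \<in> K4"
    then have S: "S \<in> ?K" "None \<notin> S" "\<And>g. g \<in> A \<Longrightarrow> Some (0, g) \<notin> S"
      by (auto simp: K1_def K2_def K3_def K4_def)
    have "insert (Some (1, x0)) S \<in> ?K"
    proof (rule layered_insert_Some[OF S(1)])
      fix j h assume h: "Some (j, h) \<in> S"
      then show "\<not> conflict 1 x0 j h" using vert[OF S(1) h] S(3)[of h] by (auto simp: conflict_def)
    qed (use A S in auto)
    then have "insert (Some (1, x0)) S \<in> K1" using notC(2) by (simp add: K1_def)
    then show "insert (Some (1, x0)) S \<in> K4" using S A by (auto simp: K2_def K3_def K4_def)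
  qed
  have "(proper_step ?V)\<^sup>*\<^sup>* K1 K4" by (rule rtranclp_trans[OF rtranclp_trans[OF s1 s2] s3])
  then have "(collapse_step ?V)\<^sup>*\<^sup>* K1 {}"
    by (rule rtranclp.rtrancl_into_rtrancl[OF proper_steps_imp_collapse_steps last])
  then show ?thesis
    unfolding spherical_def K1_def
    by (intro conjI ballI impI) (rule fin layered_subset_Pow CK facet | assumption)+
qed

section \<open>Generalised Mycielskians of complete graphs\<close>

lemma collapse_step_mono: "V \<subseteq> V' \<Longrightarrow> collapse_step V K L \<Longrightarrow> collapse_step V' K L"
  by (auto simp: collapse_step_def)

lemma equivclp_proper_step_mono:
  assumes "V \<subseteq> V'" "equivclp (proper_step V) K L" shows "equivclp (proper_step V') K L"
  using assms(2)
proof (induction rule: equivclp_induct)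
  case (step y z)
  then have "proper_step V' y z \<or> proper_step V' z y"
    using collapse_step_mono[OF assms(1)] by (auto simp: proper_step_def)
  then show ?case using step.IH by (rule equivclp_into_equivclp[rotated])
qed simp

lemma spherical_mono:
  assumes "V \<subseteq> V'" "spherical V K C" shows "spherical V' K C"
proof -
  have "(collapse_step V')\<^sup>*\<^sup>* (K - C) {}"
  proof (rule rtranclp_mono[THEN predicate2D])
    show "collapse_step V \<le> collapse_step V'" using collapse_step_mono[OF assms(1)] by blast
  qed (use assms(2) in \<open>simp add: spherical_def\<close>)
  moreover have "K \<subseteq> Pow V'" using assms by (auto simp: spherical_def)
  ultimately show ?thesis using assms(2) by (simp add: spherical_def)
qed

lemma spherical_wedge_of_spheres:
  assumes KC: "spherical V K C" and dim: "\<And>c. c \<in> C \<Longrightarrow> card c = Suc d" and d: "1 \<le> d" and C: "0 < card C"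
  shows "geometric_realization K homotopy_equivalent_space wedge_of_spheres (card C) d"
proof (rule homotopy_equivalent_wedge_of_spheres[OF _ _ _ _ dim d])
  show K: "fin_complex K" and "C \<subseteq> K" using KC by (auto simp: spherical_def)
  show "C \<noteq> {}" using C by auto
  then have "K \<noteq> {}" using \<open>C \<subseteq> K\<close> by auto
  then have "{} \<in> K" using fin_complex_empty_mem[OF K] by simp
  moreover have "{} \<notin> C" using dim by force
  ultimately have "K - C \<noteq> {}" by blast
  then show "contractible_space (geometric_realization (K - C))"
    using contractible_collapsible KC by (auto simp: spherical_def)
  show "\<And>c S. c \<in> C \<Longrightarrow> S \<in> K \<Longrightarrow> c \<subseteq> S \<Longrightarrow> S = c" using KC by (simp add: spherical_def)
qed

text \<open>The matching lives on some \<open>K\<close> related to the independence complex by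
  collapses and expansions in any order. \<open>m\<close> counts the future spheres, and
  \<open>e\<close> is the cardinality of a critical facet, one more than its dimension.\<close>

definition reduces_to :: "'a set \<Rightarrow> nat \<Rightarrow> nat \<Rightarrow> nat \<Rightarrow> bool" where
  "reduces_to A r m e \<longleftrightarrow> (\<exists>K C. equivclp (proper_step (myc_vertices A r)) (layered (myc_vertices A r) {r - 1}) K \<and>
     spherical (myc_vertices A r) K C \<and> card C = m \<and> (\<forall>c\<in>C. card c = e))"

section \<open>Induction in steps of three levels\<close>

lemma card_crown_facets:
  assumes "finite A" "x0 \<in> A"
  shows "card ((\<lambda>g. {Some (l :: nat, g), Some (Suc l, g)}) ` (A - {x0})) = card A - 1"
    "c \<in> (\<lambda>g. {Some (l, g), Some (Suc l, g)}) ` (A - {x0}) \<Longrightarrow> card c = 2"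
proof -
  have "inj_on (\<lambda>g. {Some (l :: nat, g), Some (Suc l, g)}) (A - {x0})"
    by (auto simp: inj_on_def doubleton_eq_iff)
  then show "card ((\<lambda>g. {Some (l :: nat, g), Some (Suc l, g)}) ` (A - {x0})) = card A - 1"
    using assms by (simp add: card_image)
qed auto

lemma reduces_to_one:
  assumes "finite A" shows "reduces_to A 1 (card A) 1"
proof -
  have "card ((\<lambda>g. {Some (0 :: nat, g)}) ` A) = card A" by (intro card_image) (auto simp: inj_on_def)
  then show ?thesis
    unfolding reduces_to_def using spherical_mycielskian_one[OF assms]
    by (intro exI[of _ "layered (myc_vertices A 1) {0}"] exI[of _ "(\<lambda>g. {Some (0, g)}) ` A"]) auto
qed

lemma reduces_to_two:
  assumes "finite A" "x0 \<in> A" shows "reduces_to A 2 (card A - 1) 2"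
proof -
  have "inj_on (\<lambda>g. {None, Some (0 :: nat, g)}) (A - {x0})" by (auto simp: inj_on_def doubleton_eq_iff)
  then have "card ((\<lambda>g. {None, Some (0 :: nat, g)}) ` (A - {x0})) = card A - 1"
    using assms by (simp add: card_image)
  then show ?thesis
    unfolding reduces_to_def using spherical_mycielskian_two[OF assms]
    by (intro exI[of _ "layered (myc_vertices A 2) {1}"] exI[of _ "(\<lambda>g. {None, Some (0, g)}) ` (A - {x0})"]) auto
qed

lemma reduces_to_three:
  assumes "finite A" "x0 \<in> A" shows "reduces_to A 3 (card A - 1) 2"
proof -
  have "spherical (myc_vertices A 3) (crown A 1) ((\<lambda>g. {Some (1, g), Some (Suc 1, g)}) ` (A - {x0}))"
    by (rule spherical_mono[OF _ spherical_crown[OF assms]]) auto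
  moreover have "equivclp (proper_step (myc_vertices A 3)) (layered (myc_vertices A 3) {3 - 1}) (crown A 1)"
    using mycielskian_three[OF assms] by simp
  ultimately show ?thesis
    unfolding reduces_to_def using card_crown_facets[OF assms, where l = 1] by blast
qed

text \<open>Three more levels amount to joining with the crown complex. A critical facet of the join
  is the union of one from each factor, which multiplies the count by \<open>card A - 1\<close> and
  adds the two vertices of a crown edge.\<close>

lemma reduces_to_step:
  assumes A: "finite A" "x0 \<in> A" and red: "reduces_to A (p + 1) m e"
  shows "reduces_to A (p + 4) (m * (card A - 1)) (e + 2)"
proof -
  let ?V = "myc_vertices A (p + 1)" and ?U = "level (p + 2) A \<union> level (Suc (p + 2)) A"
  let ?W = "myc_vertices A (p + 4)"
  let ?D = "(\<lambda>g. {Some (p + 2, g), Some (Suc (p + 2), g)}) ` (A - {x0})"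
  obtain K C where K: "equivclp (proper_step ?V) (layered ?V {p}) K" "spherical ?V K C" "card C = m"
    and e: "\<And>c. c \<in> C \<Longrightarrow> card c = e"
    using red by (auto simp: reduces_to_def)
  have disj: "?V \<inter> ?U = {}" by auto
  have sub: "?V \<union> ?U \<subseteq> ?W" by auto
  have crown: "spherical ?U (crown A (p + 2)) ?D" by (rule spherical_crown[OF A]) simp
  have fin: "fin_complex (crown A (p + 2))" "crown A (p + 2) \<subseteq> Pow ?U" using crown by (auto simp: spherical_def)
  have ne: "crown A (p + 2) \<noteq> {}" using layered_nonempty by blast
  have C: "C \<subseteq> Pow ?V" "?D \<subseteq> Pow ?U" using K(2) by (auto simp: spherical_def)
  have "equivclp (proper_step ?W) (simplicial_join ?V (layered ?V {p}) (crown A (p + 2)))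
      (simplicial_join ?V K (crown A (p + 2)))"
    by (rule equivclp_proper_step_mono[OF sub equivclp_proper_step_join[OF K(1) fin ne disj]])
  with mycielskian_split[OF A(1)]
  have "equivclp (proper_step ?W) (layered ?W {p + 3}) (simplicial_join ?V K (crown A (p + 2)))"
    by (rule equivclp_trans)
  moreover have "spherical ?W (simplicial_join ?V K (crown A (p + 2))) (simplicial_join ?V C ?D)"
    by (rule spherical_mono[OF sub spherical_join[OF K(2) crown disj]])
  moreover have "card (simplicial_join ?V C ?D) = m * (card A - 1)"
    using card_simplicial_join[OF C disj] K(3) card_crown_facets(1)[OF A, where l = "p + 2"] by simp
  moreover have "card c = e + 2" if c: "c \<in> simplicial_join ?V C ?D" for c
  proof -
    have parts: "c \<inter> ?V \<in> C" "c - ?V \<in> ?D" using c unfolding simplicial_join_def by blast+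
    have "c \<inter> ?V \<in> K" using parts(1) K(2) by (auto simp: spherical_def)
    then have f: "finite (c \<inter> ?V)" using K(2) fin_complexD(2) by (auto simp: spherical_def)
    have g: "finite (c - ?V)" using parts(2) by (metis (no_types, lifting) finite.simps imageE)
    have "card ((c \<inter> ?V) \<union> (c - ?V)) = card (c \<inter> ?V) + card (c - ?V)"
      using f g by (intro card_Un_disjoint) auto
    then show ?thesis
      using e[OF parts(1)] card_crown_facets(2)[OF A parts(2)] by (simp only: Int_Diff_Un)
  qed
  moreover have "p + 4 - 1 = p + 3" by simp
  ultimately show ?thesis
    unfolding reduces_to_def
    by (intro exI[of _ "simplicial_join ?V K (crown A (p + 2))"] exI[of _ "simplicial_join ?V C ?D"]) presburger
qed

text \<open>Each residue class is seeded by its own base case. The multiples of 3 start at 3, since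
  the step starts from an index of the form \<open>p + 1\<close>; hence \<open>3 * k + 3\<close> has
  the exponent \<open>k + 1\<close>.\<close>

lemma reduces_to_mod3:
  assumes A: "finite A" "x0 \<in> A"
  shows "reduces_to A (3 * k + 1) (card A * (card A - 1) ^ k) (2 * k + 1)"
    "reduces_to A (3 * k + 2) ((card A - 1) ^ (k + 1)) (2 * k + 2)"
    "reduces_to A (3 * k + 3) ((card A - 1) ^ (k + 1)) (2 * k + 2)"
proof (induction k)
  case 0
  show "reduces_to A (3 * 0 + 1) (card A * (card A - 1) ^ 0) (2 * 0 + 1)"
    "reduces_to A (3 * 0 + 2) ((card A - 1) ^ (0 + 1)) (2 * 0 + 2)"
    "reduces_to A (3 * 0 + 3) ((card A - 1) ^ (0 + 1)) (2 * 0 + 2)"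
    using reduces_to_one[OF A(1)] reduces_to_two[OF A] reduces_to_three[OF A]
    by (simp_all add: numeral_2_eq_2)
next
  case (Suc k)
  show "reduces_to A (3 * Suc k + 1) (card A * (card A - 1) ^ Suc k) (2 * Suc k + 1)"
    using reduces_to_step[OF A Suc(1)] by (simp add: algebra_simps)
  have "reduces_to A ((3 * k + 1) + 1) ((card A - 1) ^ (k + 1)) (2 * k + 2)" using Suc(2) by simp
  from reduces_to_step[OF A this]
  show "reduces_to A (3 * Suc k + 2) ((card A - 1) ^ (Suc k + 1)) (2 * Suc k + 2)"
    by (simp add: algebra_simps)
  have "3 * k + 3 = (3 * k + 2) + 1" by simp
  with Suc(3) have "reduces_to A ((3 * k + 2) + 1) ((card A - 1) ^ (k + 1)) (2 * k + 2)" by (simp only:)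
  from reduces_to_step[OF A this]
  show "reduces_to A (3 * Suc k + 3) ((card A - 1) ^ (Suc k + 1)) (2 * Suc k + 2)"
    by (simp add: algebra_simps)
qed

lemma reduces_to_wedge_of_spheres:
  assumes "reduces_to A r m (Suc d)" "1 \<le> d" "0 < m"
  shows "geometric_realization (layered (myc_vertices A r) {r - 1}) homotopy_equivalent_space wedge_of_spheres m d"
proof -
  obtain K C where K: "equivclp (proper_step (myc_vertices A r)) (layered (myc_vertices A r) {r - 1}) K"
    "spherical (myc_vertices A r) K C" "card C = m" "\<And>c. c \<in> C \<Longrightarrow> card c = Suc d"
    using assms(1) by (auto simp: reduces_to_def)
  have "geometric_realization K homotopy_equivalent_space wedge_of_spheres m d"
    using spherical_wedge_of_spheres[OF K(2,4) assms(2)] K(3) assms(3) by simp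
  then show ?thesis
    using simple_equivalence_homotopy_equivalent[OF K(1)] homotopy_eqv_trans by blast
qed

section \<open>From the quotient graph to the layered complex\<close>

lemma homeomorphic_realization_image:
  assumes K: "fin_complex K" and f: "inj_on f (\<Union>K)"
  shows "geometric_realization K homeomorphic_space geometric_realization ((`) f ` K)"
proof -
  let ?U = "\<Union>K" and ?K' = "(`) f ` K"
  have K': "fin_complex ?K'"
    unfolding fin_complex_def
  proof (intro conjI ballI)
    show "finite ?K'" using fin_complexD(1)[OF K] by simp
    fix T assume "T \<in> ?K'"
    then obtain S where S: "S \<in> K" "T = f ` S" by blast
    show "finite T" using S fin_complexD(2)[OF K] by simp
    show "Pow T \<subseteq> ?K'"
    proof
      fix T' assume "T' \<in> Pow T"
      then obtain S' where "S' \<subseteq> S" "T' = f ` S'" using S(2) by (auto simp: subset_image_iff)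
      then show "T' \<in> ?K'" using fin_complexD(3)[OF K S(1)] by blast
    qed
  qed
  define g where "g x = (\<lambda>b. if b \<in> f ` ?U then x (the_inv_into ?U f b) else 0)" for x :: "'a \<Rightarrow> real"
  define h where "h y = (\<lambda>a. if a \<in> ?U then y (f a) else 0)" for y :: "'b \<Rightarrow> real"
  have sub: "supp x \<subseteq> ?U" if "x \<in> realization_points K" for x using realization_pointsD(2)[OF that] by blast
  have sub': "supp y \<subseteq> f ` ?U" if y: "y \<in> realization_points ?K'" for y
    using realization_pointsD(2)[OF y] by blast
  have g_f: "g x (f a) = x a" if "a \<in> ?U" for x a using that f by (auto simp: g_def the_inv_into_f_f)
  have g_in: "g x \<in> realization_points ?K'" if x: "x \<in> realization_points K" for x
  proof (rule realization_pointsI[OF K'])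
    have S: "supp x \<in> K" by (rule realization_pointsD(2)[OF x])
    then show "f ` supp x \<in> ?K'" by blast
    have SU: "supp x \<subseteq> ?U" by (rule sub[OF x])
    show "0 \<le> g x v" for v using realization_pointsD(1)[OF x] by (simp add: g_def)
    show "g x v = 0" if "v \<notin> f ` supp x" for v
    proof (cases "v \<in> f ` ?U")
      case True
      then obtain a where "a \<in> ?U" "v = f a" by blast
      then show ?thesis using that g_f by auto
    qed (simp add: g_def)
    have "sum (g x) (f ` supp x) = sum (g x \<circ> f) (supp x)"
      by (rule sum.reindex) (rule inj_on_subset[OF f SU])
    also have "\<dots> = sum x (supp x)" using SU g_f by (intro sum.cong) auto
    also have "\<dots> = 1" using realization_pointsD(3)[OF x _ subset_refl] fin_complexD(2)[OF K S] by simp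
    finally show "sum (g x) (f ` supp x) = 1" .
  qed
  have h_in: "h y \<in> realization_points K" if y: "y \<in> realization_points ?K'" for y
  proof -
    obtain S where S: "S \<in> K" "supp y = f ` S" using realization_pointsD(2)[OF y] by blast
    show ?thesis
    proof (rule realization_pointsI[OF K S(1)])
      have SU: "S \<subseteq> ?U" using S(1) by blast
      show "0 \<le> h y v" for v using realization_pointsD(1)[OF y] by (simp add: h_def)
      show "h y v = 0" if "v \<notin> S" for v
      proof (cases "v \<in> ?U")
        case True
        then have "f v \<notin> f ` S" using that f SU by (meson inj_on_image_mem_iff)
        then show ?thesis using S(2) by (auto simp: h_def)
      qed (simp add: h_def)
      have "sum (h y) S = sum (y \<circ> f) S" using SU by (intro sum.cong) (auto simp: h_def)
      also have "\<dots> = sum y (f ` S)" by (rule sum.reindex[symmetric]) (rule inj_on_subset[OF f SU])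
      also have "\<dots> = 1" using realization_pointsD(3)[OF y] S(2) fin_complexD(2)[OF K S(1)] by simp
      finally show "sum (h y) S = 1" .
    qed
  qed
  have "continuous_map (geometric_realization K) (geometric_realization ?K') g"
    unfolding continuous_map_into_realization
  proof (intro conjI allI ballI)
    show "continuous_map (geometric_realization K) euclideanreal (\<lambda>x. g x b)" for b
      unfolding g_def by (cases "b \<in> f ` ?U") (auto intro: continuous_intros)
  qed (use g_in in simp)
  moreover have "continuous_map (geometric_realization ?K') (geometric_realization K) h"
    unfolding continuous_map_into_realization
  proof (intro conjI allI ballI)
    show "continuous_map (geometric_realization ?K') euclideanreal (\<lambda>y. h y a)" for a
      unfolding h_def by (cases "a \<in> ?U") (auto intro: continuous_intros)
  qed (use h_in in simp)
  moreover have "h (g x) = x" if x: "x \<in> realization_points K" for x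
  proof
    fix a show "h (g x) a = x a" using sub[OF x] g_f[of a x] by (cases "a \<in> ?U") (auto simp: h_def)
  qed
  moreover have "g (h y) = y" if y: "y \<in> realization_points ?K'" for y
  proof
    fix b show "g (h y) b = y b"
    proof (cases "b \<in> f ` ?U")
      case True
      then obtain a where "a \<in> ?U" "b = f a" by blast
      then show ?thesis using g_f[of a "h y"] by (simp add: h_def)
    next
      case False
      then have "y b = 0" using sub'[OF y] by blast
      then show ?thesis using False by (simp add: g_def)
    qed
  qed
  ultimately show ?thesis
    unfolding homeomorphic_space_def homeomorphic_maps_def by (intro exI[of _ g] exI[of _ h]) simp
qed

text \<open>Vertices of \<open>mycielskian\<close> are equivalence classes, while the combinatorics
  runs on \<open>None\<close> and \<open>Some (i, g)\<close>. This is the relabelling between them;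
  note that level and element swap places.\<close>

definition myc_class :: "'a set \<Rightarrow> nat \<Rightarrow> (nat \<times> 'a) option \<Rightarrow> ('a \<times> nat) set" where
  "myc_class A r x = (case x of None \<Rightarrow> A \<times> {r} | Some (i, g) \<Rightarrow> {(g, i)})"

text \<open>Adjacency of classes is read off from representatives through \<open>cls\<close>, and
  \<open>myc_class\<close> is injective, so independent sets on both sides correspond. The work is
  to check that the class of the top level sees exactly level \<open>r - 1\<close>.\<close>

lemma independence_complex_mycielskian:
  assumes G: "parcs G = {(u, v). (u, v) \<in> pverts G \<times> pverts G \<and> u \<noteq> v}"
    and A: "finite (pverts G)" "2 \<le> card (pverts G)" and r: "1 \<le> r"
  shows "independence_complex (mycielskian r G) =
    (`) (myc_class (pverts G) r) ` layered (myc_vertices (pverts G) r) {r - 1}"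
    and "inj_on (myc_class (pverts G) r) (myc_vertices (pverts G) r)"
proof -
  let ?A = "pverts G"
  let ?\<phi> = "myc_class ?A r" and ?V = "myc_vertices ?A r"
  let ?P = "categorical_product G (looped_path r)"
  define R where "R = {(u, v) \<in> pverts ?P \<times> pverts ?P. u = v \<or> snd u = r \<and> snd v = r}"
  \<comment> \<open>Arcs of the product join distinct elements, so a vertex over \<open>g\<close> in
    level \<open>r - 1\<close> meets the top level only over some other element. At least two
    vertices are needed to find one.\<close>
  have other: "\<exists>h\<in>?A. h \<noteq> g" for g
  proof (rule ccontr)
    assume "\<not> (\<exists>h\<in>?A. h \<noteq> g)"
    then have "?A \<subseteq> {g}" by blast
    then have "card ?A \<le> card {g}" by (intro card_mono) auto
    then show False using A(2) by simp
  qed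
  obtain x0 where x0: "x0 \<in> ?A" using other by blast
  have P: "pverts ?P = ?A \<times> {0..r}" by (simp add: categorical_product_def looped_path_def)
  have L: "(i, j) \<in> parcs (looped_path r) \<longleftrightarrow> i = 0 \<and> j = 0 \<or> j = Suc i \<and> i < r \<or> i = Suc j \<and> j < r" for i j
    by (auto simp: looped_path_def)
  have Parc: "((g, i), (h, j)) \<in> parcs ?P \<longleftrightarrow> g \<in> ?A \<and> h \<in> ?A \<and> g \<noteq> h \<and> (i, j) \<in> parcs (looped_path r)" for g h i j
    by (auto simp: categorical_product_def G)
  have class_lt: "R `` {(g, i)} = ?\<phi> (Some (i, g))" if "g \<in> ?A" "i < r" for g i
    using that by (auto simp: R_def P myc_class_def)
  have class_r: "R `` {(g, r)} = ?\<phi> None" if "g \<in> ?A" for g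
    using that by (auto simp: R_def P myc_class_def)
  define cls where "cls = (\<lambda>(g, i). if i < r then Some (i, g) else None :: (nat \<times> 'a) option)"
  have cls: "R `` {u} = ?\<phi> (cls u)" "cls u \<in> ?V" if u_in: "u \<in> pverts ?P" for u
  proof -
    obtain g i where u: "u = (g, i)" "g \<in> ?A" "i \<le> r" using u_in unfolding P by auto
    have "i = r" if "\<not> i < r" using that u(3) by simp
    then show "R `` {u} = ?\<phi> (cls u)" using class_lt[OF u(2), of i] class_r[OF u(2)] by (auto simp: u(1) cls_def)
    show "cls u \<in> ?V" using u by (auto simp: cls_def)
  qed
  show inj: "inj_on ?\<phi> ?V"
  proof (rule inj_onI)
    fix x y assume xy: "x \<in> ?V" "y \<in> ?V" "?\<phi> x = ?\<phi> y"
    have ne: "?\<phi> None \<noteq> ?\<phi> (Some (i, g))" if "i < r" for i g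
    proof -
      have "(x0, r) \<in> ?\<phi> None" using x0 by (simp add: myc_class_def)
      moreover have "(x0, r) \<notin> ?\<phi> (Some (i, g))" using that by (simp add: myc_class_def)
      ultimately show ?thesis by blast
    qed
    show "x = y"
    proof (cases x; cases y)
      fix p q assume "x = Some p" "y = Some q"
      then show ?thesis using xy(3) by (cases p; cases q) (simp add: myc_class_def)
    next
      fix q assume "x = None" "y = Some q"
      then show ?thesis using xy ne by auto
    next
      fix p assume "x = Some p" "y = None"
      then show ?thesis using xy ne[symmetric] by auto
    qed simp
  qed
  have quot: "mycielskian r G = quotient_graph ?P R" by (simp only: mycielskian_def Let_def R_def)
  have verts: "pverts (mycielskian r G) = ?\<phi> ` ?V"
  proof -
    have "pverts (mycielskian r G) = (\<lambda>u. R `` {u}) ` pverts ?P"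
      by (auto simp: quot quotient_graph_def quotient_def)
    also have "\<dots> = ?\<phi> ` cls ` pverts ?P" using cls(1) by (simp add: image_image cong: image_cong)
    also have "cls ` pverts ?P = ?V"
    proof (intro subset_antisym subsetI)
      fix x assume x: "x \<in> ?V"
      show "x \<in> cls ` pverts ?P"
      proof (cases x)
        case None
        then show ?thesis using x0 by (intro image_eqI[of _ _ "(x0, r)"]) (auto simp: cls_def P)
      next
        case (Some p)
        then show ?thesis using x by (cases p, intro image_eqI[of _ _ "(snd p, fst p)"]) (auto simp: cls_def P)
      qed
    qed (erule imageE, simp only: cls(2))
    finally show ?thesis .
  qed
  define adj where "adj x y \<longleftrightarrow> (\<exists>u v. (u, v) \<in> parcs ?P \<and> cls u = x \<and> cls v = y)" for x y
  have arcs: "(?\<phi> x, ?\<phi> y) \<in> parcs (mycielskian r G) \<longleftrightarrow> adj x y" if xy: "x \<in> ?V" "y \<in> ?V" for x y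
  proof -
    have eq: "R `` {u} = ?\<phi> z \<longleftrightarrow> cls u = z" if "u \<in> pverts ?P" "z \<in> ?V" for u z
      using cls[OF that(1)] that(2) inj by (auto simp: inj_on_def)
    have inP: "u \<in> pverts ?P \<and> v \<in> pverts ?P" if "(u, v) \<in> parcs ?P" for u v
      using that by (cases u; cases v) (auto simp: Parc L P)
    have "(?\<phi> x, ?\<phi> y) \<in> parcs (mycielskian r G) \<longleftrightarrow>
        (\<exists>u v. (u, v) \<in> parcs ?P \<and> R `` {u} = ?\<phi> x \<and> R `` {v} = ?\<phi> y)"
    proof -
      have "parcs (mycielskian r G) = {(R `` {u}, R `` {v}) | u v. (u, v) \<in> parcs ?P}"
        by (simp add: quot quotient_graph_def)
      then show ?thesis 
        by (simp only: mem_Collect_eq prod.inject eq_commute[of "?\<phi> x"] eq_commute[of "?\<phi> y"] conj_ac)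
    qed
    also have "\<dots> \<longleftrightarrow> adj x y"
    proof -
      have "(u, v) \<in> parcs ?P \<and> R `` {u} = ?\<phi> x \<and> R `` {v} = ?\<phi> y \<longleftrightarrow>
          (u, v) \<in> parcs ?P \<and> cls u = x \<and> cls v = y" for u v
        using eq[OF _ xy(1), of u] eq[OF _ xy(2), of v] inP[of u v] by argo
      then show ?thesis by (simp only: adj_def)
    qed
    finally show ?thesis .
  qed
  have adj_SS: "adj (Some (i, g)) (Some (j, h)) \<longleftrightarrow> conflict i g j h"
    if "i < r" "j < r" "g \<in> ?A" "h \<in> ?A" for i j g h
  proof -
    have "adj (Some (i, g)) (Some (j, h)) \<longleftrightarrow> ((g, i), (h, j)) \<in> parcs ?P"
      unfolding adj_def cls_def using that by (auto split: if_splits)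
    also have "\<dots> \<longleftrightarrow> conflict i g j h"
      using that by (auto simp: Parc L conflict_def)
    finally show ?thesis .
  qed
  have adj_NS: "adj None (Some (i, g)) \<longleftrightarrow> i = r - 1" "adj (Some (i, g)) None \<longleftrightarrow> i = r - 1"
    if ig: "i < r" "g \<in> ?A" for i g
  proof -
    obtain h where h: "h \<in> ?A" "h \<noteq> g" using other by blast
    show "adj None (Some (i, g)) \<longleftrightarrow> i = r - 1"
    proof
      assume "adj None (Some (i, g))"
      then obtain h j where hj: "((h, j), (g, i)) \<in> parcs ?P" "\<not> j < r"
        unfolding adj_def cls_def by (auto split: if_splits)
      then show "i = r - 1" using ig by (auto simp: Parc L)
    next
      assume "i = r - 1"
      then have "((h, r), (g, i)) \<in> parcs ?P" using h ig r by (auto simp: Parc L)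
      then show "adj None (Some (i, g))"
        unfolding adj_def cls_def using ig by (intro exI[of _ "(h, r)"] exI[of _ "(g, i)"]) simp
    qed
    show "adj (Some (i, g)) None \<longleftrightarrow> i = r - 1"
    proof
      assume "adj (Some (i, g)) None"
      then obtain h j where hj: "((g, i), (h, j)) \<in> parcs ?P" "\<not> j < r"
        unfolding adj_def cls_def by (auto split: if_splits)
      then show "i = r - 1" using ig by (auto simp: Parc L)
    next
      assume "i = r - 1"
      then have "((g, i), (h, r)) \<in> parcs ?P" using h ig r by (auto simp: Parc L)
      then show "adj (Some (i, g)) None"
        unfolding adj_def cls_def using ig by (intro exI[of _ "(g, i)"] exI[of _ "(h, r)"]) simp
    qed
  qed
  \<comment> \<open>The only loop of \<open>looped_path r\<close> is at 0, and
    \<open>r \<ge> 1\<close> keeps it away from the top level; so the contracted vertex carries no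
    loop and can occur in independent sets.\<close>
  have adj_NN: "\<not> adj None None"
  proof
    assume "adj None None"
    then obtain g i h j where "((g, i), (h, j)) \<in> parcs ?P" "\<not> i < r" "\<not> j < r"
      unfolding adj_def cls_def by (auto split: if_splits)
    then show False using r by (auto simp: Parc L)
  qed
  have layered_iff: "T \<in> layered ?V {r - 1} \<longleftrightarrow> (\<forall>x\<in>T. \<forall>y\<in>T. \<not> adj x y)" if T: "T \<subseteq> ?V" for T
  proof
    assume l: "T \<in> layered ?V {r - 1}"
    show "\<forall>x\<in>T. \<forall>y\<in>T. \<not> adj x y"
    proof (intro ballI)
      fix x y assume xy: "x \<in> T" "y \<in> T"
      then have "x \<in> ?V" "y \<in> ?V" using T by auto
      then show "\<not> adj x y"
        using xy adj_SS adj_NS adj_NN layeredD(2,3)[OF l] by (cases x; cases y) auto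
    qed
  next
    assume n: "\<forall>x\<in>T. \<forall>y\<in>T. \<not> adj x y"
    have V: "i < r \<and> g \<in> ?A" if "Some (i, g) \<in> T" for i g using T that by auto
    show "T \<in> layered ?V {r - 1}"
      unfolding layered_def
    proof (intro CollectI conjI allI impI ballI T)
      fix i g j h assume m: "Some (i, g) \<in> T" "Some (j, h) \<in> T"
      then show "\<not> conflict i g j h" using n V[OF m(1)] V[OF m(2)] adj_SS by blast
    next
      fix i g assume "None \<in> T" "i \<in> {r - 1}"
      then show "Some (i, g) \<notin> T" using n V[of i g] adj_NS(1)[of i g] by blast
    qed
  qed
  have finV: "finite ?V" using A(1) by simp
  show "independence_complex (mycielskian r G) = (`) ?\<phi> ` layered ?V {r - 1}"
  proof (intro subset_antisym subsetI)
    fix S assume "S \<in> independence_complex (mycielskian r G)"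
    then have S: "S \<subseteq> ?\<phi> ` ?V" "\<And>u v. u \<in> S \<Longrightarrow> v \<in> S \<Longrightarrow> (u, v) \<notin> parcs (mycielskian r G)"
      by (auto simp: independence_complex_def verts)
    obtain T where T: "T \<subseteq> ?V" "S = ?\<phi> ` T" using S(1) unfolding subset_image_iff by blast
    have "\<not> adj x y" if xy: "x \<in> T" "y \<in> T" for x y
      using S(2)[of "?\<phi> x" "?\<phi> y"] arcs[of x y] T xy by blast
    then have "T \<in> layered ?V {r - 1}" using layered_iff[OF T(1)] by blast
    then show "S \<in> (`) ?\<phi> ` layered ?V {r - 1}" using T(2) by blast
  next
    fix S assume "S \<in> (`) ?\<phi> ` layered ?V {r - 1}"
    then obtain T where T: "T \<in> layered ?V {r - 1}" "S = ?\<phi> ` T" by blast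
    have TV: "T \<subseteq> ?V" by (rule layeredD(1)[OF T(1)])
    have "finite S" using T(2) finite_subset[OF TV finV] by simp
    moreover have "S \<subseteq> ?\<phi> ` ?V" using T(2) TV by blast
    moreover have "(?\<phi> x, ?\<phi> y) \<notin> parcs (mycielskian r G)" if "x \<in> T" "y \<in> T" for x y
      using arcs[of x y] TV that T(1) layered_iff[OF TV] by blast
    ultimately show "S \<in> independence_complex (mycielskian r G)"
      unfolding independence_complex_def verts using T(2) by blast
  qed
qed

lemma independence_complex_mycielskian_equivalent:
  assumes "complete_digraph n (with_proj G)" "2 \<le> n" "1 \<le> r"
    and red: "reduces_to (pverts G) r m (Suc d)" "1 \<le> d" "0 < m"
  shows "geometric_realization (independence_complex (mycielskian r G)) homotopy_equivalent_space wedge_of_spheres m d"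
proof -
  let ?L = "layered (myc_vertices (pverts G) r) {r - 1}" and ?\<phi> = "myc_class (pverts G) r"
  have G: "finite (pverts G)" "card (pverts G) = n"
    "parcs G = {(u, v). (u, v) \<in> pverts G \<times> pverts G \<and> u \<noteq> v}"
    using assms(1) by (auto simp: complete_digraph_pair_def)
  note ind = independence_complex_mycielskian[OF G(3,1) _ assms(3)]
  have fin: "fin_complex ?L" by (rule fin_complex_layered) (use G in simp)
  have inj: "inj_on ?\<phi> (\<Union>?L)"
    by (rule inj_on_subset[OF ind(2)]) (use G(2) assms(2) layered_subset_Pow in auto)
  have "independence_complex (mycielskian r G) = (`) ?\<phi> ` ?L" using G(2) assms(2) by (intro ind(1)) simp
  then have "geometric_realization ?L homotopy_equivalent_space geometric_realization (independence_complex (mycielskian r G))"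
    using homeomorphic_imp_homotopy_equivalent_space[OF homeomorphic_realization_image[OF fin inj]] by (simp only:)
  then show ?thesis
    using reduces_to_wedge_of_spheres[OF red] homotopy_eqv_trans homotopy_equivalent_space_sym by blast
qed

theorem theorem4p13:
  fixes G :: "'a pair_pre_digraph" and n r :: nat
  assumes "n \<ge> 3" and "r \<ge> 2" and "complete_digraph n (with_proj G)"
  shows "(\<forall>k. r = 3 * k \<longrightarrow>
            geometric_realization (independence_complex (mycielskian r G))
              homotopy_equivalent_space wedge_of_spheres ((n - 1) ^ k) (2 * k - 1)) \<and>
         (\<forall>k. r = 3 * k + 1 \<longrightarrow>
            geometric_realization (independence_complex (mycielskian r G))
              homotopy_equivalent_space wedge_of_spheres (n * (n - 1) ^ k) (2 * k)) \<and>
         (\<forall>k. r = 3 * k + 2 \<longrightarrow>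
            geometric_realization (independence_complex (mycielskian r G))
              homotopy_equivalent_space wedge_of_spheres ((n - 1) ^ (k + 1)) (2 * k + 1))"
proof -
  have A: "finite (pverts G)" "card (pverts G) = n"
    using assms(3) by (auto simp: complete_digraph_pair_def)
  then obtain x0 where x0: "x0 \<in> pverts G" using assms(1) by fastforce
  note red = reduces_to_mod3[OF A(1) x0, unfolded A(2)]
  have eqv: "geometric_realization (independence_complex (mycielskian r G)) homotopy_equivalent_space wedge_of_spheres m d"
    if "reduces_to (pverts G) r m (Suc d)" "1 \<le> d" "0 < m" for m d
    using independence_complex_mycielskian_equivalent[OF assms(3) _ _ that] assms(1,2) by simp
  show ?thesis
  proof (intro conjI allI impI)
    fix k assume k: "r = 3 * k"
    \<comment> \<open>\<open>r \<ge> 2\<close> excludes \<open>k = 0\<close>, so the class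
      \<open>3 * l + 3\<close> applies, and \<open>2 * k - 1\<close> is \<open>2 * l + 1\<close>
      with no truncation of the subtraction.\<close>
    then obtain l where l: "k = Suc l" using assms(2) by (cases k) auto
    show "geometric_realization (independence_complex (mycielskian r G))
              homotopy_equivalent_space wedge_of_spheres ((n - 1) ^ k) (2 * k - 1)"
      using red(3)[of l] k l assms(1) by (intro eqv) (simp_all add: add.commute)
  next
    fix k assume k: "r = 3 * k + 1"
    show "geometric_realization (independence_complex (mycielskian r G))
              homotopy_equivalent_space wedge_of_spheres (n * (n - 1) ^ k) (2 * k)"
      \<comment> \<open>Here \<open>r \<ge> 2\<close> forces \<open>k \<ge> 1\<close>, so the
        dimension \<open>2 * k\<close> is positive, as the identification with spheres
        demands.\<close>
      using red(1)[of k] k assms(1,2) by (intro eqv) simp_all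
  next
    fix k assume k: "r = 3 * k + 2"
    show "geometric_realization (independence_complex (mycielskian r G))
              homotopy_equivalent_space wedge_of_spheres ((n - 1) ^ (k + 1)) (2 * k + 1)"
      using red(2)[of k] k assms(1) by (intro eqv) simp_all
  qed
qed

end
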